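(* Let $T>0$ and let $b$ be a weak solution on $(0,T)\times\mathbb{T}^3$ of the electron magnetohydrodynamic (EMHD) equations $$b_t+\nabla\times[(\nabla\times b)\times b]=0,\qquad \operatorname{div} b=0,$$ and let $\vec{j}=\nabla\times b$. Assume that, for $\ell$ in a neighborhood of the origin and $t\in(0,T)$, $$\Big(\int_{\mathbb{T}^{3}}|b(x+\ell,t)-b(x,t)|^{\frac92}dx\Big)^{\frac29}\leq C_1(t)^{\frac{1}{r_{1}}}|\ell|^{\alpha}\sigma_1(\ell)^{\frac13},$$ $$\Big(\int_{\mathbb{T}^{3}}|\vec{j}(x+\ell,t)-\vec{j}(x,t)|^{\frac95}dx\Big)^{\frac59}\leq C_2(t)^{\frac{1}{r_{2}}}|\ell|^{\beta}\sigma_2(\ell)^{\frac13},$$ where $\frac{2}{r_{1}}+\frac{1}{r_{2}}=1$, $1<r_{1},r_{2}<\infty$, $2\alpha+\beta\geq1$, $C_1,C_2$ are nonnegative integrable functions on $[0,T]$, and $\sigma_1,\sigma_2$ are nonnegative bounded functions on a neighborhood of the origin. Suppose that at least one of $\sigma_1,\sigma_2$ satisfies $\sigma_i(\ell)\to0$ as $\ell\to0$. Then the energy is conserved.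
   Context: $\mathbb{T}^3$ is the three-dimensional torus. A weak solution of the EMHD equations is a divergence-free field $b\in L^\infty(0,T;L^2(\mathbb{T}^3))$ satisfying the equation in the sense of distributions on $(0,T)\times\mathbb{T}^3$, where for divergence-free $b$ the Hall term is understood through the identity $\nabla\times[(\nabla\times b)\times b]=\nabla\times[\operatorname{div}(b\otimes b)]$ with $(\operatorname{div}(b\otimes b))_i=\sum_k\partial_k(b_kb_i)$. The energy is $\frac12\int_{\mathbb{T}^3}|b(x,t)|^2dx$; it is conserved if it equals a constant for almost every $t\in(0,T)$. *)

theory Defs
  imports "HOL-Analysis.Analysis"
begin

text \<open>
  The torus is \<open>\<real>\<^sup>3/\<int>\<^sup>3\<close>: fields on it are 1-periodic functions on \<open>real^3\<close>, and integrals over it are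
  Lebesgue integrals over \<open>unit_cube\<close>. Fields depending on time are curried, \<open>b t x\<close>.
\<close>

definition unit_cube :: "(real^3) set" where
  "unit_cube = {x. \<forall>i. 0 \<le> x $ i \<and> x $ i < 1}"

definition periodic :: "(real^3 \<Rightarrow> 'a) \<Rightarrow> bool" where
  "periodic f \<longleftrightarrow> (\<forall>x k. f (x + axis k 1) = f x)"

definition in_Lp :: "real \<Rightarrow> (real^3 \<Rightarrow> real^3) \<Rightarrow> bool" where
  "in_Lp p f \<longleftrightarrow> periodic f \<and> f \<in> borel_measurable (lebesgue_on unit_cube) \<and>
     integrable (lebesgue_on unit_cube) (\<lambda>x. norm (f x) powr p)"

definition Lp_norm :: "real \<Rightarrow> (real^3 \<Rightarrow> real^3) \<Rightarrow> real" where
  "Lp_norm p f = (LINT x|lebesgue_on unit_cube. norm (f x) powr p) powr (1 / p)"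

primrec k_times_cont_diff :: "nat \<Rightarrow> ('a::euclidean_space \<Rightarrow> 'b::euclidean_space) \<Rightarrow> bool" where
  "k_times_cont_diff 0 f \<longleftrightarrow> continuous_on UNIV f"
| "k_times_cont_diff (Suc k) f \<longleftrightarrow> (\<forall>x. f differentiable (at x)) \<and>
     (\<forall>v. k_times_cont_diff k (\<lambda>x. frechet_derivative f (at x) v))"

definition smooth :: "('a::euclidean_space \<Rightarrow> 'b::euclidean_space) \<Rightarrow> bool" where
  "smooth f \<longleftrightarrow> (\<forall>k. k_times_cont_diff k f)"

definition pderiv_dir :: "3 \<Rightarrow> (real^3 \<Rightarrow> 'b::euclidean_space) \<Rightarrow> real^3 \<Rightarrow> 'b" where
  "pderiv_dir k f x = frechet_derivative f (at x) (axis k 1)"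

definition grad :: "(real^3 \<Rightarrow> real) \<Rightarrow> real^3 \<Rightarrow> real^3" where
  "grad f x = (\<chi> k. pderiv_dir k f x)"

definition curl :: "(real^3 \<Rightarrow> real^3) \<Rightarrow> real^3 \<Rightarrow> real^3" where
  "curl u x = vector
     [pderiv_dir 2 u x $ 3 - pderiv_dir 3 u x $ 2,
      pderiv_dir 3 u x $ 1 - pderiv_dir 1 u x $ 3,
      pderiv_dir 1 u x $ 2 - pderiv_dir 2 u x $ 1]"

definition weakly_div_free :: "(real^3 \<Rightarrow> real^3) \<Rightarrow> bool" where
  "weakly_div_free u \<longleftrightarrow> in_Lp 1 u \<and>
     (\<forall>\<psi>. smooth \<psi> \<and> periodic \<psi> \<longrightarrow>
        (LINT x|lebesgue_on unit_cube. u x \<bullet> grad \<psi> x) = 0)"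

text \<open>\<open>has_weak_curl u v\<close>: the distributional curl of \<open>u\<close> is the integrable function \<open>v\<close>.
  The curl is formally self-adjoint, hence no sign.\<close>

definition has_weak_curl :: "(real^3 \<Rightarrow> real^3) \<Rightarrow> (real^3 \<Rightarrow> real^3) \<Rightarrow> bool" where
  "has_weak_curl u v \<longleftrightarrow> in_Lp 1 u \<and> in_Lp 1 v \<and>
     (\<forall>\<phi>. smooth \<phi> \<and> periodic \<phi> \<longrightarrow>
        (LINT x|lebesgue_on unit_cube. v x \<bullet> \<phi> x) =
        (LINT x|lebesgue_on unit_cube. u x \<bullet> curl \<phi> x))"

text \<open>Smooth vector fields with compact support in \<open>(0,T) \<times> \<real>\<^sup>3/\<int>\<^sup>3\<close>.\<close>

definition test_field :: "real \<Rightarrow> (real \<Rightarrow> real^3 \<Rightarrow> real^3) \<Rightarrow> bool" where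
  "test_field T \<phi> \<longleftrightarrow> smooth (\<lambda>(t, x). \<phi> t x) \<and> (\<forall>t. periodic (\<phi> t)) \<and>
     (\<exists>t1 t2. 0 < t1 \<and> t2 < T \<and> (\<forall>t x. t \<notin> {t1..t2} \<longrightarrow> \<phi> t x = 0))"

text \<open>
  Weak solutions of \<open>b\<^sub>t + curl ((curl b) \<times> b) = 0\<close>, \<open>div b = 0\<close>. The Hall term is read as
  \<open>curl (div (b \<otimes> b))\<close>; moving all derivatives to the test field, its pairing with \<open>\<phi>\<close> is
  \<open>- \<integral>\<integral> \<Sum>\<^sub>i \<Sum>\<^sub>k b\<^sub>k b\<^sub>i \<partial>\<^sub>k (curl \<phi>)\<^sub>i\<close>, and that of \<open>b\<^sub>t\<close> is \<open>- \<integral>\<integral> b \<bullet> \<phi>\<^sub>t\<close>. The equation below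
  is the weak form multiplied by \<open>-1\<close>.
\<close>

definition emhd_weak_solution :: "real \<Rightarrow> (real \<Rightarrow> real^3 \<Rightarrow> real^3) \<Rightarrow> bool" where
  "emhd_weak_solution T b \<longleftrightarrow>
     (\<lambda>(t, x). b t x) \<in> borel_measurable (lebesgue_on ({0<..<T} \<times> UNIV)) \<and>
     (\<exists>M. AE t in lebesgue_on {0<..<T}. in_Lp 2 (b t) \<and> Lp_norm 2 (b t) \<le> M) \<and>
     (AE t in lebesgue_on {0<..<T}. weakly_div_free (b t)) \<and>
     (\<forall>\<phi>. test_field T \<phi> \<longrightarrow>
        (LINT (t, x)|lebesgue_on ({0<..<T} \<times> unit_cube).
           b t x \<bullet> vector_derivative (\<lambda>s. \<phi> s x) (at t) +
           (\<Sum>i\<in>UNIV. \<Sum>k\<in>UNIV.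
              b t x $ k * b t x $ i * pderiv_dir k (\<lambda>y. curl (\<phi> t) y $ i) x)) = 0)"

definition energy :: "(real^3 \<Rightarrow> real^3) \<Rightarrow> real" where
  "energy u = 1 / 2 * (LINT x|lebesgue_on unit_cube. (norm (u x))\<^sup>2)"

definition energy_conserved :: "real \<Rightarrow> (real \<Rightarrow> real^3 \<Rightarrow> real^3) \<Rightarrow> bool" where
  "energy_conserved T b \<longleftrightarrow> (\<exists>c. AE t in lebesgue_on {0<..<T}. energy (b t) = c)"

end

theory Submission
  imports Defs
begin

text \<open>
  Mollify the field in space with a periodic kernel \<open>\<eta>\<close>, \<open>u = \<integral> \<eta>(l) b(x + l) dl\<close>. For fixed \<open>x\<close> the equation
  bounds the weak time derivative of \<open>u(t, x)\<close>, so the energy of \<open>u\<close> has as weak derivative (up to sign) the flux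
  \<open>\<integral> \<Sum>\<^sub>k\<^sub>i \<partial>\<^sub>k J\<^sub>i (b\<^sub>k b\<^sub>i)\<^sup>\<eta>\<close> with \<open>J = curl u\<close>. The part \<open>\<integral> \<Sum>\<^sub>k\<^sub>i \<partial>\<^sub>k J\<^sub>i u\<^sub>k u\<^sub>i\<close> vanishes, because its integrand
  is the divergence of \<open>(J \<bullet> u) u - |u|\<^sup>2/2 J\<close>. The rest is a Constantin--E--Titi commutator, quadratic in the
  increments of \<open>b\<close>, paired with \<open>\<partial>\<^sub>k J\<close>, which is linear in the increments of \<open>j\<close> and costs a factor \<open>1/\<epsilon>\<close>;
  Hoelder's inequality with exponents \<open>9/2, 9/2, 9/5\<close> bounds it by \<open>\<epsilon> powr (2\<alpha> + \<beta> - 1)\<close> times the moduli.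
  The kernel is supported where \<open>|l|\<close> is comparable to \<open>\<epsilon>\<close>, so that \<open>|l| powr \<alpha>\<close> is comparable to
  \<open>\<epsilon> powr \<alpha>\<close> whatever the sign of \<open>\<alpha>\<close>.
\<close>

section \<open>Smooth functions\<close>

text \<open>The obstacle is regularity in time: \<open>b\<close> is only bounded in time with values
  in L2, so the equation cannot be tested with a mollification of \<open>b\<close> itself. Testing
  with \<theta>(t) \<eta>(y - x) e_i at a fixed point x avoids this: a scalar function of time with
  bounded weak derivative can be squared, and x is integrated only afterwards. The scaling leaves
  nothing to spare. If 2\<alpha> + \<beta> = 1, the powers of \<epsilon> merely cancel, and all
  smallness comes from whichever modulus tends to 0. The relation 2/r1 + 1/r2 = 1 turns the time
  weights into the integrable bound C1 + C2, so the flux tends to 0 in L1 of time and the energy has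
  weak derivative 0. Measurability is the other obstacle: the fields are Lebesgue measurable, the
  bounds hold for almost every t, and the current is given separately at each time. The argument
  therefore runs for a Borel field that obeys its bounds at every time and vanishes at exceptional
  times, and the flux is expressed through \<open>b\<close> alone.\<close>

lemma k_times_cont_diffI:
  assumes "\<And>x. (f has_derivative f' x) (at x)" "\<And>v. k_times_cont_diff k (\<lambda>x. f' x v)"
  shows "k_times_cont_diff (Suc k) f"
proof -
  have "f' x = frechet_derivative f (at x)" for x
    using assms(1) by (rule frechet_derivative_at)
  then show ?thesis
    using assms by (auto simp: differentiable_def)
qed

lemma k_times_cont_diff_SucD: "k_times_cont_diff (Suc k) f \<Longrightarrow> k_times_cont_diff k f"
proof (induction k arbitrary: f)
  case 0
  then show ?case
    by (auto intro!: continuous_at_imp_continuous_on differentiable_imp_continuous_within)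
next
  case (Suc k)
  then show ?case by simp
qed

lemma k_times_cont_diff_bounded_linear:
  assumes "bounded_linear L"
  shows "k_times_cont_diff k f \<Longrightarrow> k_times_cont_diff k (\<lambda>x. L (f x))"
proof (induction k arbitrary: f)
  case 0
  then show ?case using assms by (auto intro: bounded_linear.continuous_on)
next
  case (Suc k)
  show ?case
  proof (rule k_times_cont_diffI)
    show "((\<lambda>x. L (f x)) has_derivative (\<lambda>v. L (frechet_derivative f (at x) v))) (at x)" for x
      using Suc.prems by (intro bounded_linear.has_derivative[OF assms])
        (simp add: frechet_derivative_works[symmetric])
  qed (use Suc in simp)
qed

lemma k_times_cont_diff_compose_affine:
  assumes "bounded_linear L"
  shows "k_times_cont_diff k f \<Longrightarrow> k_times_cont_diff k (\<lambda>x. f (L x + c))"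
proof (induction k arbitrary: f)
  case 0
  have "continuous_on UNIV (f \<circ> (\<lambda>x. L x + c))"
    using 0 by (intro continuous_on_compose continuous_intros bounded_linear.continuous_on[OF assms])
      (auto intro: continuous_on_subset)
  then show ?case by (simp add: o_def)
next
  case (Suc k)
  show ?case
  proof (rule k_times_cont_diffI)
    fix x
    have "((\<lambda>x. L x + c) has_derivative L) (at x)"
      using has_derivative_add[OF bounded_linear_imp_has_derivative[OF assms] has_derivative_const]
      by simp
    moreover have "(f has_derivative frechet_derivative f (at (L x + c))) (at (L x + c))"
      using Suc.prems by (simp add: frechet_derivative_works[symmetric])
    ultimately show "((\<lambda>x. f (L x + c)) has_derivative
        (\<lambda>v. frechet_derivative f (at (L x + c)) (L v))) (at x)"
      by (rule has_derivative_compose)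
    show "k_times_cont_diff k (\<lambda>x. frechet_derivative f (at (L x + c)) (L v))" for v
      using Suc.IH[of "\<lambda>y. frechet_derivative f (at y) (L v)"] Suc.prems by simp
  qed
qed

lemma k_times_cont_diff_add:
  "k_times_cont_diff k f \<Longrightarrow> k_times_cont_diff k g \<Longrightarrow> k_times_cont_diff k (\<lambda>x. f x + g x)"
proof (induction k arbitrary: f g)
  case 0
  then show ?case by (simp add: continuous_on_add)
next
  case (Suc k)
  show ?case
  proof (rule k_times_cont_diffI)
    show "((\<lambda>x. f x + g x) has_derivative
        (\<lambda>v. frechet_derivative f (at x) v + frechet_derivative g (at x) v)) (at x)" for x
      using Suc.prems by (intro has_derivative_add) (simp_all add: frechet_derivative_works[symmetric])
  qed (use Suc in simp)
qed

lemma k_times_cont_diff_mult: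
  fixes f g :: "'a::euclidean_space \<Rightarrow> real"
  shows "k_times_cont_diff k f \<Longrightarrow> k_times_cont_diff k g \<Longrightarrow> k_times_cont_diff k (\<lambda>x. f x * g x)"
proof (induction k arbitrary: f g)
  case 0
  then show ?case by (simp add: continuous_on_mult)
next
  case (Suc k)
  show ?case
  proof (rule k_times_cont_diffI)
    show "((\<lambda>x. f x * g x) has_derivative
        (\<lambda>v. f x * frechet_derivative g (at x) v + frechet_derivative f (at x) v * g x)) (at x)" for x
      using Suc.prems by (intro has_derivative_mult) (simp_all add: frechet_derivative_works[symmetric])
    fix v
    \<comment> \<open>The undifferentiated factors are needed only to order \<open>k\<close>, one
      less than is available.\<close>
    show "k_times_cont_diff k (\<lambda>x. f x * frechet_derivative g (at x) v + frechet_derivative f (at x) v * g x)"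
      using Suc.prems k_times_cont_diff_SucD[OF Suc.prems(1)] k_times_cont_diff_SucD[OF Suc.prems(2)]
      by (intro k_times_cont_diff_add Suc.IH) simp_all
  qed
qed

lemma k_times_cont_diff_const: "k_times_cont_diff k (\<lambda>x. c)"
proof (induction k arbitrary: c)
  case 0
  show ?case by simp
next
  case (Suc k)
  show ?case
    by (rule k_times_cont_diffI[where f' = "\<lambda>x v. 0"]) (simp_all add: Suc)
qed

lemma smooth_const: "smooth (\<lambda>x. c)"
  by (simp add: smooth_def k_times_cont_diff_const)

lemma smooth_add: "smooth f \<Longrightarrow> smooth g \<Longrightarrow> smooth (\<lambda>x. f x + g x)"
  by (simp add: smooth_def k_times_cont_diff_add)

lemma smooth_mult: "smooth f \<Longrightarrow> smooth g \<Longrightarrow> smooth (\<lambda>x. f x * g x :: real)"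
  by (simp add: smooth_def k_times_cont_diff_mult)

lemma smooth_bounded_linear: "bounded_linear L \<Longrightarrow> smooth f \<Longrightarrow> smooth (\<lambda>x. L (f x))"
  by (simp add: smooth_def k_times_cont_diff_bounded_linear)

lemma smooth_compose_affine: "bounded_linear L \<Longrightarrow> smooth f \<Longrightarrow> smooth (\<lambda>x. f (L x + c))"
  by (simp add: smooth_def k_times_cont_diff_compose_affine)

lemma smooth_translate: "smooth f \<Longrightarrow> smooth (\<lambda>x. f (x + c))"
  using smooth_compose_affine[OF bounded_linear_ident] .

lemma smooth_cmult: "smooth f \<Longrightarrow> smooth (\<lambda>x. c * f x :: real)"
  by (rule smooth_mult[OF smooth_const])

lemma smooth_diff: "smooth f \<Longrightarrow> smooth g \<Longrightarrow> smooth (\<lambda>x. f x - g x :: real)"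
  using smooth_add[of f "\<lambda>x. (-1) * g x"] smooth_cmult[of g "-1"] by simp

lemma smooth_prod:
  fixes f :: "'i \<Rightarrow> 'a::euclidean_space \<Rightarrow> real"
  shows "finite I \<Longrightarrow> (\<And>i. i \<in> I \<Longrightarrow> smooth (f i)) \<Longrightarrow> smooth (\<lambda>x. \<Prod>i\<in>I. f i x)"
  by (induction I rule: finite_induct) (auto intro: smooth_const smooth_mult)

lemma smooth_has_derivative: "smooth f \<Longrightarrow> (f has_derivative frechet_derivative f (at x)) (at x)"
  unfolding smooth_def using k_times_cont_diff.simps(2)[of 0 f]
  by (auto simp: frechet_derivative_works[symmetric] dest: spec[of _ "Suc 0"])

lemma smooth_frechet_derivative: "smooth f \<Longrightarrow> smooth (\<lambda>x. frechet_derivative f (at x) v)"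
  unfolding smooth_def
proof
  assume "\<forall>k. k_times_cont_diff k f"
  then have "k_times_cont_diff (Suc k) f" for k by blast
  then show "k_times_cont_diff k (\<lambda>x. frechet_derivative f (at x) v)" for k by simp
qed

lemma smooth_continuous: "smooth f \<Longrightarrow> continuous_on UNIV f"
  unfolding smooth_def by (drule spec[of _ 0]) simp

lemma smooth_pderiv_dir: "smooth f \<Longrightarrow> smooth (pderiv_dir k f)"
  using smooth_frechet_derivative[of f "axis k 1"] by (simp add: pderiv_dir_def[abs_def])

lemma smooth_deriv_real:
  fixes h :: "real \<Rightarrow> real"
  assumes "smooth h"
  shows "(h has_real_derivative deriv h x) (at x)" "smooth (deriv h)"
proof -
  have d: "(h has_real_derivative frechet_derivative h (at x) 1) (at x)" for x
  proof (rule has_derivative_imp_has_field_derivative[OF smooth_has_derivative[OF assms]])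
    have "linear (frechet_derivative h (at x))"
      using smooth_has_derivative[OF assms] has_derivative_linear by blast
    then show "v * frechet_derivative h (at x) 1 = frechet_derivative h (at x) v" for v
      using linear_scale[of "frechet_derivative h (at x)" v 1]
      by (simp only: real_scaleR_def mult_1_right)
  qed
  then have "deriv h = (\<lambda>x. frechet_derivative h (at x) 1)"
    by (intro ext DERIV_imp_deriv)
  then show "(h has_real_derivative deriv h x) (at x)" "smooth (deriv h)"
    using d smooth_frechet_derivative[OF assms] by auto
qed

lemma k_times_cont_diff_Suc_real:
  fixes h :: "real \<Rightarrow> real"
  assumes "\<And>x. (h has_real_derivative h' x) (at x)" "k_times_cont_diff k h'"
  shows "k_times_cont_diff (Suc k) h"
  using assms by (intro k_times_cont_diffI[where f' = "\<lambda>x v. h' x * v"]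
    k_times_cont_diff_mult k_times_cont_diff_const has_field_derivative_imp_has_derivative)

lemma smooth_antideriv:
  fixes h :: "real \<Rightarrow> real"
  assumes "\<And>x. (h has_real_derivative h' x) (at x)" "smooth h'"
  shows "smooth h"
  unfolding smooth_def
proof
  fix k
  have "k_times_cont_diff k h'" using assms(2) by (simp add: smooth_def)
  from k_times_cont_diff_SucD[OF k_times_cont_diff_Suc_real[OF assms(1) this]]
  show "k_times_cont_diff k h" .
qed

section \<open>Flat exponentials and bump functions\<close>

text \<open>The functions x^(-n) exp(-1/x) for positive x, extended by 0. Keeping the power
  \<open>n\<close> as a parameter makes the family closed under differentiation up to linear
  combinations, which is what the induction for smoothness needs.\<close>

definition exp_inv :: "nat \<Rightarrow> real \<Rightarrow> real" where
  "exp_inv n x = (if x > 0 then (1 / x) ^ n * exp (- (1 / x)) else 0)"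

lemma exp_inv_tendsto_0: "(exp_inv n \<longlongrightarrow> 0) (at 0)"
proof -
  have "((\<lambda>y::real. y ^ n / exp y) \<longlongrightarrow> 0) at_top"
    by (rule tendsto_power_div_exp_0)
  then have "((\<lambda>x::real. inverse x ^ n / exp (inverse x)) \<longlongrightarrow> 0) (at_right 0)"
    by (rule filterlim_compose[OF _ filterlim_inverse_at_top_right])
  then have "(exp_inv n \<longlongrightarrow> 0) (at_right 0)"
    by (rule Lim_transform_eventually)
      (auto simp: exp_inv_def eventually_at_filter exp_minus divide_simps)
  moreover have "(exp_inv n \<longlongrightarrow> 0) (at_left 0)"
    by (rule Lim_transform_eventually[OF tendsto_const]) (auto simp: exp_inv_def eventually_at_filter)
  ultimately show ?thesis by (rule filterlim_split_at_real[rotated])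
qed

lemma exp_inv_has_derivative:
  "(exp_inv n has_real_derivative exp_inv (n + 2) x - n * exp_inv (n + 1) x) (at x)"
proof -
  consider "x > 0" | "x < 0" | "x = 0" by linarith
  then show ?thesis
  proof cases
    case 1
    have "((\<lambda>x. (1 / x) ^ n * exp (- (1 / x))) has_real_derivative
        exp_inv (n + 2) x - n * exp_inv (n + 1) x) (at x)"
      using 1 by (auto intro!: derivative_eq_intros simp: exp_inv_def field_simps power2_eq_square)
        (cases n; auto simp: power_eq_if split: if_splits)
    then show ?thesis
      by (rule has_field_derivative_transform_within_open[where S = "{0<..}"])
        (use 1 in \<open>auto simp: exp_inv_def\<close>)
  next
    case 2
    have "((\<lambda>x. 0) has_real_derivative exp_inv (n + 2) x - n * exp_inv (n + 1) x) (at x)"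
      using 2 by (auto simp: exp_inv_def)
    then show ?thesis
      by (rule has_field_derivative_transform_within_open[where S = "{..<0}"])
        (use 2 in \<open>auto simp: exp_inv_def\<close>)
  next
    case 3
    \<comment> \<open>For positive h the difference quotient at 0 is again a member of the family,
      with \<open>n\<close> raised by one, so its limit 0 is already known.\<close>
    have "((\<lambda>h. (exp_inv n (0 + h) - exp_inv n 0) / h) \<longlongrightarrow> 0) (at 0)"
      by (rule Lim_transform_eventually[OF exp_inv_tendsto_0[of "Suc n"]])
        (auto simp: exp_inv_def eventually_at_filter)
    then show ?thesis using 3 by (simp add: DERIV_def exp_inv_def)
  qed
qed

lemma smooth_exp_inv: "smooth (exp_inv n)"
proof -
  have "k_times_cont_diff k (exp_inv n)" for k
  proof (induction k arbitrary: n)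
    case 0
    show ?case
      using DERIV_isCont[OF exp_inv_has_derivative] by (simp add: continuous_at_imp_continuous_on)
  next
    case (Suc k)
    have "k_times_cont_diff k (\<lambda>x. exp_inv (n + 2) x + (- real n) * exp_inv (n + 1) x)"
      by (intro k_times_cont_diff_add k_times_cont_diff_mult k_times_cont_diff_const Suc.IH)
    then show ?case
      by (intro k_times_cont_diff_Suc_real[OF exp_inv_has_derivative]) simp
  qed
  then show ?thesis by (simp add: smooth_def)
qed

text \<open>One flat factor switches on at \<open>a\<close>, the other switches off at
  \<open>b\<close>.\<close>

lemma smooth_bump_exists:
  fixes a b :: real
  assumes "a < b"
  obtains \<rho> :: "real \<Rightarrow> real"
  where "smooth \<rho>" "\<And>x. \<rho> x \<ge> 0" "\<And>x. x \<notin> {a<..<b} \<Longrightarrow> \<rho> x = 0" "\<And>x. x \<in> {a<..<b} \<Longrightarrow> \<rho> x > 0"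
proof
  define \<rho> where "\<rho> = (\<lambda>x. exp_inv 0 (x - a) * exp_inv 0 (b - x))"
  have "bounded_linear (\<lambda>x::real. - x)"
    by (rule bounded_linear_minus[OF bounded_linear_ident])
  from smooth_compose_affine[OF this smooth_exp_inv[of 0], of b]
  have "smooth (\<lambda>x. exp_inv 0 (b - x))" by simp
  moreover have "smooth (\<lambda>x. exp_inv 0 (x - a))"
    using smooth_translate[OF smooth_exp_inv[of 0], of "-a"] by simp
  ultimately show "smooth \<rho>" unfolding \<rho>_def by (intro smooth_mult)
qed (auto simp: exp_inv_def)

section \<open>The torus\<close>

text \<open>A measure on all of \<open>real^3\<close> with the Borel sets, so that periodic Borel
  functions and their translates need no restriction of the domain. The completed measure
  \<open>lebesgue_on unit_cube\<close> is linked to it by \<open>torus_transfer\<close>.\<close>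

definition torus :: "(real^3) measure" where
  "torus = density lborel (indicator unit_cube)"

definition wrap :: "real^3 \<Rightarrow> real^3" where
  "wrap x = (\<chi> i. frac (x $ i))"

lemma space_torus [simp]: "space torus = UNIV"
  and sets_torus [measurable_cong, simp]: "sets torus = sets borel"
  by (simp_all add: torus_def)

lemma unit_cube_borel [measurable]: "unit_cube \<in> sets borel"
  unfolding unit_cube_def by measurable

lemma emeasure_unit_cube: "emeasure lborel unit_cube = 1"
proof -
  have box: "box 0 1 \<subseteq> unit_cube" "unit_cube \<subseteq> cbox 0 (1 :: real^3)"
    by (auto simp: unit_cube_def mem_box_cart less_imp_le)
  have 1: "(1 :: real^3) \<bullet> b = 1" if "b \<in> Basis" for b
    using that by (auto simp: Basis_vec_def inner_axis)
  have *: "emeasure lborel (box 0 (1::real^3)) = 1" "emeasure lborel (cbox 0 (1::real^3)) = 1"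
    by (simp_all add: emeasure_lborel_box_eq emeasure_lborel_cbox_eq 1)
  show ?thesis
    using emeasure_mono[OF box(1), of lborel] emeasure_mono[OF box(2), of lborel] *
    by (simp add: order_antisym)
qed

lemma emeasure_torus_UNIV: "emeasure torus UNIV = 1"
  by (simp add: torus_def emeasure_density emeasure_unit_cube)

lemma finite_measure_torus: "finite_measure torus"
  by standard (simp add: emeasure_torus_UNIV)

interpretation torus: finite_measure torus
  by (rule finite_measure_torus)

lemma measure_torus_UNIV [simp]: "measure torus UNIV = 1"
  by (simp add: measure_def emeasure_torus_UNIV)

lemma AE_torus: "(AE x in torus. Q x) \<longleftrightarrow> (AE x in lborel. x \<in> unit_cube \<longrightarrow> Q x)"
  unfolding torus_def by (subst AE_density) (auto simp: indicator_def)

lemma frac_borel_measurable [measurable]: "(frac :: real \<Rightarrow> real) \<in> borel_measurable borel"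
  unfolding frac_def[abs_def] by measurable

lemma wrap_borel_measurable [measurable]: "wrap \<in> borel_measurable borel"
  unfolding wrap_def[abs_def]
  by (subst borel_measurable_euclidean_space) (auto simp: Basis_vec_def inner_axis)

lemma wrap_in_unit_cube [simp]: "wrap x \<in> unit_cube"
  by (simp add: wrap_def unit_cube_def frac_lt_1)

lemma wrap_id: "x \<in> unit_cube \<Longrightarrow> wrap x = x"
  by (simp add: wrap_def unit_cube_def vec_eq_iff frac_eq)

lemma periodic_axis_int:
  assumes "periodic f"
  shows "f (x + axis k (of_int n)) = f x"
proof (induction n arbitrary: x rule: int_induct[where k = 0])
  case base
  show ?case by (simp add: axis_eq_0_iff[THEN iffD2])
next
  case (step1 i)
  have "axis k (of_int (i + 1)) = axis k (of_int i) + (axis k 1 :: real^3)"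
    by (simp add: vec_eq_iff axis_def)
  then show ?case
    using step1 assms by (metis add.assoc periodic_def)
next
  case (step2 i)
  have "axis k (of_int (i - 1)) + axis k 1 = (axis k (of_int i) :: real^3)"
    by (simp add: vec_eq_iff axis_def)
  then show ?case
    using step2 assms by (metis add.assoc periodic_def)
qed

lemma periodic_int_vec:
  assumes "periodic f"
  shows "f (x + (\<chi> i. of_int (m $ i))) = f x"
proof -
  have "x + (\<chi> i. of_int (m $ i)) =
      x + axis 1 (of_int (m $ 1)) + axis 2 (of_int (m $ 2)) + axis 3 (of_int (m $ 3))"
    by (simp add: vec_eq_iff axis_def forall_3)
  then show ?thesis by (simp only: periodic_axis_int[OF assms])
qed

lemma wrap_eq: "wrap x = x + (\<chi> i. of_int ((\<chi> i. - \<lfloor>x $ i\<rfloor>) $ i))"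
  by (simp add: wrap_def vec_eq_iff frac_def)

lemma periodic_wrap: "periodic f \<Longrightarrow> f (wrap x) = f x"
  unfolding wrap_eq by (rule periodic_int_vec)

lemma periodic_translate: "periodic f \<Longrightarrow> periodic (\<lambda>x. f (x + a))"
  unfolding periodic_def by (metis add.assoc add.commute)

lemma lborel_translate: "distr lborel borel ((+) a) = (lborel :: 'a::euclidean_space measure)"
  by (simp add: lborel_distr_plus)

text \<open>Tonelli for a countable sum, used with the lattice of integer vectors as index
  set.\<close>

lemma nn_integral_count_space_swap:
  fixes f :: "'a \<Rightarrow> 'b::countable \<Rightarrow> ennreal"
  assumes "sigma_finite_measure M" and [measurable]: "\<And>m. (\<lambda>x. f x m) \<in> borel_measurable M"
  shows "(\<integral>\<^sup>+x. (\<integral>\<^sup>+m. f x m \<partial>count_space UNIV) \<partial>M) = (\<integral>\<^sup>+m. (\<integral>\<^sup>+x. f x m \<partial>M) \<partial>count_space UNIV)"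
proof -
  interpret pair_sigma_finite "count_space (UNIV :: 'b set)" M
    by (intro pair_sigma_finite.intro assms(1) sigma_finite_measure_count_space)
  have "(\<lambda>(m, x). f x m) \<in> borel_measurable (count_space UNIV \<Otimes>\<^sub>M M)"
    by (rule measurable_pair_measure_countable1) auto
  from Fubini'[OF this] show ?thesis by simp
qed

text \<open>Translation invariance on the quotient comes from the tiling of space by lattice
  translates of the cube. The tiling is inserted as a sum equal to 1, each summand is shifted by its
  lattice vector so that the wrapped point lands in the cube, and the tiling is used once more at
  the shifted point x - a.\<close>

lemma distr_torus_wrap: "distr torus torus (\<lambda>x. wrap (x + a)) = torus"
proof (rule measure_eqI)
  fix A assume "A \<in> sets (distr torus torus (\<lambda>x. wrap (x + a)))"
  then have A[measurable]: "A \<in> sets borel" by simp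
  let ?Z = "\<lambda>m::int^3. (\<chi> i. of_int (m $ i)) :: real^3"
  have nm: "nn_integral lborel f = (\<integral>\<^sup>+x. f (c + x) \<partial>lborel)" if [measurable]: "f \<in> borel_measurable borel"
    for f and c :: "real^3"
    by (subst lborel_translate[of c, symmetric], subst nn_integral_distr) auto
  \<comment> \<open>Exactly one lattice vector contributes, the vector of integer parts of
    x.\<close>
  have part: "(\<integral>\<^sup>+m. indicator unit_cube (x - ?Z m) \<partial>count_space UNIV) = (1::ennreal)" for x
  proof -
    have "indicator unit_cube (x - ?Z m) = (indicator {(\<chi> i. \<lfloor>x $ i\<rfloor>)} m :: ennreal)" for m
    proof -
      have "x - ?Z m \<in> unit_cube \<longleftrightarrow> m = (\<chi> i. \<lfloor>x $ i\<rfloor>)"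
        by (auto simp: unit_cube_def vec_eq_iff eq_commute[of "m $ _"] floor_eq_iff algebra_simps)
      then show ?thesis by (simp add: indicator_def)
    qed
    then show ?thesis by simp
  qed
  have "(\<lambda>x. wrap (x + a)) \<in> borel_measurable borel" by measurable
  from measurable_sets[OF this A] have "(\<lambda>x. wrap (x + a)) -` A \<in> sets borel" by simp
  then have "emeasure (distr torus torus (\<lambda>x. wrap (x + a))) A =
      (\<integral>\<^sup>+x. indicator unit_cube x * indicator A (wrap (x + a)) \<partial>lborel)"
    by (simp add: emeasure_distr torus_def emeasure_density)
      (auto intro!: nn_integral_cong simp: indicator_def)
  also have "\<dots> = (\<integral>\<^sup>+x. indicator unit_cube (- a + x) * indicator A (wrap x) \<partial>lborel)"
    by (subst nm[where c = "- a"]) (auto simp: algebra_simps)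
  also have "\<dots> = (\<integral>\<^sup>+x. (\<integral>\<^sup>+m. indicator unit_cube (x - ?Z m) * (indicator unit_cube (- a + x) * indicator A (wrap x))
      \<partial>count_space UNIV) \<partial>lborel)"
    by (subst nn_integral_multc) (simp_all add: part)
  also have "\<dots> = (\<integral>\<^sup>+m. (\<integral>\<^sup>+x. indicator unit_cube (x - ?Z m) * (indicator unit_cube (- a + x) * indicator A (wrap x))
      \<partial>lborel) \<partial>count_space UNIV)"
    by (intro nn_integral_count_space_swap lborel.sigma_finite_measure_axioms) measurable
  also have "\<dots> = (\<integral>\<^sup>+m. (\<integral>\<^sup>+x. indicator unit_cube (x - a + ?Z m) * (indicator unit_cube x * indicator A x)
      \<partial>lborel) \<partial>count_space UNIV)"
  proof (rule nn_integral_cong)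
    fix m :: "int^3"
    have w: "wrap (x + ?Z m) = wrap x" for x
      by (simp add: wrap_def vec_eq_iff)
    show "(\<integral>\<^sup>+x. indicator unit_cube (x - ?Z m) * (indicator unit_cube (- a + x) * indicator A (wrap x)) \<partial>lborel)
      = (\<integral>\<^sup>+x. indicator unit_cube (x - a + ?Z m) * (indicator unit_cube x * indicator A x) \<partial>lborel)"
      apply (subst nm[where c = "?Z m"], simp)
      by (auto simp: w wrap_id indicator_def algebra_simps intro!: nn_integral_cong)
  qed
  \<comment> \<open>Reversing the lattice vectors turns the sum into \<open>part\<close> at the
    point x - a.\<close>
  also have "\<dots> = (\<integral>\<^sup>+m. (\<integral>\<^sup>+x. indicator unit_cube (x - a - ?Z m) * (indicator unit_cube x * indicator A x)
      \<partial>lborel) \<partial>count_space UNIV)"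
  proof -
    have "?Z (- m) = - ?Z m" for m by (simp add: vec_eq_iff)
    then show ?thesis
      by (subst nn_integral_bij_count_space[where g = uminus and A = UNIV, symmetric])
        (auto simp: bij_uminus)
  qed
  also have "\<dots> = (\<integral>\<^sup>+x. (\<integral>\<^sup>+m. indicator unit_cube (x - a - ?Z m) * (indicator unit_cube x * indicator A x)
      \<partial>count_space UNIV) \<partial>lborel)"
    by (intro nn_integral_count_space_swap[symmetric] lborel.sigma_finite_measure_axioms) measurable
  also have "\<dots> = emeasure torus A"
    by (subst nn_integral_multc) (auto simp add: part torus_def emeasure_density mult.commute)
  finally show "emeasure (distr torus torus (\<lambda>x. wrap (x + a))) A = emeasure torus A" .
qed simp

lemma nn_integral_torus_translate:
  assumes [measurable]: "f \<in> borel_measurable borel" and "periodic f"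
  shows "(\<integral>\<^sup>+x. f (x + a) \<partial>torus) = (\<integral>\<^sup>+x. f x \<partial>torus)"
proof -
  have "(\<integral>\<^sup>+x. f x \<partial>torus) = (\<integral>\<^sup>+x. f (wrap (x + a)) \<partial>torus)"
    by (subst distr_torus_wrap[of a, symmetric], subst nn_integral_distr) auto
  then show ?thesis by (simp add: periodic_wrap assms)
qed

lemma integrable_torus_translate:
  fixes f :: "real^3 \<Rightarrow> 'b::{banach, second_countable_topology}"
  assumes [measurable]: "f \<in> borel_measurable borel" and "periodic f"
  shows "integrable torus (\<lambda>x. f (x + a)) \<longleftrightarrow> integrable torus f"
proof -
  have "integrable torus f \<longleftrightarrow> integrable torus (\<lambda>x. f (wrap (x + a)))"
    by (subst distr_torus_wrap[of a, symmetric], subst integrable_distr_eq) auto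
  then show ?thesis by (simp add: periodic_wrap assms)
qed

lemma integral_torus_translate:
  fixes f :: "real^3 \<Rightarrow> 'b::{banach, second_countable_topology}"
  assumes [measurable]: "f \<in> borel_measurable borel" and "periodic f"
  shows "(\<integral>x. f (x + a) \<partial>torus) = (\<integral>x. f x \<partial>torus)"
proof -
  have "(\<integral>x. f x \<partial>torus) = (\<integral>x. f (wrap (x + a)) \<partial>torus)"
    by (subst distr_torus_wrap[of a, symmetric], subst integral_distr) auto
  then show ?thesis by (simp add: periodic_wrap assms)
qed

section \<open>Partial derivatives and bounded periodic functions\<close>

text \<open>Only the derivative along one axis is recorded. That suffices for integration by parts,
  and mollified fields have it by differentiation under the integral, with no joint
  differentiability to establish.\<close>

definition has_pd :: "3 \<Rightarrow> (real^3 \<Rightarrow> real) \<Rightarrow> (real^3 \<Rightarrow> real) \<Rightarrow> bool" where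
  "has_pd k f g \<longleftrightarrow> (\<forall>x. ((\<lambda>s. f (x + s *\<^sub>R axis k 1)) has_real_derivative g x) (at 0))"

text \<open>A class closed under sums and products whose members are integrable over the torus and
  over the time interval; it settles most integrability questions below without separate
  estimates.\<close>

definition bounded_borel :: "('a::topological_space \<Rightarrow> real) \<Rightarrow> bool" where
  "bounded_borel f \<longleftrightarrow> f \<in> borel_measurable borel \<and> (\<exists>C. \<forall>x. \<bar>f x\<bar> \<le> C)"

lemma bounded_borel_measurable: "bounded_borel f \<Longrightarrow> f \<in> borel_measurable borel"
  by (simp add: bounded_borel_def)

lemma bounded_borelE:
  assumes "bounded_borel f" obtains C where "C > 0" "\<And>x. \<bar>f x\<bar> \<le> C"
proof -
  obtain C where "\<And>x. \<bar>f x\<bar> \<le> C" using assms by (auto simp: bounded_borel_def)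
  then have "\<bar>f x\<bar> \<le> max C 1" for x by (simp add: le_max_iff_disj)
  then show ?thesis by (intro that[of "max C 1"]) auto
qed

lemma bounded_borel_mult: assumes "bounded_borel f" "bounded_borel g" shows "bounded_borel (\<lambda>x. f x * g x)"
proof -
  obtain C D where C: "\<And>x. \<bar>f x\<bar> \<le> C" "C > 0" and D: "\<And>x. \<bar>g x\<bar> \<le> D"
    using assms by (meson bounded_borelE)
  then have "\<bar>f x * g x\<bar> \<le> C * D" for x by (auto simp: abs_mult intro!: mult_mono)
  then show ?thesis using assms by (auto simp: bounded_borel_def)
qed

lemma bounded_borel_add: assumes "bounded_borel f" "bounded_borel g" shows "bounded_borel (\<lambda>x. f x + g x)"
proof -
  obtain C D where C: "\<And>x. \<bar>f x\<bar> \<le> C" and D: "\<And>x. \<bar>g x\<bar> \<le> D"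
    using assms by (meson bounded_borelE)
  have "\<bar>f x + g x\<bar> \<le> C + D" for x
    using abs_triangle_ineq[of "f x" "g x"] C[of x] D[of x] by linarith
  then show ?thesis using assms by (auto simp: bounded_borel_def)
qed

lemma bounded_borel_const: "bounded_borel (\<lambda>x. c)"
  by (auto simp: bounded_borel_def)

lemma bounded_borel_diff: "bounded_borel f \<Longrightarrow> bounded_borel g \<Longrightarrow> bounded_borel (\<lambda>x. f x - g x)"
  using bounded_borel_add[of f "\<lambda>x. (-1) * g x"] bounded_borel_mult[OF bounded_borel_const, of g "-1"] by simp

lemma bounded_borel_sum: "(\<And>i. i \<in> I \<Longrightarrow> bounded_borel (f i)) \<Longrightarrow> bounded_borel (\<lambda>x. \<Sum>i\<in>I. f i x)"
  by (induction I rule: infinite_finite_induct) (auto intro: bounded_borel_const bounded_borel_add)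

definition bper :: "(real^3 \<Rightarrow> real) \<Rightarrow> bool" where
  "bper f \<longleftrightarrow> periodic f \<and> bounded_borel f"

lemma bper_iff: "bper f \<longleftrightarrow> periodic f \<and> f \<in> borel_measurable borel \<and> (\<exists>C. \<forall>x. \<bar>f x\<bar> \<le> C)"
  by (simp add: bper_def bounded_borel_def)

lemma bper_measurable: "bper f \<Longrightarrow> f \<in> borel_measurable borel"
  and bper_periodic: "bper f \<Longrightarrow> periodic f"
  by (simp_all add: bper_iff)

lemma bperE:
  assumes "bper f" obtains C where "C > 0" "\<And>x. \<bar>f x\<bar> \<le> C"
  using assms bounded_borelE unfolding bper_def by blast

lemma bper_mult: "bper f \<Longrightarrow> bper g \<Longrightarrow> bper (\<lambda>x. f x * g x)"
  by (simp add: bper_def periodic_def bounded_borel_mult)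

lemma bper_add: "bper f \<Longrightarrow> bper g \<Longrightarrow> bper (\<lambda>x. f x + g x)"
  by (simp add: bper_def periodic_def bounded_borel_add)

lemma bper_const: "bper (\<lambda>x. c)"
  by (simp add: bper_def periodic_def bounded_borel_const)

lemma bper_minus: "bper f \<Longrightarrow> bper (\<lambda>x. - f x)"
  by (auto simp: bper_iff periodic_def)

lemma bper_diff: "bper f \<Longrightarrow> bper g \<Longrightarrow> bper (\<lambda>x. f x - g x)"
  by (simp add: bper_def periodic_def bounded_borel_diff)

lemma bper_sum: "(\<And>i. i \<in> I \<Longrightarrow> bper (f i)) \<Longrightarrow> bper (\<lambda>x. \<Sum>i\<in>I. f i x)"
  by (simp add: bper_def periodic_def bounded_borel_sum)

lemma bounded_borel_torus: assumes "bounded_borel f" shows "integrable torus f"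
proof -
  obtain C where "\<And>x. \<bar>f x\<bar> \<le> C" using assms by (meson bounded_borelE)
  then show ?thesis
    using bounded_borel_measurable[OF assms] by (intro torus.integrable_const_bound[where B = C]) auto
qed

lemma bper_translate:
  assumes "bper f" shows "bper (\<lambda>x. f (x + a))"
proof -
  have [measurable]: "f \<in> borel_measurable borel" by (rule bper_measurable[OF assms])
  have "(\<lambda>x. f (x + a)) \<in> borel_measurable borel" by measurable
  then show ?thesis using assms periodic_translate[of f a] by (auto simp: bper_iff)
qed

lemma bper_integrable: "bper f \<Longrightarrow> integrable torus f"
  by (simp add: bper_def bounded_borel_torus)

lemma bper_integrable_mult:
  assumes "bper f" "integrable torus g" shows "integrable torus (\<lambda>x. f x * g x)"
proof -
  obtain C where C: "\<And>x. \<bar>f x\<bar> \<le> C" "C > 0" using assms by (meson bperE)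
  have [measurable]: "f \<in> borel_measurable borel" by (rule bper_measurable[OF assms(1)])
  show ?thesis
  proof (rule Bochner_Integration.integrable_bound[of _ "\<lambda>x. C * g x"])
    show "AE x in torus. norm (f x * g x) \<le> norm (C * g x)"
      using C by (auto simp: abs_mult intro!: mult_right_mono AE_I2)
  qed (use assms in auto)
qed

text \<open>A periodic function takes all its values on a compact cube.\<close>

lemma periodic_bounded:
  fixes f :: "real^3 \<Rightarrow> 'a::real_normed_vector"
  assumes "continuous_on UNIV f" "periodic f"
  obtains C where "\<And>x. norm (f x) \<le> C"
proof -
  have "compact (f ` cbox 0 1)"
    by (intro compact_continuous_image continuous_on_subset[OF assms(1)]) auto
  then obtain C where C: "\<And>x. x \<in> cbox 0 1 \<Longrightarrow> norm (f x) \<le> C"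
    by (meson compact_imp_bounded bounded_iff image_eqI)
  have "wrap x \<in> cbox 0 1" for x
    using wrap_in_unit_cube[of x] by (auto simp: unit_cube_def mem_box_cart less_imp_le)
  then have "norm (f x) \<le> C" for x using C[of "wrap x"] by (simp add: periodic_wrap assms)
  then show ?thesis by (rule that)
qed

lemma bper_continuous:
  assumes "continuous_on UNIV f" "periodic f" shows "bper f"
proof -
  obtain C where "\<And>x. norm (f x) \<le> C" using periodic_bounded[OF assms] by blast
  then show ?thesis using assms by (auto simp: bper_iff intro: borel_measurable_continuous_onI)
qed

lemma smooth_has_pd: "smooth f \<Longrightarrow> has_pd k f (pderiv_dir k f)"
  unfolding has_pd_def
proof
  fix x assume f: "smooth f"
  have "((\<lambda>s. x + s *\<^sub>R axis k (1::real)) has_derivative (\<lambda>s. s *\<^sub>R axis k 1)) (at 0)"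
    by (auto intro!: derivative_eq_intros)
  moreover have "(f has_derivative frechet_derivative f (at x)) (at (x + 0 *\<^sub>R axis k 1))"
    using smooth_has_derivative[OF f] by simp
  ultimately have "((\<lambda>s. f (x + s *\<^sub>R axis k 1)) has_derivative
      (\<lambda>s. frechet_derivative f (at x) (s *\<^sub>R axis k 1))) (at 0)"
    by (rule has_derivative_compose)
  moreover have "linear (frechet_derivative f (at x))"
    using smooth_has_derivative[OF f] has_derivative_linear by blast
  ultimately show "((\<lambda>s. f (x + s *\<^sub>R axis k 1)) has_real_derivative pderiv_dir k f x) (at 0)"
    by (intro has_derivative_imp_has_field_derivative) (auto simp: pderiv_dir_def linear_scale)
qed

lemma has_pd_unique: "has_pd k f g \<Longrightarrow> has_pd k f h \<Longrightarrow> g = h"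
  unfolding has_pd_def by (intro ext) (metis DERIV_unique)

lemma has_pd_periodic: "has_pd k f g \<Longrightarrow> periodic f \<Longrightarrow> periodic g"
  unfolding periodic_def
proof (intro allI)
  fix x i assume f: "has_pd k f g" "\<forall>x k. f (x + axis k 1) = f x"
  have "f (x + axis i 1 + s *\<^sub>R axis k 1) = f (x + s *\<^sub>R axis k 1)" for s
    using f(2)[rule_format, of "x + s *\<^sub>R axis k 1" i] by (simp add: add.assoc add.commute[of "axis i 1"])
  then show "g (x + axis i 1) = g x"
    using f(1) unfolding has_pd_def by (metis (no_types, lifting) DERIV_unique ext)
qed

lemma smooth_periodic_bper: "smooth f \<Longrightarrow> periodic f \<Longrightarrow> bper f"
  by (intro bper_continuous smooth_continuous)

lemma smooth_periodic_pderiv: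
  fixes f :: "real^3 \<Rightarrow> real"
  shows "smooth f \<Longrightarrow> periodic f \<Longrightarrow> periodic (pderiv_dir k f)"
  by (rule has_pd_periodic[OF smooth_has_pd])

lemma has_pd_mult:
  "has_pd k f f' \<Longrightarrow> has_pd k g g' \<Longrightarrow> has_pd k (\<lambda>x. f x * g x) (\<lambda>x. f' x * g x + f x * g' x)"
  unfolding has_pd_def by (auto intro!: derivative_eq_intros)

lemma has_pd_diff:
  "has_pd k f f' \<Longrightarrow> has_pd k g g' \<Longrightarrow> has_pd k (\<lambda>x. f x - g x) (\<lambda>x. f' x - g' x)"
  unfolding has_pd_def by (auto intro!: derivative_eq_intros)

lemma has_pd_cmult: "has_pd k f f' \<Longrightarrow> has_pd k (\<lambda>x. c * f x) (\<lambda>x. c * f' x)"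
  unfolding has_pd_def by (auto intro!: derivative_eq_intros)

lemma has_pd_sum:
  "(\<And>i. i \<in> I \<Longrightarrow> has_pd k (f i) (f' i)) \<Longrightarrow> has_pd k (\<lambda>x. \<Sum>i\<in>I. f i x) (\<lambda>x. \<Sum>i\<in>I. f' i x)"
  unfolding has_pd_def by (auto intro!: derivative_eq_intros)

text \<open>The mean value theorem along the axis. It provides the constant that dominates
  difference quotients under the integral.\<close>

lemma has_pd_lipschitz:
  assumes "has_pd k f g" "\<And>x. \<bar>g x\<bar> \<le> C"
  shows "\<bar>f (x + s *\<^sub>R axis k 1) - f x\<bar> \<le> C * \<bar>s\<bar>"
proof -
  have d: "((\<lambda>s. f (x + s *\<^sub>R axis k 1)) has_real_derivative g (x + s *\<^sub>R axis k 1)) (at s)" for s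
  proof -
    have *: "x + (r + s) *\<^sub>R axis k 1 = x + s *\<^sub>R axis k 1 + r *\<^sub>R axis k (1::real)" for r
      by (simp add: scaleR_left_distrib)
    have "((\<lambda>r. f (x + (r + s) *\<^sub>R axis k 1)) has_real_derivative g (x + s *\<^sub>R axis k 1)) (at 0)"
      using assms(1) unfolding has_pd_def * by blast
    then show ?thesis
      using DERIV_shift[of "\<lambda>r. f (x + r *\<^sub>R axis k 1)" _ 0 s] by simp
  qed
  have "norm ((\<lambda>s. f (x + s *\<^sub>R axis k 1)) s - (\<lambda>s. f (x + s *\<^sub>R axis k 1)) 0) \<le> C * norm (s - 0)"
    by (rule field_differentiable_bound[where S = UNIV and f' = "\<lambda>s. g (x + s *\<^sub>R axis k 1)"])
      (use d assms(2) in auto)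
  then show ?thesis by simp
qed

text \<open>Dominated convergence for a real parameter, reduced to sequences. The bound is asked for
  only away from \<open>a\<close>, where a difference quotient is meaningful.\<close>

lemma integral_dominated_convergence_at:
  fixes F :: "real \<Rightarrow> 'a \<Rightarrow> real"
  assumes "\<And>h. F h \<in> borel_measurable M" "g \<in> borel_measurable M" "integrable M w"
    and lim: "\<And>x. ((\<lambda>h. F h x) \<longlongrightarrow> g x) (at a)"
    and bound: "\<And>h x. h \<noteq> a \<Longrightarrow> \<bar>F h x\<bar> \<le> w x"
  shows "((\<lambda>h. \<integral>x. F h x \<partial>M) \<longlongrightarrow> (\<integral>x. g x \<partial>M)) (at a)"
  unfolding tendsto_at_iff_sequentially
proof (intro allI impI)
  fix X assume X: "\<forall>i. X i \<in> UNIV - {a}" "X \<longlonglongrightarrow> a"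
  have "(\<lambda>n. \<integral>x. F (X n) x \<partial>M) \<longlonglongrightarrow> (\<integral>x. g x \<partial>M)"
  proof (rule integral_dominated_convergence[where w = w])
    show "AE x in M. (\<lambda>n. F (X n) x) \<longlonglongrightarrow> g x"
      using lim X unfolding tendsto_at_iff_sequentially by (auto simp: o_def)
    show "AE x in M. norm (F (X n) x) \<le> w x" for n
      using bound X by auto
  qed (use assms in auto)
  then show "((\<lambda>h. \<integral>x. F h x \<partial>M) \<circ> X) \<longlonglongrightarrow> (\<integral>x. g x \<partial>M)" by (simp add: o_def)
qed

text \<open>The difference quotients of \<open>f\<close> have integral 0 by translation invariance
  and converge boundedly to \<open>g\<close>. This plays the part of the divergence theorem on the
  torus.\<close>

lemma integral_pd_eq_0:
  assumes "has_pd k f g" "bper f" "bper g"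
  shows "(\<integral>x. g x \<partial>torus) = 0"
proof -
  obtain C where C: "\<And>x. \<bar>g x\<bar> \<le> C" "C > 0" using assms by (meson bperE)
  have [measurable]: "f \<in> borel_measurable borel" "g \<in> borel_measurable borel"
    using assms by (auto simp: bper_iff)
  let ?F = "\<lambda>h x. (f (x + h *\<^sub>R axis k 1) - f x) / h"
  have "((\<lambda>h. \<integral>x. ?F h x \<partial>torus) \<longlongrightarrow> (\<integral>x. g x \<partial>torus)) (at 0)"
  proof (rule integral_dominated_convergence_at[where w = "\<lambda>_. C"])
    show "((\<lambda>h. ?F h x) \<longlongrightarrow> g x) (at 0)" for x
      using assms(1) by (auto simp: has_pd_def DERIV_def)
    show "\<bar>?F h x\<bar> \<le> C" if "h \<noteq> 0" for h x
      using has_pd_lipschitz[OF assms(1) C(1)] that by (simp add: divide_le_eq)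
  qed auto
  moreover have *: "(\<integral>x. ?F h x \<partial>torus) = 0" for h
    using integral_torus_translate[of f "h *\<^sub>R axis k 1"] assms(2)
    by (simp add: bper_integrable bper_translate bper_measurable bper_periodic)
  ultimately show ?thesis
    unfolding * by (intro LIM_unique[OF _ tendsto_const])
qed

lemma integral_by_parts_torus:
  assumes "has_pd k f f'" "has_pd k g g'" "bper f" "bper f'" "bper g" "bper g'"
  shows "(\<integral>x. f x * g' x \<partial>torus) = - (\<integral>x. f' x * g x \<partial>torus)"
proof -
  have "(\<integral>x. f' x * g x + f x * g' x \<partial>torus) = 0"
    using assms by (intro integral_pd_eq_0[OF has_pd_mult]) (auto intro!: bper_add bper_mult)
  then show ?thesis
    using assms by (simp add: bper_integrable bper_mult)
qed

section \<open>Correlation with a periodic kernel\<close>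

text \<open>The kernel is evaluated at y - x and not at x - y: the value at x is then the pairing of
  \<open>f\<close> with the translate of \<kappa> by x, which is what the weak equations provide.
  The price is a minus sign at each differentiation in x.\<close>

definition corr :: "(real^3 \<Rightarrow> real) \<Rightarrow> (real^3 \<Rightarrow> real) \<Rightarrow> real^3 \<Rightarrow> real" where
  "corr \<kappa> f x = (\<integral>y. \<kappa> (y - x) * f y \<partial>torus)"

lemma periodic_diff: "periodic f \<Longrightarrow> periodic (\<lambda>x. f (x - a))"
  using periodic_translate[of f "-a"] by simp

lemma corr_integrable:
  assumes "bper \<kappa>" "integrable torus f" shows "integrable torus (\<lambda>y. \<kappa> (y - x) * f y)"
  using bper_integrable_mult[OF bper_translate[OF assms(1), of "-x"] assms(2)] by simp

lemma corr_translate: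
  assumes "bper \<kappa>" "integrable torus f" "periodic f"
  shows "corr \<kappa> f x = (\<integral>l. \<kappa> l * f (x + l) \<partial>torus)"
proof -
  have [measurable]: "\<kappa> \<in> borel_measurable borel" "f \<in> borel_measurable borel"
    using assms by (auto simp: bper_iff)
  have "periodic (\<lambda>y. \<kappa> (y - x) * f y)"
    using periodic_diff[of \<kappa> x] assms by (simp add: bper_iff periodic_def)
  from integral_torus_translate[OF _ this, of x] show ?thesis
    by (simp add: corr_def add.commute)
qed

lemma bper_corr:
  assumes "bper \<kappa>" "integrable torus f"
  shows "bper (corr \<kappa> f)"
  unfolding bper_iff
proof (intro conjI)
  have [measurable]: "\<kappa> \<in> borel_measurable borel" "f \<in> borel_measurable borel"
    using assms by (auto simp: bper_iff)
  show "corr \<kappa> f \<in> borel_measurable borel"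
    unfolding corr_def[abs_def]
    by (rule torus.borel_measurable_lebesgue_integral) (simp add: measurable_split_conv)
  have "\<kappa> (y - (x + axis k 1)) = \<kappa> (y - x)" for x y k
  proof -
    have "\<kappa> (y - x - axis k 1 + axis k 1) = \<kappa> (y - x - axis k 1)"
      using assms(1) unfolding bper_iff periodic_def by blast
    then show ?thesis by (simp add: diff_diff_add)
  qed
  then show "periodic (corr \<kappa> f)"
    by (simp add: periodic_def corr_def)
  obtain C where C: "\<And>x. \<bar>\<kappa> x\<bar> \<le> C" "C > 0" using assms by (meson bperE)
  have "\<bar>corr \<kappa> f x\<bar> \<le> (\<integral>y. C * \<bar>f y\<bar> \<partial>torus)" for x
  proof -
    have "\<bar>corr \<kappa> f x\<bar> \<le> (\<integral>y. \<bar>\<kappa> (y - x) * f y\<bar> \<partial>torus)"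
      unfolding corr_def by (rule integral_abs_bound)
    also have "\<dots> \<le> (\<integral>y. C * \<bar>f y\<bar> \<partial>torus)"
      using assms C by (intro integral_mono integrable_abs corr_integrable integrable_mult_right)
        (auto intro!: mult_right_mono integrable_mult_right simp: abs_mult)
    finally show ?thesis .
  qed
  then show "\<exists>C. \<forall>x. \<bar>corr \<kappa> f x\<bar> \<le> C" by blast
qed

lemma has_pd_corr:
  assumes "has_pd k \<kappa> \<kappa>'" "bper \<kappa>" "bper \<kappa>'" "integrable torus f"
  shows "has_pd k (corr \<kappa> f) (\<lambda>x. - corr \<kappa>' f x)"
  unfolding has_pd_def DERIV_def
proof
  fix x
  have [measurable]: "\<kappa> \<in> borel_measurable borel" "\<kappa>' \<in> borel_measurable borel" "f \<in> borel_measurable borel"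
    using assms by (auto simp: bper_iff)
  obtain C where C: "\<And>x. \<bar>\<kappa>' x\<bar> \<le> C" "C > 0" using assms by (meson bperE)
  let ?F = "\<lambda>h y. (\<kappa> (y - (x + h *\<^sub>R axis k 1)) - \<kappa> (y - x)) / h * f y"
  have "((\<lambda>h. \<integral>y. ?F h y \<partial>torus) \<longlongrightarrow> (\<integral>y. - \<kappa>' (y - x) * f y \<partial>torus)) (at 0)"
  proof (rule integral_dominated_convergence_at[where w = "\<lambda>y. C * \<bar>f y\<bar>"])
    fix y
    have "((\<lambda>s. (\<kappa> (y - x + s *\<^sub>R axis k 1) - \<kappa> (y - x)) / s) \<longlongrightarrow> \<kappa>' (y - x)) (at 0)"
      using assms(1) by (auto simp: has_pd_def DERIV_def)
    \<comment> \<open>Moving x forward moves the argument y - x of \<kappa> backward, so the limit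
      is taken along -s; this produces the minus sign.\<close>
    then have "((\<lambda>s. (\<kappa> (y - x + (- s) *\<^sub>R axis k 1) - \<kappa> (y - x)) / (- s)) \<longlongrightarrow> \<kappa>' (y - x)) (at 0)"
      by (rule filterlim_compose[of _ _ "at 0" uminus "at 0"])
        (auto simp: filterlim_at eventually_at_filter intro!: tendsto_eq_intros)
    from tendsto_mult_right[OF tendsto_minus[OF this], of "f y"]
    show "((\<lambda>h. ?F h y) \<longlongrightarrow> - \<kappa>' (y - x) * f y) (at 0)"
      by (simp add: algebra_simps)
  next
    fix h :: real and y assume "h \<noteq> 0"
    have "\<bar>\<kappa> (y - (x + h *\<^sub>R axis k 1)) - \<kappa> (y - x)\<bar> \<le> C * \<bar>h\<bar>"
      using has_pd_lipschitz[OF assms(1) C(1), of "y - x" "- h"] by (simp add: algebra_simps)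
    then have "\<bar>(\<kappa> (y - (x + h *\<^sub>R axis k 1)) - \<kappa> (y - x)) / h\<bar> \<le> C"
      using \<open>h \<noteq> 0\<close> by (simp add: divide_le_eq)
    then show "\<bar>?F h y\<bar> \<le> C * \<bar>f y\<bar>"
      unfolding abs_mult by (rule mult_right_mono) simp
  qed (use assms in auto)
  moreover have F: "(corr \<kappa> f (x + h *\<^sub>R axis k 1) - corr \<kappa> f x) / h = (\<integral>y. ?F h y \<partial>torus)" for h
  proof -
    have *: "(\<integral>y. ?F h y \<partial>torus) = (\<integral>y. (\<kappa> (y - (x + h *\<^sub>R axis k 1)) * f y - \<kappa> (y - x) * f y) / h \<partial>torus)"
      by (intro Bochner_Integration.integral_cong) (simp_all add: left_diff_distrib)
    show ?thesis
      unfolding corr_def *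
      by (simp add: Bochner_Integration.integral_diff[OF corr_integrable[OF assms(2,4)] corr_integrable[OF assms(2,4)]])
  qed
  ultimately have "((\<lambda>h. (corr \<kappa> f (x + h *\<^sub>R axis k 1) - corr \<kappa> f x) / h)
      \<longlongrightarrow> - corr \<kappa>' f x) (at 0)"
    unfolding F by (simp add: corr_def)
  then show "((\<lambda>h. (corr \<kappa> f (x + (0 + h) *\<^sub>R axis k 1) - corr \<kappa> f (x + 0 *\<^sub>R axis k 1)) / h)
      \<longlongrightarrow> - corr \<kappa>' f x) (at 0)"
    by simp
qed

section \<open>Mollified energy flux\<close>

lemma borel_measurable_vec_nth_comp [measurable (raw)]:
  fixes f :: "'a \<Rightarrow> real^'n"
  assumes "f \<in> borel_measurable M"
  shows "(\<lambda>x. f x $ k) \<in> borel_measurable M"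
  by (rule measurable_compose[OF assms])
    (intro borel_measurable_continuous_onI continuous_intros)

text \<open>The weak divergence condition tested with all translates of \<kappa>, phrased so that it
  applies directly to mollified fields.\<close>

definition div_free :: "(real^3 \<Rightarrow> real^3) \<Rightarrow> bool" where
  "div_free b \<longleftrightarrow> (\<forall>\<kappa> x. smooth \<kappa> \<and> periodic \<kappa> \<longrightarrow>
     (\<Sum>k\<in>UNIV. corr (pderiv_dir k \<kappa>) (\<lambda>y. b y $ k) x) = 0)"

text \<open>The weak curl tested with the translates of \<kappa> in the three coordinate directions.
  Since a derivative of \<open>corr\<close> in x is minus \<open>corr\<close> with the
  differentiated kernel, the right-hand sides are the components of the curl of the mollified
  field.\<close>

definition curl_of :: "(real^3 \<Rightarrow> real^3) \<Rightarrow> (real^3 \<Rightarrow> real^3) \<Rightarrow> bool" where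
  "curl_of b j \<longleftrightarrow> (\<forall>\<kappa> x. smooth \<kappa> \<and> periodic \<kappa> \<longrightarrow>
     corr \<kappa> (\<lambda>y. j y $ 1) x
       = corr (pderiv_dir 3 \<kappa>) (\<lambda>y. b y $ 2) x - corr (pderiv_dir 2 \<kappa>) (\<lambda>y. b y $ 3) x \<and>
     corr \<kappa> (\<lambda>y. j y $ 2) x
       = corr (pderiv_dir 1 \<kappa>) (\<lambda>y. b y $ 3) x - corr (pderiv_dir 3 \<kappa>) (\<lambda>y. b y $ 1) x \<and>
     corr \<kappa> (\<lambda>y. j y $ 3) x
       = corr (pderiv_dir 2 \<kappa>) (\<lambda>y. b y $ 1) x - corr (pderiv_dir 1 \<kappa>) (\<lambda>y. b y $ 2) x)"

text \<open>Nonnegativity and unit mass make \<eta> a probability density, as the variance arguments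
  require. The symmetry of second derivatives makes the mollified current divergence free; it is
  evident for the product kernels built later.\<close>

locale kernel =
  fixes \<eta> :: "real^3 \<Rightarrow> real"
  assumes smooth_\<eta>: "smooth \<eta>" and periodic_\<eta>: "periodic \<eta>"
    and sym_\<eta>: "pderiv_dir k (pderiv_dir m \<eta>) = pderiv_dir m (pderiv_dir k \<eta>)"
    and nonneg_\<eta>: "\<eta> x \<ge> 0" and integral_\<eta>: "(\<integral>x. \<eta> x \<partial>torus) = 1"
begin

abbreviation "\<eta>1 k \<equiv> pderiv_dir k \<eta>"
abbreviation "\<eta>2 m k \<equiv> pderiv_dir m (pderiv_dir k \<eta>)"

lemma smooth_\<eta>1: "smooth (\<eta>1 k)" and periodic_\<eta>1: "periodic (\<eta>1 k)"
  by (simp_all add: smooth_pderiv_dir smooth_periodic_pderiv smooth_\<eta> periodic_\<eta>)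

lemma bper_\<eta>: "bper \<eta>" and bper_\<eta>1: "bper (\<eta>1 k)" and bper_\<eta>2: "bper (\<eta>2 m k)"
  by (simp_all add: smooth_periodic_bper smooth_pderiv_dir smooth_periodic_pderiv smooth_\<eta> periodic_\<eta>)

lemma has_pd_\<eta>: "has_pd k \<eta> (\<eta>1 k)" and has_pd_\<eta>1: "has_pd m (\<eta>1 k) (\<eta>2 m k)"
  by (simp_all add: smooth_has_pd smooth_\<eta> smooth_\<eta>1)

lemma integral_\<eta>1: "(\<integral>x. \<eta>1 k x \<partial>torus) = 0"
  by (rule integral_pd_eq_0[OF has_pd_\<eta> bper_\<eta> bper_\<eta>1])

text \<open>One integration by parts for each of the two derivatives; the two signs cancel and the
  order of the derivatives is reversed.\<close>

lemma move_derivatives: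
  assumes "integrable torus f" "integrable torus g"
  shows "(\<integral>x. corr \<eta> f x * corr (\<eta>2 k m) g x \<partial>torus) = (\<integral>x. corr (\<eta>2 m k) f x * corr \<eta> g x \<partial>torus)"
proof -
  note [intro] = bper_corr[OF bper_\<eta>] bper_corr[OF bper_\<eta>1] bper_corr[OF bper_\<eta>2] bper_minus assms
  have "(\<integral>x. corr \<eta> f x * - corr (\<eta>2 k m) g x \<partial>torus) = - (\<integral>x. - corr (\<eta>1 k) f x * corr (\<eta>1 m) g x \<partial>torus)"
    by (rule integral_by_parts_torus[where k = k])
      (auto intro!: has_pd_corr[OF has_pd_\<eta>] has_pd_corr[OF has_pd_\<eta>1] simp: bper_\<eta> bper_\<eta>1 bper_\<eta>2)
  moreover have "(\<integral>x. corr (\<eta>1 k) f x * - corr (\<eta>1 m) g x \<partial>torus) = - (\<integral>x. - corr (\<eta>2 m k) f x * corr \<eta> g x \<partial>torus)"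
    by (rule integral_by_parts_torus[where k = m])
      (auto intro!: has_pd_corr[OF has_pd_\<eta>] has_pd_corr[OF has_pd_\<eta>1] simp: bper_\<eta> bper_\<eta>1 bper_\<eta>2)
  ultimately show ?thesis by simp
qed

text \<open>The pairing of the Hall term with the test field that equals \<open>\<eta> (\<cdot> - x)\<close> in direction \<open>i\<close>.\<close>

definition hall :: "3 \<Rightarrow> (real^3 \<Rightarrow> real^3) \<Rightarrow> real^3 \<Rightarrow> real" where
  "hall i b x = (\<Sum>k\<in>UNIV.
     if i = 1 then corr (\<eta>2 k 3) (\<lambda>y. b y $ k * b y $ 2) x - corr (\<eta>2 k 2) (\<lambda>y. b y $ k * b y $ 3) x
     else if i = 2 then corr (\<eta>2 k 1) (\<lambda>y. b y $ k * b y $ 3) x - corr (\<eta>2 k 3) (\<lambda>y. b y $ k * b y $ 1) x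
     else corr (\<eta>2 k 2) (\<lambda>y. b y $ k * b y $ 1) x - corr (\<eta>2 k 1) (\<lambda>y. b y $ k * b y $ 2) x)"

text \<open>The pairing of the mollified Hall term with the mollified field. The current does not
  occur in it, so it can be shown measurable in time although the current is only known separately
  at each time.\<close>

definition flux :: "(real^3 \<Rightarrow> real^3) \<Rightarrow> real" where
  "flux b = (\<integral>x. (\<Sum>i\<in>UNIV. corr \<eta> (\<lambda>y. b y $ i) x * hall i b x) \<partial>torus)"

end

lemma square_integrable_components:
  fixes b :: "real^3 \<Rightarrow> real^3"
  assumes [measurable]: "b \<in> borel_measurable borel" and b2: "integrable torus (\<lambda>x. (norm (b x))\<^sup>2)"
  shows "integrable torus (\<lambda>x. b x $ k)" "integrable torus (\<lambda>x. b x $ k * b x $ i)"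
    "integrable torus (\<lambda>x. norm (b x))"
proof -
  have c: "\<bar>b x $ k\<bar> \<le> norm (b x)" for x k by (rule component_le_norm_cart)
  show "integrable torus (\<lambda>x. b x $ k * b x $ i)"
    by (rule Bochner_Integration.integrable_bound[OF b2])
      (use c in \<open>auto simp: abs_mult power2_eq_square intro!: mult_mono\<close>)
  have "norm (b x) \<le> 1 + (norm (b x))\<^sup>2" for x
    using sum_squares_bound[of "norm (b x)" 1] norm_ge_zero[of "b x"]
    unfolding one_power2 mult_1_right by linarith
  then show n: "integrable torus (\<lambda>x. norm (b x))"
    by (intro Bochner_Integration.integrable_bound[OF Bochner_Integration.integrable_add[OF torus.integrable_const b2], of _ 1]) auto
  show "integrable torus (\<lambda>x. b x $ k)"
    by (rule Bochner_Integration.integrable_bound[OF n]) (auto simp: c)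
qed

text \<open>One time slice, with Borel representatives of field and current that are exactly
  periodic.\<close>

locale kernel_field = kernel +
  fixes b j :: "real^3 \<Rightarrow> real^3"
  assumes b_meas [measurable]: "b \<in> borel_measurable borel" and b_per: "periodic b"
    and b_sq: "integrable torus (\<lambda>x. (norm (b x))\<^sup>2)"
    and j_meas [measurable]: "j \<in> borel_measurable borel" and j_per: "periodic j"
    and j_int: "integrable torus (\<lambda>x. norm (j x))"
    and b_div: "div_free b" and b_curl: "curl_of b j"
begin

lemma b_int: "integrable torus (\<lambda>x. b x $ k)" and bb_int: "integrable torus (\<lambda>x. b x $ k * b x $ i)"
  using square_integrable_components[OF b_meas b_sq] by auto

lemma jc_int: "integrable torus (\<lambda>x. j x $ k)"
  by (rule Bochner_Integration.integrable_bound[OF j_int]) (auto simp: component_le_norm_cart)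

text \<open>\<open>D k i\<close> and \<open>a k i\<close> are the derivatives of \<open>J i\<close>
  and \<open>u i\<close> in direction \<open>k\<close>; their minus sign is that of differentiating
  a correlation. \<open>bb k i\<close> mollifies the product, and differs from the product of the
  mollifications by the commutator.\<close>

abbreviation "u k \<equiv> corr \<eta> (\<lambda>y. b y $ k)"
abbreviation "J k \<equiv> corr \<eta> (\<lambda>y. j y $ k)"
abbreviation "D k i \<equiv> (\<lambda>x. - corr (\<eta>1 k) (\<lambda>y. j y $ i) x)"
abbreviation "a k i \<equiv> (\<lambda>x. - corr (\<eta>1 k) (\<lambda>y. b y $ i) x)"
abbreviation "bb k i \<equiv> corr \<eta> (\<lambda>y. b y $ k * b y $ i)"

lemma bper_u: "bper (u k)" and bper_J: "bper (J k)" and bper_D: "bper (D k i)" and bper_a: "bper (a k i)"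
  and bper_bb: "bper (bb k i)"
  by (auto intro!: bper_corr bper_minus bper_\<eta> bper_\<eta>1 b_int bb_int jc_int)

lemma has_pd_u: "has_pd k (u i) (a k i)" and has_pd_J: "has_pd k (J i) (D k i)"
  by (intro has_pd_corr[OF has_pd_\<eta> bper_\<eta> bper_\<eta>1] b_int jc_int)+

text \<open>The derivatives of the curl and of the divergence are moved from the products onto
  \<open>u\<close> by \<open>move_derivatives\<close>. What then acts on \<open>u\<close> is the
  derivative in direction \<open>k\<close> of its curl, that is, \<open>D k i\<close>.\<close>

lemma flux_eq: "flux b = (\<integral>x. (\<Sum>k\<in>UNIV. \<Sum>i\<in>UNIV. D k i x * bb k i x) \<partial>torus)"
proof -
  note [intro] = bper_corr[OF bper_\<eta>] bper_corr[OF bper_\<eta>1] bper_corr[OF bper_\<eta>2] bper_minus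
    b_int bb_int jc_int bper_integrable bper_mult
  \<comment> \<open>The weak curl is tested here with the differentiated kernel
    \<open>\<eta>1 k\<close>.\<close>
  have d: "D k 1 x = corr (\<eta>2 2 k) (\<lambda>y. b y $ 3) x - corr (\<eta>2 3 k) (\<lambda>y. b y $ 2) x"
    "D k 2 x = corr (\<eta>2 3 k) (\<lambda>y. b y $ 1) x - corr (\<eta>2 1 k) (\<lambda>y. b y $ 3) x"
    "D k 3 x = corr (\<eta>2 1 k) (\<lambda>y. b y $ 2) x - corr (\<eta>2 2 k) (\<lambda>y. b y $ 1) x" for k x
    using b_curl smooth_\<eta>1[of k] periodic_\<eta>1[of k] by (simp_all add: curl_of_def)
  have [simp]: "integrable torus (\<lambda>x. u i x * corr (\<eta>2 k m) (\<lambda>y. b y $ k' * b y $ i') x)"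
    "integrable torus (\<lambda>x. corr (\<eta>2 k m) (\<lambda>y. b y $ i) x * bb k' i' x)" for i k m k' i'
    by auto
  have "(\<Sum>i\<in>UNIV. u i x * hall i b x) = (\<Sum>k\<in>UNIV.
      u 1 x * corr (\<eta>2 k 3) (\<lambda>y. b y $ k * b y $ 2) x - u 1 x * corr (\<eta>2 k 2) (\<lambda>y. b y $ k * b y $ 3) x
    + u 2 x * corr (\<eta>2 k 1) (\<lambda>y. b y $ k * b y $ 3) x - u 2 x * corr (\<eta>2 k 3) (\<lambda>y. b y $ k * b y $ 1) x
    + u 3 x * corr (\<eta>2 k 2) (\<lambda>y. b y $ k * b y $ 1) x - u 3 x * corr (\<eta>2 k 1) (\<lambda>y. b y $ k * b y $ 2) x)" for x
    by (simp add: sum_3 hall_def algebra_simps)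
  then have "flux b = (\<Sum>k\<in>UNIV.
      (\<integral>x. u 1 x * corr (\<eta>2 k 3) (\<lambda>y. b y $ k * b y $ 2) x \<partial>torus) - (\<integral>x. u 1 x * corr (\<eta>2 k 2) (\<lambda>y. b y $ k * b y $ 3) x \<partial>torus)
    + (\<integral>x. u 2 x * corr (\<eta>2 k 1) (\<lambda>y. b y $ k * b y $ 3) x \<partial>torus) - (\<integral>x. u 2 x * corr (\<eta>2 k 3) (\<lambda>y. b y $ k * b y $ 1) x \<partial>torus)
    + (\<integral>x. u 3 x * corr (\<eta>2 k 2) (\<lambda>y. b y $ k * b y $ 1) x \<partial>torus) - (\<integral>x. u 3 x * corr (\<eta>2 k 1) (\<lambda>y. b y $ k * b y $ 2) x \<partial>torus))"
    unfolding flux_def by simp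
  also have "\<dots> = (\<Sum>k\<in>UNIV.
      (\<integral>x. corr (\<eta>2 3 k) (\<lambda>y. b y $ 1) x * bb k 2 x \<partial>torus) - (\<integral>x. corr (\<eta>2 2 k) (\<lambda>y. b y $ 1) x * bb k 3 x \<partial>torus)
    + (\<integral>x. corr (\<eta>2 1 k) (\<lambda>y. b y $ 2) x * bb k 3 x \<partial>torus) - (\<integral>x. corr (\<eta>2 3 k) (\<lambda>y. b y $ 2) x * bb k 1 x \<partial>torus)
    + (\<integral>x. corr (\<eta>2 2 k) (\<lambda>y. b y $ 3) x * bb k 1 x \<partial>torus) - (\<integral>x. corr (\<eta>2 1 k) (\<lambda>y. b y $ 3) x * bb k 2 x \<partial>torus))"
    by (simp add: move_derivatives b_int bb_int)
  also have "\<dots> = (\<integral>x. (\<Sum>k\<in>UNIV. 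
      corr (\<eta>2 3 k) (\<lambda>y. b y $ 1) x * bb k 2 x - corr (\<eta>2 2 k) (\<lambda>y. b y $ 1) x * bb k 3 x
    + corr (\<eta>2 1 k) (\<lambda>y. b y $ 2) x * bb k 3 x - corr (\<eta>2 3 k) (\<lambda>y. b y $ 2) x * bb k 1 x
    + corr (\<eta>2 2 k) (\<lambda>y. b y $ 3) x * bb k 1 x - corr (\<eta>2 1 k) (\<lambda>y. b y $ 3) x * bb k 2 x) \<partial>torus)"
    by simp
  also have "\<dots> = (\<integral>x. (\<Sum>k\<in>UNIV. \<Sum>i\<in>UNIV. D k i x * bb k i x) \<partial>torus)"
    unfolding sum_3[of "\<lambda>i. D _ i _ * bb _ i _"] d
    by (intro Bochner_Integration.integral_cong refl sum.cong) (simp add: algebra_simps)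
  finally show ?thesis .
qed

text \<open>Besides the wanted terms, the divergence of \<open>V\<close> contains multiples of div u
  and div J and the sum of J_i u_k (\<open>a k i\<close> - \<open>a i k\<close>). The first two
  vanish, and the last is J \<bullet> (J \<times> u), hence 0, because J is the curl of u.\<close>

lemma flux_mollified: "(\<integral>x. (\<Sum>k\<in>UNIV. \<Sum>i\<in>UNIV. D k i x * (u k x * u i x)) \<partial>torus) = 0"
proof -
  define V where "V k x = (\<Sum>i\<in>UNIV. J i x * u i x) * u k x - J k x * (\<Sum>i\<in>UNIV. (1 / 2) * (u i x * u i x))" for k x
  define V' where "V' k x = ((\<Sum>i\<in>UNIV. D k i x * u i x + J i x * a k i x) * u k x + (\<Sum>i\<in>UNIV. J i x * u i x) * a k k x)
      - (D k k x * (\<Sum>i\<in>UNIV. (1 / 2) * (u i x * u i x)) + J k x * (\<Sum>i\<in>UNIV. (1 / 2) * (a k i x * u i x + u i x * a k i x)))" for k x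
  have bV: "bper (V k)" "bper (V' k)" for k
    unfolding V_def V'_def
    by (intro bper_diff bper_add bper_mult bper_sum bper_u bper_J bper_D bper_a bper_const)+
  have "has_pd k (V k) (V' k)" for k
    unfolding V_def V'_def
    by (intro has_pd_diff has_pd_mult has_pd_sum has_pd_cmult has_pd_u has_pd_J)
  then have "(\<integral>x. V' k x \<partial>torus) = 0" for k
    using bV by (intro integral_pd_eq_0)
  then have "(\<integral>x. (\<Sum>k\<in>UNIV. V' k x) \<partial>torus) = 0"
    by (subst Bochner_Integration.integral_sum) (auto intro: bper_integrable bV)
  moreover have "(\<Sum>k\<in>UNIV. V' k x) = (\<Sum>k\<in>UNIV. \<Sum>i\<in>UNIV. D k i x * (u k x * u i x))" for x
  proof -
    have J: "J 1 x = a 2 3 x - a 3 2 x" "J 2 x = a 3 1 x - a 1 3 x" "J 3 x = a 1 2 x - a 2 1 x"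
      using b_curl smooth_\<eta> periodic_\<eta> by (simp_all add: curl_of_def)
    have "(\<Sum>k\<in>UNIV. corr (\<eta>1 k) (\<lambda>y. b y $ k) x) = 0"
      using b_div smooth_\<eta> periodic_\<eta> unfolding div_free_def by blast
    then have divu: "a 1 1 x + a 2 2 x + a 3 3 x = 0"
      unfolding sum_3 by linarith
    have "D k 1 x = corr (\<eta>2 2 k) (\<lambda>y. b y $ 3) x - corr (\<eta>2 3 k) (\<lambda>y. b y $ 2) x"
      "D k 2 x = corr (\<eta>2 3 k) (\<lambda>y. b y $ 1) x - corr (\<eta>2 1 k) (\<lambda>y. b y $ 3) x"
      "D k 3 x = corr (\<eta>2 1 k) (\<lambda>y. b y $ 2) x - corr (\<eta>2 2 k) (\<lambda>y. b y $ 1) x" for k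
      using b_curl smooth_\<eta>1[of k] periodic_\<eta>1[of k] by (simp_all add: curl_of_def)
    \<comment> \<open>The divergence of a curl: the second derivatives cancel in pairs by
      symmetry.\<close>
    from this(1)[of 1] this(2)[of 2] this(3)[of 3]
    have divJ: "D 1 1 x + D 2 2 x + D 3 3 x = 0"
      using sym_\<eta>[of 1 2] sym_\<eta>[of 1 3] sym_\<eta>[of 2 3] by simp
    show ?thesis
    proof -
      define A where "A k i = a k i x" for k i
      define E where "E k i = D k i x" for k i
      define v where "v i = u i x" for i
      \<comment> \<open>Eliminating the last diagonal entries by the two trace conditions leaves a
        polynomial identity.\<close>
      have 1: "A 3 3 = - A 1 1 - A 2 2" using divu by (simp add: A_def)
      have 2: "E 3 3 = - E 1 1 - E 2 2" using divJ by (simp add: E_def)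
      show ?thesis
        unfolding V'_def sum_3 J A_def[symmetric] E_def[symmetric] v_def[symmetric]
        unfolding 1 2 by (simp add: field_simps)
    qed
  qed
  ultimately show ?thesis by simp
qed

lemma incr_int:
  "integrable torus (\<lambda>l. b (x + l) $ k)" "integrable torus (\<lambda>l. b (x + l) $ k * b (x + l) $ i)"
  "integrable torus (\<lambda>l. j (x + l) $ k)" "integrable torus (\<lambda>l. (norm (b (x + l)))\<^sup>2)"
  "integrable torus (\<lambda>l. norm (j (x + l)))"
proof -
  have *: "integrable torus (\<lambda>l. f (x + l))"
    if "f \<in> borel_measurable borel" "periodic f" "integrable torus f" for f :: "real^3 \<Rightarrow> real"
    using integrable_torus_translate[of f x] that by (simp add: add.commute)
  show "integrable torus (\<lambda>l. b (x + l) $ k)" "integrable torus (\<lambda>l. b (x + l) $ k * b (x + l) $ i)"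
    "integrable torus (\<lambda>l. j (x + l) $ k)" "integrable torus (\<lambda>l. (norm (b (x + l)))\<^sup>2)"
    "integrable torus (\<lambda>l. norm (j (x + l)))"
    using b_per j_per b_int bb_int jc_int b_sq j_int
    by (intro *[of "\<lambda>x. b x $ k"] *[of "\<lambda>x. b x $ k * b x $ i"] *[of "\<lambda>x. j x $ k"]
        *[of "\<lambda>x. (norm (b x))\<^sup>2"] *[of "\<lambda>x. norm (j x)"]; simp add: periodic_def)+
qed

lemma \<eta>_int: "integrable torus f \<Longrightarrow> integrable torus (\<lambda>l. \<eta> l * f l)"
  by (rule bper_integrable_mult[OF bper_\<eta>])

lemma incr_sq_int: "integrable torus (\<lambda>l. \<eta> l * (norm (b (x + l) - b x))\<^sup>2)"
proof (rule \<eta>_int, rule Bochner_Integration.integrable_bound)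
  show "integrable torus (\<lambda>l. 2 * (norm (b (x + l)))\<^sup>2 + 2 * (norm (b x))\<^sup>2)"
    by (intro Bochner_Integration.integrable_add integrable_mult_right incr_int torus.integrable_const)
  have "(norm (b (x + l) - b x))\<^sup>2 \<le> 2 * (norm (b (x + l)))\<^sup>2 + 2 * (norm (b x))\<^sup>2" for l
  proof -
    have "(norm (b (x + l) - b x))\<^sup>2 \<le> (norm (b (x + l)) + norm (b x))\<^sup>2"
      by (intro power_mono norm_triangle_ineq4) simp
    also have "\<dots> \<le> 2 * (norm (b (x + l)))\<^sup>2 + 2 * (norm (b x))\<^sup>2"
      using sum_squares_bound[of "norm (b (x + l))" "norm (b x)"] by (simp add: power2_sum)
    finally show ?thesis .
  qed
  then show "AE l in torus. norm ((norm (b (x + l) - b x))\<^sup>2) \<le> norm (2 * (norm (b (x + l)))\<^sup>2 + 2 * (norm (b x))\<^sup>2)"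
    by (intro AE_I2) (simp add: abs_of_nonneg)
qed measurable

text \<open>
  With \<open>\<delta>\<close> the increment by \<open>l\<close>, the difference equals \<open>\<integral> \<eta> \<delta>b\<^sub>k \<delta>b\<^sub>i - (\<integral> \<eta> \<delta>b\<^sub>k) (\<integral> \<eta> \<delta>b\<^sub>i)\<close>
  (Constantin, E and Titi).
\<close>

lemma commutator_bound:
  "\<bar>bb k i x - u k x * u i x\<bar> \<le> 2 * (\<integral>l. \<eta> l * (norm (b (x + l) - b x))\<^sup>2 \<partial>torus)"
proof -
  define d where "d k l = b (x + l) $ k - b x $ k" for k l
  define N where "N = (\<integral>l. \<eta> l * (norm (b (x + l) - b x))\<^sup>2 \<partial>torus)"
  have per: "periodic (\<lambda>y. b y $ k)" "periodic (\<lambda>y. b y $ k * b y $ i)" for k i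
    using b_per by (simp_all add: periodic_def)
  have ex: "\<eta> l * (d k l * d i l) = \<eta> l * (b (x + l) $ k * b (x + l) $ i)
      - b x $ k * (\<eta> l * b (x + l) $ i) - b x $ i * (\<eta> l * b (x + l) $ k) + b x $ k * b x $ i * \<eta> l" for k i l
    by (simp add: d_def algebra_simps)
  have int2: "integrable torus (\<lambda>l. \<eta> l * (d k l * d i l))" for k i
    unfolding ex
    by (intro Bochner_Integration.integrable_add Bochner_Integration.integrable_diff integrable_mult_right
        \<eta>_int incr_int bper_integrable bper_\<eta>)
  have i2: "(\<integral>l. \<eta> l * (d k l * d i l) \<partial>torus)
      = bb k i x - b x $ k * u i x - b x $ i * u k x + b x $ k * b x $ i" for k i
    unfolding ex
    by (simp add: \<eta>_int incr_int bper_integrable bper_\<eta> integral_\<eta> corr_translate[OF bper_\<eta>] b_int bb_int per)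
  have d1: "\<eta> l * d k l = \<eta> l * b (x + l) $ k - b x $ k * \<eta> l" for k l
    by (simp add: d_def algebra_simps)
  have int1: "integrable torus (\<lambda>l. \<eta> l * d k l)" for k
    unfolding d1 by (intro Bochner_Integration.integrable_diff integrable_mult_right
        \<eta>_int incr_int bper_integrable bper_\<eta>)
  have i1: "(\<integral>l. \<eta> l * d k l \<partial>torus) = u k x - b x $ k" for k
    unfolding d1
    by (simp add: \<eta>_int incr_int bper_integrable bper_\<eta> integral_\<eta> corr_translate[OF bper_\<eta>] b_int per)
  have "\<bar>d k l * d i l\<bar> \<le> (norm (b (x + l) - b x))\<^sup>2" for k i l
    using component_le_norm_cart[of "b (x + l) - b x" k] component_le_norm_cart[of "b (x + l) - b x" i]
    unfolding abs_mult power2_eq_square by (intro mult_mono) (auto simp: d_def)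
  then have b2: "\<bar>\<integral>l. \<eta> l * (d k l * d i l) \<partial>torus\<bar> \<le> N" for k i
    unfolding N_def using nonneg_\<eta>
    by (intro order_trans[OF integral_abs_bound] integral_mono integrable_abs int2 incr_sq_int)
      (auto simp: abs_mult intro!: mult_left_mono)
  \<comment> \<open>Since \<eta> is a probability density, the variance of the increment is
    nonnegative; hence the squared mean is at most the mean square.\<close>
  have b1: "(\<integral>l. \<eta> l * d k l \<partial>torus)\<^sup>2 \<le> N" for k
  proof -
    define p where "p = (\<integral>l. \<eta> l * d k l \<partial>torus)"
    have sq: "\<eta> l * (d k l - p)\<^sup>2 = \<eta> l * (d k l * d k l) - 2 * p * (\<eta> l * d k l) + p\<^sup>2 * \<eta> l" for l
      by (simp add: power2_eq_square algebra_simps)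
    have "0 \<le> (\<integral>l. \<eta> l * (d k l - p)\<^sup>2 \<partial>torus)"
      using nonneg_\<eta> by (intro Bochner_Integration.integral_nonneg) simp
    also have "\<dots> = (\<integral>l. \<eta> l * (d k l * d k l) \<partial>torus) - p\<^sup>2"
      unfolding sq using int1 int2 by (simp add: bper_integrable bper_\<eta> integral_\<eta> p_def[symmetric] power2_eq_square)
    also have "\<dots> \<le> N - p\<^sup>2" using b2[of k k] by linarith
    finally show ?thesis by (simp add: p_def)
  qed
  \<comment> \<open>Subtracting the constant b(x) inside all mollifications leaves the commutator
    unchanged, which is why only increments remain.\<close>
  have "bb k i x - u k x * u i x = (\<integral>l. \<eta> l * (d k l * d i l) \<partial>torus) - (\<integral>l. \<eta> l * d k l \<partial>torus) * (\<integral>l. \<eta> l * d i l \<partial>torus)"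
    unfolding i1 i2 by (simp add: algebra_simps)
  moreover have "\<bar>(\<integral>l. \<eta> l * d k l \<partial>torus) * (\<integral>l. \<eta> l * d i l \<partial>torus)\<bar> \<le> N"
  proof -
    have "2 * \<bar>p * q\<bar> \<le> p\<^sup>2 + q\<^sup>2" for p q :: real
      using sum_squares_bound[of "\<bar>p\<bar>" "\<bar>q\<bar>"] by (simp add: abs_mult)
    from this[of "\<integral>l. \<eta> l * d k l \<partial>torus" "\<integral>l. \<eta> l * d i l \<partial>torus"] show ?thesis
      using b1[of k] b1[of i] by linarith
  qed
  ultimately show ?thesis
    using b2[of k i] unfolding N_def[symmetric] by linarith
qed

text \<open>The gradient kernel \<open>\<eta>1 k\<close> has integral 0, so the constant j(x) can be
  subtracted under the integral.\<close>

lemma D_bound: "ennreal \<bar>D k i x\<bar> \<le> (\<integral>\<^sup>+l. ennreal (\<bar>\<eta>1 k l\<bar> * norm (j (x + l) - j x)) \<partial>torus)"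
proof -
  have per: "periodic (\<lambda>y. j y $ i)" using j_per by (simp add: periodic_def)
  have int: "integrable torus (\<lambda>l. \<eta>1 k l * (j (x + l) $ i - j x $ i))"
    by (intro bper_integrable_mult bper_\<eta>1 Bochner_Integration.integrable_diff incr_int torus.integrable_const)
  have "(\<integral>l. \<eta>1 k l * (j (x + l) $ i - j x $ i) \<partial>torus) = corr (\<eta>1 k) (\<lambda>y. j y $ i) x"
    unfolding right_diff_distrib
    by (simp add: bper_integrable_mult[OF bper_\<eta>1] incr_int integral_\<eta>1 corr_translate[OF bper_\<eta>1 _ per] jc_int
        bper_integrable[OF bper_\<eta>1])
  then have "ennreal \<bar>D k i x\<bar> = ennreal (norm (\<integral>l. \<eta>1 k l * (j (x + l) $ i - j x $ i) \<partial>torus))"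
    by simp
  also have "\<dots> \<le> (\<integral>\<^sup>+l. norm (\<eta>1 k l * (j (x + l) $ i - j x $ i)) \<partial>torus)"
    by (rule integral_norm_bound_ennreal[OF int])
  also have "\<dots> \<le> (\<integral>\<^sup>+l. ennreal (\<bar>\<eta>1 k l\<bar> * norm (j (x + l) - j x)) \<partial>torus)"
    using component_le_norm_cart[of "j (x + l) - j x" i for l]
    by (intro nn_integral_mono ennreal_leI) (auto simp: abs_mult intro!: mult_left_mono)
  finally show ?thesis .
qed

text \<open>The gradient of the current and the commutator are controlled by integrals over
  independent displacements l and l'. Tonelli puts the integral over x innermost, where
  \<open>K\<close> bounds it uniformly for l and l' in \<open>S\<close>; what is left are the masses
  of the two kernels. The 18 is the factor 2 of the commutator bound times 9 pairs of
  indices.\<close>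

lemma flux_bound:
  assumes S: "\<And>l l'. l \<in> S \<Longrightarrow> l' \<in> S \<Longrightarrow>
      (\<integral>\<^sup>+x. ennreal (norm (j (x + l) - j x) * (norm (b (x + l') - b x))\<^sup>2) \<partial>torus) \<le> ennreal K"
    and supp: "\<And>l. l \<in> unit_cube \<Longrightarrow> l \<notin> S \<Longrightarrow> \<eta> l = 0"
      "\<And>k l. l \<in> unit_cube \<Longrightarrow> l \<notin> S \<Longrightarrow> \<eta>1 k l = 0"
    and G: "\<And>k. (\<integral>l. \<bar>\<eta>1 k l\<bar> \<partial>torus) \<le> G" and "K \<ge> 0"
  shows "\<bar>flux b\<bar> \<le> 18 * G * K"
proof -
  have [measurable]: "\<eta> \<in> borel_measurable borel" "\<eta>1 k \<in> borel_measurable borel" for k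
    by (rule bper_measurable bper_\<eta> bper_\<eta>1)+
  interpret pair_sigma_finite torus torus
    by (intro pair_sigma_finite.intro torus.sigma_finite_measure_axioms)
  have Q: "AE l in torus. l \<in> unit_cube" by (simp add: AE_torus)
  have "G \<ge> 0" using G[of 1] by (rule order_trans[OF Bochner_Integration.integral_nonneg, rotated]) simp
  define R where "R k i x = bb k i x - u k x * u i x" for k i x
  have bR: "bper (R k i)" for k i
    unfolding R_def[abs_def] by (intro bper_diff bper_mult bper_u bper_bb)
  have flux: "flux b = (\<Sum>k\<in>UNIV. \<Sum>i\<in>UNIV. (\<integral>x. D k i x * R k i x \<partial>torus))"
  proof -
    have [simp]: "integrable torus (\<lambda>x. corr (\<eta>1 k) (\<lambda>y. j y $ i) x * bb k i x)"
      "integrable torus (\<lambda>x. corr (\<eta>1 k) (\<lambda>y. j y $ i) x * (u k x * u i x))" for k i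
      by (intro bper_integrable bper_mult bper_u bper_corr bper_\<eta>1 jc_int bper_bb)+
    have "(\<Sum>k\<in>UNIV. \<Sum>i\<in>UNIV. (\<integral>x. D k i x * R k i x \<partial>torus)) =
        (\<Sum>k\<in>UNIV. \<Sum>i\<in>UNIV. (\<integral>x. D k i x * bb k i x \<partial>torus)) - (\<Sum>k\<in>UNIV. \<Sum>i\<in>UNIV. (\<integral>x. D k i x * (u k x * u i x) \<partial>torus))"
      unfolding R_def right_diff_distrib
      by (subst Bochner_Integration.integral_diff) (simp_all only: sum_subtractf, simp_all)
    also have "\<dots> = flux b"
      unfolding flux_eq using flux_mollified by (subst (asm) Bochner_Integration.integral_sum; simp)+
    finally show ?thesis ..
  qed
  have "\<bar>\<integral>x. D k i x * R k i x \<partial>torus\<bar> \<le> 2 * G * K" for k i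
  proof -
    let ?dj = "\<lambda>l x. ennreal (norm (j (x + l) - j x))" and ?db = "\<lambda>l x. ennreal ((norm (b (x + l) - b x))\<^sup>2)"
    have bd: "ennreal \<bar>D k i x * R k i x\<bar> \<le>
        (\<integral>\<^sup>+l. ennreal \<bar>\<eta>1 k l\<bar> * ?dj l x \<partial>torus) * (2 * (\<integral>\<^sup>+l'. ennreal (\<eta> l') * ?db l' x \<partial>torus))" for x
    proof -
      have "ennreal \<bar>R k i x\<bar> \<le> ennreal (2 * (\<integral>l. \<eta> l * (norm (b (x + l) - b x))\<^sup>2 \<partial>torus))"
        unfolding R_def by (intro ennreal_leI commutator_bound)
      also have "\<dots> = 2 * (\<integral>\<^sup>+l'. ennreal (\<eta> l') * ?db l' x \<partial>torus)"
        using nonneg_\<eta> by (simp add: ennreal_mult nn_integral_eq_integral[OF incr_sq_int, symmetric])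
      finally show ?thesis
        unfolding abs_mult ennreal_mult[OF abs_ge_zero abs_ge_zero]
        using D_bound[of k i x] by (intro mult_mono) (simp_all add: ennreal_mult)
    qed
    \<comment> \<open>From here on all integrals are of nonnegative functions, so that the order of
      integration can be changed without any joint integrability.\<close>
    have "ennreal \<bar>\<integral>x. D k i x * R k i x \<partial>torus\<bar> \<le> (\<integral>\<^sup>+x. ennreal \<bar>D k i x * R k i x\<bar> \<partial>torus)"
      unfolding real_norm_def[symmetric]
      by (rule integral_norm_bound_ennreal[OF bper_integrable[OF bper_mult[OF bper_D bR]]])
    also have "\<dots> \<le> (\<integral>\<^sup>+x. (\<integral>\<^sup>+l. ennreal \<bar>\<eta>1 k l\<bar> * ?dj l x \<partial>torus) * (2 * (\<integral>\<^sup>+l'. ennreal (\<eta> l') * ?db l' x \<partial>torus)) \<partial>torus)"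
      by (intro nn_integral_mono bd)
    also have "\<dots> = (\<integral>\<^sup>+x. (\<integral>\<^sup>+l. (\<integral>\<^sup>+l'. 2 * ennreal \<bar>\<eta>1 k l\<bar> * ennreal (\<eta> l') * (?dj l x * ?db l' x) \<partial>torus) \<partial>torus) \<partial>torus)"
    proof (rule nn_integral_cong)
      fix x
      have "(\<integral>\<^sup>+l. ennreal \<bar>\<eta>1 k l\<bar> * ?dj l x \<partial>torus) * (2 * (\<integral>\<^sup>+l'. ennreal (\<eta> l') * ?db l' x \<partial>torus))
          = (\<integral>\<^sup>+l. ennreal \<bar>\<eta>1 k l\<bar> * ?dj l x * (2 * (\<integral>\<^sup>+l'. ennreal (\<eta> l') * ?db l' x \<partial>torus)) \<partial>torus)"
        by (rule nn_integral_multc[symmetric]) measurable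
      also have "\<dots> = (\<integral>\<^sup>+l. (\<integral>\<^sup>+l'. 2 * ennreal \<bar>\<eta>1 k l\<bar> * ennreal (\<eta> l') * (?dj l x * ?db l' x) \<partial>torus) \<partial>torus)"
        by (intro nn_integral_cong) (simp add: nn_integral_cmult[symmetric] ac_simps)
      finally show "(\<integral>\<^sup>+l. ennreal \<bar>\<eta>1 k l\<bar> * ?dj l x \<partial>torus) * (2 * (\<integral>\<^sup>+l'. ennreal (\<eta> l') * ?db l' x \<partial>torus))
          = (\<integral>\<^sup>+l. (\<integral>\<^sup>+l'. 2 * ennreal \<bar>\<eta>1 k l\<bar> * ennreal (\<eta> l') * (?dj l x * ?db l' x) \<partial>torus) \<partial>torus)" .
    qed
    also have "\<dots> = (\<integral>\<^sup>+l. (\<integral>\<^sup>+x. (\<integral>\<^sup>+l'. 2 * ennreal \<bar>\<eta>1 k l\<bar> * ennreal (\<eta> l') * (?dj l x * ?db l' x) \<partial>torus) \<partial>torus) \<partial>torus)"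
      by (rule Fubini') measurable
    also have "\<dots> = (\<integral>\<^sup>+l. (\<integral>\<^sup>+l'. (\<integral>\<^sup>+x. 2 * ennreal \<bar>\<eta>1 k l\<bar> * ennreal (\<eta> l') * (?dj l x * ?db l' x) \<partial>torus) \<partial>torus) \<partial>torus)"
      by (intro nn_integral_cong Fubini') measurable
    also have "\<dots> = (\<integral>\<^sup>+l. (\<integral>\<^sup>+l'. 2 * ennreal \<bar>\<eta>1 k l\<bar> * ennreal (\<eta> l') * (\<integral>\<^sup>+x. ?dj l x * ?db l' x \<partial>torus) \<partial>torus) \<partial>torus)"
      by (simp add: nn_integral_cmult)
    also have "\<dots> \<le> (\<integral>\<^sup>+l. (\<integral>\<^sup>+l'. 2 * ennreal \<bar>\<eta>1 k l\<bar> * ennreal (\<eta> l') * ennreal K \<partial>torus) \<partial>torus)"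
    \<comment> \<open>If l or l' lies outside \<open>S\<close>, the corresponding kernel factor
      vanishes, so \<open>K\<close> is called upon only inside.\<close>
    proof (rule nn_integral_mono_AE, use Q in eventually_elim, rule nn_integral_mono_AE, use Q in eventually_elim)
      fix l l' assume "l \<in> unit_cube" "l' \<in> unit_cube"
      then show "2 * ennreal \<bar>\<eta>1 k l\<bar> * ennreal (\<eta> l') * (\<integral>\<^sup>+x. ?dj l x * ?db l' x \<partial>torus)
          \<le> 2 * ennreal \<bar>\<eta>1 k l\<bar> * ennreal (\<eta> l') * ennreal K"
        using S[of l l'] supp(1)[of l'] supp(2)[of l k]
        by (cases "l \<in> S"; cases "l' \<in> S") (auto simp: ennreal_mult intro!: mult_left_mono)
    qed
    also have "\<dots> = 2 * (\<integral>\<^sup>+l. ennreal \<bar>\<eta>1 k l\<bar> \<partial>torus) * (\<integral>\<^sup>+l'. ennreal (\<eta> l') \<partial>torus) * ennreal K"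
      by (simp add: nn_integral_multc nn_integral_cmult)
    also have "\<dots> = 2 * ennreal (\<integral>l. \<bar>\<eta>1 k l\<bar> \<partial>torus) * ennreal K"
      using nonneg_\<eta>
      by (simp add: nn_integral_eq_integral integrable_abs bper_integrable bper_\<eta> bper_\<eta>1 integral_\<eta>)
    also have "\<dots> \<le> 2 * ennreal G * ennreal K"
      by (intro mult_mono ennreal_leI G) auto
    also have "\<dots> = ennreal (2 * G * K)"
      using \<open>G \<ge> 0\<close> \<open>K \<ge> 0\<close> by (simp add: ennreal_mult)
    finally show ?thesis using \<open>G \<ge> 0\<close> \<open>K \<ge> 0\<close> by (simp add: ennreal_le_iff)
  qed
  then have "\<bar>flux b\<bar> \<le> (\<Sum>k\<in>(UNIV::3 set). \<Sum>i\<in>(UNIV::3 set). 2 * G * K)"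
    unfolding flux by (intro order_trans[OF sum_abs] sum_mono)
  then show ?thesis by simp
qed

end

section \<open>Mollifiers supported away from the origin\<close>

lemma deriv_eq_0_outside:
  fixes h :: "real \<Rightarrow> real"
  assumes "\<And>s. s \<notin> {a..b} \<Longrightarrow> h s = 0" "s \<notin> {a..b}"
  shows "deriv h s = 0"
proof (rule DERIV_imp_deriv)
  have "((\<lambda>_. 0) has_real_derivative 0) (at s)" by simp
  then show "(h has_real_derivative 0) (at s)"
    by (rule has_field_derivative_transform_within_open[where S = "- {a..b}"])
      (use assms in auto)
qed

text \<open>The support [a, b] lies strictly inside (0, 1), so the periodisation vanishes near every
  integer, the only places where \<open>frac\<close> jumps; elsewhere \<open>frac\<close> is locally
  a translation.\<close>

lemma has_derivative_frac:
  fixes h :: "real \<Rightarrow> real"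
  assumes h: "smooth h" "\<And>s. s \<notin> {a..b} \<Longrightarrow> h s = 0" and ab: "0 < a" "a \<le> b" "b < 1"
  shows "((\<lambda>s. h (frac s)) has_real_derivative deriv h (frac s)) (at s)"
proof (cases "frac s = 0")
  case True
  then have s: "s = of_int \<lfloor>s\<rfloor>" by (simp add: frac_def)
  define n where "n = \<lfloor>s\<rfloor>"
  \<comment> \<open>To the right of n the fractional part stays below a, to the left of n it stays
    above b.\<close>
  have z: "h (frac r) = 0" if "r \<in> {of_int n - (1 - b)<..<of_int n + a}" for r
  proof (cases "r \<ge> of_int n")
    case True
    then have "of_int \<lfloor>r\<rfloor> \<ge> (of_int n :: real)" by (simp add: le_floor_iff)
    then have "frac r < a" using that by (simp add: frac_def)
    then show ?thesis by (intro h(2)) simp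
  next
    case False
    have "\<lfloor>r\<rfloor> = n - 1" using that ab False by (intro floor_unique) auto
    then have "frac r > b" using that by (simp add: frac_def)
    then show ?thesis by (intro h(2)) simp
  qed
  have "((\<lambda>_. 0) has_real_derivative 0) (at s)" by simp
  then have "((\<lambda>s. h (frac s)) has_real_derivative 0) (at s)"
    by (rule has_field_derivative_transform_within_open[where S = "{of_int n - (1 - b)<..<of_int n + a}"])
      (use z s ab in \<open>auto simp: n_def\<close>)
  moreover have "deriv h 0 = 0"
    using ab by (intro deriv_eq_0_outside[OF h(2)]) auto
  ultimately show ?thesis unfolding True by simp
next
  case False
  have "((\<lambda>r. h (r + (- of_int \<lfloor>s\<rfloor>))) has_real_derivative deriv h (frac s)) (at s)"
    using smooth_deriv_real(1)[OF h(1), of "frac s"]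
      DERIV_shift[of h "deriv h (frac s)" s "- of_int \<lfloor>s\<rfloor>"]
    by (simp add: frac_def)
  then show ?thesis
  proof (rule has_field_derivative_transform_within_open[where S = "{of_int \<lfloor>s\<rfloor><..<of_int \<lfloor>s\<rfloor> + 1}"])
    show "s \<in> {of_int \<lfloor>s\<rfloor><..<of_int \<lfloor>s\<rfloor> + 1}"
      using False frac_ge_0[of s] frac_lt_1[of s] unfolding frac_def greaterThanLessThan_iff by linarith
    fix r :: real assume "r \<in> {of_int \<lfloor>s\<rfloor><..<of_int \<lfloor>s\<rfloor> + 1}"
    then have "\<lfloor>r\<rfloor> = \<lfloor>s\<rfloor>" by (intro floor_unique) auto
    then show "h (r + - of_int \<lfloor>s\<rfloor>) = h (frac r)" by (simp add: frac_def)
  qed simp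
qed

text \<open>The derivative of \<open>h\<close> is supported in the same interval, so the induction
  can continue with it.\<close>

lemma smooth_frac:
  fixes h :: "real \<Rightarrow> real"
  assumes "smooth h" "\<And>s. s \<notin> {a..b} \<Longrightarrow> h s = 0" and ab: "0 < a" "a \<le> b" "b < 1"
  shows "smooth (\<lambda>s. h (frac s))"
  unfolding smooth_def
proof
  fix k
  show "k_times_cont_diff k (\<lambda>s. h (frac s))"
    using assms(1,2)
  proof (induction k arbitrary: h)
    case 0
    then show ?case
      using DERIV_isCont[OF has_derivative_frac[OF 0 ab]]
      by (simp add: continuous_at_imp_continuous_on)
  next
    case (Suc k)
    show ?case
      using Suc deriv_eq_0_outside[OF Suc.prems(2)] smooth_deriv_real(2)[OF Suc.prems(1)]
      by (intro k_times_cont_diff_Suc_real[OF has_derivative_frac[OF Suc.prems ab]] Suc.IH) auto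
  qed
qed

text \<open>Product functions reduce the kernel to one dimension: a partial derivative changes only
  one factor, so the symmetry of second derivatives can be read off.\<close>

definition tensor :: "(3 \<Rightarrow> real \<Rightarrow> real) \<Rightarrow> real^3 \<Rightarrow> real" where
  "tensor g y = (\<Prod>i\<in>UNIV. g i (y $ i))"

lemma smooth_tensor: "(\<And>i. smooth (g i)) \<Longrightarrow> smooth (tensor g)"
  unfolding tensor_def[abs_def]
  using smooth_compose_affine[OF bounded_linear_vec_nth, where c = 0]
  by (intro smooth_prod) auto

lemma pderiv_dir_tensor:
  assumes "\<And>i. smooth (g i)"
  shows "pderiv_dir k (tensor g) = tensor (g(k := deriv (g k)))"
proof (rule has_pd_unique[OF smooth_has_pd[OF smooth_tensor[OF assms]]])
  show "has_pd k (tensor g) (tensor (g(k := deriv (g k))))"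
    unfolding has_pd_def
  proof
    fix x :: "real^3"
    have t: "tensor f y = f k (y $ k) * (\<Prod>i\<in>UNIV - {k}. f i (y $ i))" for f y
      unfolding tensor_def by (subst prod.remove[of _ k]) auto
    have r: "(\<Prod>i\<in>UNIV - {k}. g i ((x + s *\<^sub>R axis k 1) $ i)) = (\<Prod>i\<in>UNIV - {k}. g i (x $ i))" for s
      by (intro prod.cong) (auto simp: axis_def)
    have "((\<lambda>s. g k (s + x $ k)) has_real_derivative deriv (g k) (x $ k)) (at 0)"
      using smooth_deriv_real(1)[OF assms[of k], of "x $ k"]
      using DERIV_shift[of "g k" _ 0 "x $ k"] by simp
    then have "((\<lambda>s. g k (x $ k + s)) has_real_derivative deriv (g k) (x $ k)) (at 0)"
      by (simp add: add.commute)
    from DERIV_cmult_right[OF this, of "\<Prod>i\<in>UNIV - {k}. g i (x $ i)"]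
    show "((\<lambda>s. tensor g (x + s *\<^sub>R axis k 1)) has_real_derivative tensor (g(k := deriv (g k))) x) (at 0)"
      unfolding t r by (simp add: axis_def)
  qed
qed

lemma pderiv_dir_cmult:
  fixes f :: "real^3 \<Rightarrow> real"
  assumes "smooth f" shows "pderiv_dir k (\<lambda>x. c * f x) = (\<lambda>x. c * pderiv_dir k f x)"
  by (rule has_pd_unique[OF smooth_has_pd[OF smooth_cmult] has_pd_cmult[OF smooth_has_pd]]) fact+

lemma measure_torus_cbox:
  assumes "0 \<le> c" "c \<le> d" "d < 1"
  shows "measure torus {y. \<forall>i. c \<le> y $ i \<and> y $ i \<le> d} = (d - c) ^ 3"
    and "{y::real^3. \<forall>i. c \<le> y $ i \<and> y $ i \<le> d} \<in> sets borel"
proof -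
  have eq: "{y. \<forall>i. c \<le> y $ i \<and> y $ i \<le> d} = cbox (\<chi> i::3. c) (\<chi> i. d)"
    by (auto simp: mem_box_cart)
  show "{y::real^3. \<forall>i. c \<le> y $ i \<and> y $ i \<le> d} \<in> sets borel" unfolding eq by simp
  have sub: "cbox (\<chi> i. c) (\<chi> i. d) \<subseteq> unit_cube"
    using assms by (auto simp: mem_box_cart unit_cube_def intro: order_trans) (meson le_less_trans)
  have "emeasure torus (cbox (\<chi> i. c) (\<chi> i. d)) = emeasure lborel (cbox (\<chi> i. c) (\<chi> i::3. d))"
    using sub by (simp add: torus_def emeasure_density)
      (auto intro!: nn_integral_cong simp: indicator_def simp flip: nn_integral_indicator)
  moreover have "cbox (\<chi> i::3. c) (\<chi> i. d) \<noteq> {}"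
    using assms by (auto simp: interval_ne_empty_cart)
  then have "measure lborel (cbox (\<chi> i::3. c) (\<chi> i. d)) = (d - c) ^ 3"
    by (subst content_cbox_cart) auto
  ultimately show "measure torus {y. \<forall>i. c \<le> y $ i \<and> y $ i \<le> d} = (d - c) ^ 3"
    unfolding eq by (simp add: measure_def)
qed

text \<open>The bump lives on [\<epsilon>/2, \<epsilon>] in each coordinate, so the support is a box
  near one corner of the cube: it avoids the faces, as the periodisation requires, and stays away
  from the origin. The profile is rescaled without a power of \<epsilon> in front and then
  normalised by its integral \<open>Z\<close>, which is at least a multiple of \<epsilon>^3.\<close>

lemma kernel_exists:
  obtains C where "C > 0" and "\<And>\<epsilon>. 0 < \<epsilon> \<Longrightarrow> \<epsilon> < 1 \<Longrightarrow> \<exists>\<eta>. kernel \<eta> \<and>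
    (\<forall>l\<in>unit_cube. \<not> (\<forall>i. \<epsilon> / 2 \<le> l $ i \<and> l $ i \<le> \<epsilon>) \<longrightarrow> \<eta> l = 0 \<and> (\<forall>k. pderiv_dir k \<eta> l = 0)) \<and>
    (\<forall>k. (\<integral>l. \<bar>pderiv_dir k \<eta> l\<bar> \<partial>torus) \<le> C / \<epsilon>)"
proof -
  obtain \<rho> :: "real \<Rightarrow> real" where \<rho>: "smooth \<rho>" "\<And>x. \<rho> x \<ge> 0" "\<And>x. x \<notin> {1/2<..<1} \<Longrightarrow> \<rho> x = 0"
    "\<And>x. x \<in> {1/2<..<1} \<Longrightarrow> \<rho> x > 0"
    using smooth_bump_exists[of "1/2" 1] by auto
  have \<rho>0: "x \<notin> {1/2..1} \<Longrightarrow> \<rho> x = 0" for x using \<rho>(3)[of x] by auto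
  \<comment> \<open>A positive lower bound for the profile on the middle part of its support, needed
    to bound the normalising integral from below.\<close>
  have "\<exists>x\<in>{5/8..7/8}. \<forall>y\<in>{5/8..7/8}. \<rho> x \<le> \<rho> y"
    by (rule continuous_attains_inf) (auto intro: continuous_on_subset[OF smooth_continuous[OF \<rho>(1)]])
  then obtain x0 where "x0 \<in> {5/8..7/8}" "\<And>y. y \<in> {5/8..7/8} \<Longrightarrow> \<rho> x0 \<le> \<rho> y" by blast
  then obtain c where c: "c > 0" "\<And>y. y \<in> {5/8..7/8} \<Longrightarrow> c \<le> \<rho> y"
    using \<rho>(4) by (intro that[of "\<rho> x0"]) auto
  have bdd: "\<exists>M. \<forall>x. \<bar>f x\<bar> \<le> M" if "continuous_on UNIV f" "\<And>x. x \<notin> {1/2..1} \<Longrightarrow> f x = 0" for f :: "real \<Rightarrow> real"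
  proof -
    have "compact (f ` {1/2..1})"
      by (intro compact_continuous_image continuous_on_subset[OF that(1)]) auto
    then obtain M where "\<And>x. x \<in> {1/2..1} \<Longrightarrow> \<bar>f x\<bar> \<le> M"
      by (metis compact_imp_bounded bounded_iff image_eqI real_norm_def)
    then have "\<bar>f x\<bar> \<le> max M 0" for x using that(2)[of x] by (cases "x \<in> {1/2..1}") (auto simp: le_max_iff_disj)
    then show ?thesis by blast
  qed
  obtain M1 where M1: "\<And>x. \<bar>\<rho> x\<bar> \<le> M1"
    using bdd[OF smooth_continuous[OF \<rho>(1)] \<rho>0] by blast
  obtain M2 where M2: "\<And>x. \<bar>deriv \<rho> x\<bar> \<le> M2"
    using bdd[OF smooth_continuous[OF smooth_deriv_real(2)[OF \<rho>(1)]] deriv_eq_0_outside[of "1/2" 1, OF \<rho>0]] by blast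
  define M where "M = max M1 M2 + 1"
  have M: "\<bar>\<rho> x\<bar> \<le> M" "\<bar>deriv \<rho> x\<bar> \<le> M" for x
    using M1[of x] M2[of x] by (auto simp: M_def)
  have "M > 0" using M1[of 0] by (simp add: M_def less_max_iff_disj add_strict_increasing2 le_max_iff_disj)
  \<comment> \<open>The middle box has side \<epsilon>/4, so \<open>Z\<close> is at least c^3
    \<epsilon>^3 / 64; the gradient before normalisation is at most M^3 / \<epsilon>, on a box of
    volume at most \<epsilon>^3. The powers of \<epsilon> from the two volumes cancel.\<close>
  define C where "C = 64 * M ^ 3 / c ^ 3"
  show ?thesis
  proof (rule that[of C])
    show "C > 0" using c \<open>M > 0\<close> by (simp add: C_def)
    fix \<epsilon> :: real assume \<epsilon>: "0 < \<epsilon>" "\<epsilon> < 1"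
    define h where "h r = \<rho> (r / \<epsilon>)" for r
    have "bounded_linear (\<lambda>r::real. r / \<epsilon>)" by (rule bounded_linear_divide)
    from smooth_compose_affine[OF this \<rho>(1), of 0] have h: "smooth h" by (simp add: h_def[abs_def])
    have h0: "h r = 0" if "r \<notin> {\<epsilon>/2..\<epsilon>}" for r
      unfolding h_def using that \<epsilon> by (intro \<rho>0) (auto simp: field_simps)
    have "(h has_real_derivative deriv \<rho> (r / \<epsilon>) * (1 / \<epsilon>)) (at r)" for r
      unfolding h_def[abs_def] by (rule DERIV_chain2[OF smooth_deriv_real(1)[OF \<rho>(1)]])
        (use \<epsilon> in \<open>auto intro!: derivative_eq_intros\<close>)
    then have h': "deriv h r = deriv \<rho> (r / \<epsilon>) / \<epsilon>" for r by (simp add: DERIV_imp_deriv)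
    define K where "K s = h (frac s)" for s
    have K: "smooth K" unfolding K_def[abs_def] by (rule smooth_frac[where a = "\<epsilon>/2" and b = \<epsilon>, OF h h0]) (use \<epsilon> in auto)
    have K': "deriv K s = deriv h (frac s)" for s
      unfolding K_def[abs_def] by (rule DERIV_imp_deriv, rule has_derivative_frac[where a = "\<epsilon>/2" and b = \<epsilon>, OF h h0]) (use \<epsilon> in auto)
    define g where "g = (\<lambda>i::3. K)"
    define \<eta>0 where "\<eta>0 = tensor g"
    have sg: "smooth (g i)" for i by (simp add: g_def K)
    have sg': "smooth ((g(k := deriv (g k))) i)" for i k by (simp add: g_def K smooth_deriv_real)
    have s0: "smooth \<eta>0" unfolding \<eta>0_def by (rule smooth_tensor[OF sg])
    have p0: "periodic \<eta>0"
      by (auto simp: periodic_def \<eta>0_def tensor_def g_def K_def axis_def frac_1_eq intro!: prod.cong)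
    have d1: "pderiv_dir k \<eta>0 = tensor (g(k := deriv (g k)))" for k
      unfolding \<eta>0_def by (rule pderiv_dir_tensor[OF sg])
    \<comment> \<open>For different indices the two updates of the factors commute.\<close>
    have sym0: "pderiv_dir m (pderiv_dir k \<eta>0) = pderiv_dir k (pderiv_dir m \<eta>0)" for k m
      unfolding d1 pderiv_dir_tensor[OF sg'] by (cases "k = m") (auto intro!: arg_cong[where f = tensor])
    have pos0: "\<eta>0 y \<ge> 0" for y
      by (auto simp: \<eta>0_def tensor_def g_def K_def h_def \<rho>(2) intro!: prod_nonneg)
    have b0: "bper \<eta>0" "bper (pderiv_dir k \<eta>0)" for k
      by (simp_all add: smooth_periodic_bper smooth_pderiv_dir smooth_periodic_pderiv s0 p0)
    have K0: "K s = 0" "deriv K s = 0" if "0 \<le> s" "s < 1" "s \<notin> {\<epsilon>/2..\<epsilon>}" for s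
      using that h0 deriv_eq_0_outside[of "\<epsilon>/2" \<epsilon> h s, OF h0] by (simp_all add: K_def K' frac_eq[THEN iffD2])
    have van: "\<eta>0 l = 0" "pderiv_dir k \<eta>0 l = 0"
      if l: "l \<in> unit_cube" "\<not> (\<forall>i. \<epsilon> / 2 \<le> l $ i \<and> l $ i \<le> \<epsilon>)" for l k
    proof -
      obtain i where "l $ i \<notin> {\<epsilon>/2..\<epsilon>}" using l(2) by auto
      then have "K (l $ i) = 0" "deriv K (l $ i) = 0" using K0[of "l $ i"] l(1) by (auto simp: unit_cube_def)
      then show "\<eta>0 l = 0" "pderiv_dir k \<eta>0 l = 0"
        unfolding d1 unfolding \<eta>0_def tensor_def g_def by (auto intro!: prod_zero)
    qed
    have "\<bar>(g(k := deriv (g k))) i s\<bar> \<le> (if i = k then M / \<epsilon> else M)" for i k s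
    proof (cases "i = k")
      case True
      then show ?thesis
        using divide_right_mono[OF M(2)[of "frac s / \<epsilon>"], of \<epsilon>] \<epsilon> by (simp add: g_def K' h' abs_divide)
    next
      case False
      then show ?thesis using M(1)[of "frac s / \<epsilon>"] by (simp add: g_def K_def h_def)
    qed
    then have "\<bar>pderiv_dir k \<eta>0 y\<bar> \<le> (\<Prod>i\<in>UNIV. if i = k then M / \<epsilon> else M)" for k y
      unfolding d1 tensor_def abs_prod by (intro prod_mono) auto
    moreover have "(\<Prod>i\<in>UNIV. if i = k then M / \<epsilon> else M) = M ^ 3 / \<epsilon>" for k :: 3
      by (subst prod.remove[of _ k]) (auto simp: card_Diff_singleton power3_eq_cube power2_eq_square)
    ultimately have d1b: "\<bar>pderiv_dir k \<eta>0 y\<bar> \<le> M ^ 3 / \<epsilon>" for k y by simp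
    define S where "S = {y::real^3. \<forall>i. \<epsilon> / 2 \<le> y $ i \<and> y $ i \<le> \<epsilon>}"
    define S' where "S' = {y::real^3. \<forall>i. 5 * \<epsilon> / 8 \<le> y $ i \<and> y $ i \<le> 7 * \<epsilon> / 8}"
    have mS: "measure torus S = (\<epsilon> / 2) ^ 3" "measure torus S' = (\<epsilon> / 4) ^ 3"
      and [measurable]: "S \<in> sets borel" "S' \<in> sets borel"
      using measure_torus_cbox[of "\<epsilon>/2" \<epsilon>] measure_torus_cbox[of "5 * \<epsilon> / 8" "7 * \<epsilon> / 8"] \<epsilon>
      by (auto simp: S_def S'_def)
    define Z where "Z = (\<integral>y. \<eta>0 y \<partial>torus)"
    have "c ^ 3 * (\<epsilon> / 4) ^ 3 = (\<integral>y. c ^ 3 * indicator S' y \<partial>torus)"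
      by (simp add: mS)
    also have "\<dots> \<le> Z"
      unfolding Z_def
    proof (rule integral_mono)
      show "integrable torus \<eta>0" by (rule bper_integrable[OF b0(1)])
      show "integrable torus (\<lambda>y. c ^ 3 * indicator S' y :: real)" by (simp add: torus.emeasure_finite less_top[symmetric])
      fix y
      show "c ^ 3 * indicator S' y \<le> \<eta>0 y"
      proof (cases "y \<in> S'")
        case True
        have "c \<le> K (y $ i)" for i
        proof -
          have y: "5 * \<epsilon> / 8 \<le> y $ i" "y $ i \<le> 7 * \<epsilon> / 8" using True by (auto simp: S'_def)
          then have "frac (y $ i) = y $ i" using \<epsilon> by (intro frac_eq[THEN iffD2]) auto
          then show ?thesis unfolding K_def h_def using y \<epsilon> by (auto intro!: c(2) simp: field_simps)
        qed
        then have "(\<Prod>i\<in>(UNIV::3 set). c) \<le> \<eta>0 y"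
          unfolding \<eta>0_def tensor_def g_def using c(1) by (intro prod_mono) auto
        then show ?thesis using True by simp
      qed (use pos0 in auto)
    qed
    finally have Z: "Z \<ge> c ^ 3 * (\<epsilon> / 4) ^ 3" .
    have c3: "c ^ 3 * (\<epsilon> / 4) ^ 3 > 0" using c \<epsilon> by simp
    then have "Z > 0" using Z by linarith
    define \<eta> where "\<eta> y = (1 / Z) * \<eta>0 y" for y
    have d: "pderiv_dir k \<eta> = (\<lambda>y. (1 / Z) * pderiv_dir k \<eta>0 y)" for k
      unfolding \<eta>_def[abs_def] by (rule pderiv_dir_cmult[OF s0])
    have "kernel \<eta>"
    proof
      show "smooth \<eta>" unfolding \<eta>_def[abs_def] by (rule smooth_cmult[OF s0])
      show "periodic \<eta>" using p0 by (simp add: periodic_def \<eta>_def)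
      show "pderiv_dir k (pderiv_dir m \<eta>) = pderiv_dir m (pderiv_dir k \<eta>)" for k m
        unfolding d by (subst (1 2) pderiv_dir_cmult) (simp_all add: smooth_pderiv_dir s0 sym0)
      show "0 \<le> \<eta> x" for x using pos0 \<open>Z > 0\<close> by (simp add: \<eta>_def)
      show "(\<integral>x. \<eta> x \<partial>torus) = 1" using \<open>Z > 0\<close> by (simp add: \<eta>_def Z_def[symmetric])
    qed
    moreover have "(\<integral>l. \<bar>pderiv_dir k \<eta> l\<bar> \<partial>torus) \<le> C / \<epsilon>" for k
    proof -
      have "(\<integral>l. \<bar>pderiv_dir k \<eta>0 l\<bar> \<partial>torus) \<le> (\<integral>l. M ^ 3 / \<epsilon> * indicator S l \<partial>torus)"
      proof (rule integral_mono_AE)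
        show "integrable torus (\<lambda>l. \<bar>pderiv_dir k \<eta>0 l\<bar>)" by (intro integrable_abs bper_integrable b0)
        show "integrable torus (\<lambda>l. M ^ 3 / \<epsilon> * indicator S l)" by (simp add: torus.emeasure_finite less_top[symmetric])
        show "AE l in torus. \<bar>pderiv_dir k \<eta>0 l\<bar> \<le> M ^ 3 / \<epsilon> * indicator S l"
          unfolding AE_torus
        proof (intro AE_I2 impI)
          fix l :: "real^3" assume "l \<in> unit_cube"
          then show "\<bar>pderiv_dir k \<eta>0 l\<bar> \<le> M ^ 3 / \<epsilon> * indicator S l"
            using van(2)[of l k] d1b[of k l] by (cases "l \<in> S") (auto simp: S_def)
        qed
      qed
      also have "\<dots> = M ^ 3 / \<epsilon> * (\<epsilon> / 2) ^ 3" by (simp add: mS)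
      finally have "(\<integral>l. \<bar>pderiv_dir k \<eta> l\<bar> \<partial>torus) \<le> (1 / Z) * (M ^ 3 / \<epsilon> * (\<epsilon> / 2) ^ 3)"
        using \<open>Z > 0\<close> unfolding d
        by (simp only: abs_mult integral_mult_right_zero abs_of_pos zero_less_divide_1_iff)
          (intro mult_left_mono; simp)
      also have "\<dots> \<le> (1 / (c ^ 3 * (\<epsilon> / 4) ^ 3)) * (M ^ 3 / \<epsilon> * \<epsilon> ^ 3)"
        using Z c3 \<open>M > 0\<close> \<epsilon> by (intro mult_mono divide_left_mono divide_right_mono power_mono) auto
      also have "\<dots> = C / \<epsilon>"
        using c \<epsilon> by (simp add: C_def power_divide)
      finally show ?thesis .
    qed
    moreover have "\<forall>l\<in>unit_cube. \<not> (\<forall>i. \<epsilon> / 2 \<le> l $ i \<and> l $ i \<le> \<epsilon>) \<longrightarrow> \<eta> l = 0 \<and> (\<forall>k. pderiv_dir k \<eta> l = 0)"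
      unfolding d using van by (simp add: \<eta>_def)
    ultimately show "\<exists>\<eta>. kernel \<eta> \<and>
      (\<forall>l\<in>unit_cube. \<not> (\<forall>i. \<epsilon> / 2 \<le> l $ i \<and> l $ i \<le> \<epsilon>) \<longrightarrow> \<eta> l = 0 \<and> (\<forall>k. pderiv_dir k \<eta> l = 0)) \<and>
      (\<forall>k. (\<integral>l. \<bar>pderiv_dir k \<eta> l\<bar> \<partial>torus) \<le> C / \<epsilon>)" by blast
  qed
qed

section \<open>Continuity of translations\<close>

text \<open>Young's inequality is applied to \<open>f\<close> and \<open>g\<close> divided by the
  bounds for their norms. Enlarging \<open>A\<close> and \<open>B\<close> by \<open>e\<close> keeps
  the divisors positive; letting \<open>e\<close> tend to 0 then covers vanishing bounds as
  well.\<close>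

lemma nn_integral_Holder:
  fixes f g :: "'a \<Rightarrow> real"
  assumes [measurable]: "f \<in> borel_measurable M" "g \<in> borel_measurable M"
    and nn: "\<And>x. f x \<ge> 0" "\<And>x. g x \<ge> 0"
    and pq: "p > 1" "q > 1" "1 / p + 1 / q = 1" and AB: "A \<ge> 0" "B \<ge> 0"
    and f: "(\<integral>\<^sup>+x. ennreal (f x powr p) \<partial>M) \<le> ennreal (A powr p)"
    and g: "(\<integral>\<^sup>+x. ennreal (g x powr q) \<partial>M) \<le> ennreal (B powr q)"
  shows "(\<integral>\<^sup>+x. ennreal (f x * g x) \<partial>M) \<le> ennreal (A * B)"
proof -
  have le: "(\<integral>\<^sup>+x. ennreal (f x * g x) \<partial>M) \<le> ennreal ((A + e) * (B + e))" if "e > 0" for e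
  proof -
    define a b where "a = A + e" and "b = B + e"
    have ab: "a > 0" "b > 0" "A \<le> a" "B \<le> b" using AB that by (auto simp: a_def b_def)
    have "f x * g x \<le> a * b * (f x powr p / (p * a powr p) + g x powr q / (q * b powr q))" for x
    proof -
      have "f x / a * (g x / b) \<le> (f x / a) powr p / p + (g x / b) powr q / q"
        using nn ab pq by (intro Youngs_inequality) auto
      then have "a * b * (f x / a * (g x / b)) \<le> a * b * ((f x / a) powr p / p + (g x / b) powr q / q)"
        using ab by (intro mult_left_mono) auto
      then show ?thesis using ab nn by (simp add: powr_divide mult.commute)
    qed
    then have "(\<integral>\<^sup>+x. ennreal (f x * g x) \<partial>M)
        \<le> (\<integral>\<^sup>+x. ennreal (b * a / (p * a powr p)) * ennreal (f x powr p) + ennreal (a * b / (q * b powr q)) * ennreal (g x powr q) \<partial>M)"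
      using ab pq by (intro nn_integral_mono) (simp add: ennreal_plus[symmetric] ennreal_mult[symmetric] algebra_simps del: ennreal_plus)
    also have "\<dots> = ennreal (b * a / (p * a powr p)) * (\<integral>\<^sup>+x. ennreal (f x powr p) \<partial>M) + ennreal (a * b / (q * b powr q)) * (\<integral>\<^sup>+x. ennreal (g x powr q) \<partial>M)"
      by (simp add: nn_integral_add nn_integral_cmult)
    also have "\<dots> \<le> ennreal (b * a / (p * a powr p)) * ennreal (a powr p) + ennreal (a * b / (q * b powr q)) * ennreal (b powr q)"
      using ab AB pq by (intro add_mono mult_left_mono order_trans[OF f] order_trans[OF g] ennreal_leI powr_mono2) auto
    also have "\<dots> = ennreal (a * b / p + a * b / q)"
      using ab pq(1,2) by (simp add: ennreal_plus[symmetric] ennreal_mult[symmetric] algebra_simps del: ennreal_plus)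
    also have "a * b / p + a * b / q = a * b * (1 / p + 1 / q)"
      by (simp add: algebra_simps)
    finally show ?thesis using pq(3) by (simp add: a_def b_def)
  qed
  have "((\<lambda>e. ennreal ((A + e) * (B + e))) \<longlongrightarrow> ennreal ((A + 0) * (B + 0))) (at_right 0)"
    by (intro tendsto_ennrealI tendsto_intros)
  from tendsto_lowerbound[OF this, of "\<integral>\<^sup>+x. ennreal (f x * g x) \<partial>M"] show ?thesis
    using le by (auto simp: eventually_at_filter)
qed

text \<open>Meant for errors of continuous approximants, which are not periodic: the box [-1, 2]^3
  contains every translate of the cube by a vector of length at most 1.\<close>

lemma nn_integral_torus_translate_le:
  fixes h :: "real^3 \<Rightarrow> ennreal"
  assumes [measurable]: "h \<in> borel_measurable borel" and l: "norm l \<le> 1"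
  shows "(\<integral>\<^sup>+x. h (x + l) \<partial>torus) \<le> (\<integral>\<^sup>+x. indicator (cbox (\<chi> i. -1) (\<chi> i. 2)) x * h x \<partial>lborel)"
proof -
  have "(\<integral>\<^sup>+x. h (x + l) \<partial>torus) = (\<integral>\<^sup>+x. indicator unit_cube x * h (x + l) \<partial>lborel)"
    by (simp add: torus_def nn_integral_density)
  also have "\<dots> = (\<integral>\<^sup>+x. indicator unit_cube (x - l) * h x \<partial>lborel)"
    by (subst (2) lborel_translate[of l, symmetric], subst nn_integral_distr) (auto simp: add.commute)
  also have "\<dots> \<le> (\<integral>\<^sup>+x. indicator (cbox (\<chi> i. -1) (\<chi> i. 2)) x * h x \<partial>lborel)"
  proof (intro nn_integral_mono mult_right_mono)
    fix x :: "real^3"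
    have "x \<in> cbox (\<chi> i. -1) (\<chi> i. 2)" if "x - l \<in> unit_cube"
    proof -
      have "-1 \<le> x $ i \<and> x $ i \<le> 2" for i
        using that component_le_norm_cart[of l i] l unfolding unit_cube_def
        by (auto dest!: spec[of _ i])
      then show ?thesis by (simp add: mem_box_cart)
    qed
    then show "indicator unit_cube (x - l) \<le> (indicator (cbox (\<chi> i. -1) (\<chi> i. 2)) x :: ennreal)"
      by (auto simp: indicator_def)
  qed simp
  finally show ?thesis .
qed

text \<open>A measurable function is almost everywhere a limit of continuous functions. Truncating
  these at the bound \<open>C\<close> gives a dominated sequence on the set \<open>W\<close> of
  finite measure, so the convergence also holds in L2 of \<open>W\<close>.\<close>

lemma continuous_L2_approx:
  fixes f :: "real^3 \<Rightarrow> real"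
  assumes [measurable]: "f \<in> borel_measurable borel" and C: "\<And>x. \<bar>f x\<bar> \<le> C"
    and W: "emeasure lborel W < \<infinity>" and [measurable]: "W \<in> sets borel" and "e > 0"
  obtains g where "continuous_on UNIV g"
    "(\<integral>\<^sup>+x. indicator W x * ennreal ((f x - g x)\<^sup>2) \<partial>lborel) \<le> ennreal e"
proof -
  have "f measurable_on UNIV"
    by (rule lebesgue_measurable_imp_measurable_on_real) (auto simp: measurable_completion)
  then obtain N g0 where N: "negligible N" and g0: "\<And>n::nat. continuous_on UNIV (g0 n)"
    and lim: "\<And>x. x \<notin> N \<Longrightarrow> (\<lambda>n. g0 n x) \<longlonglongrightarrow> f x"
    unfolding measurable_on_def by auto
  define g where "g n x = max (- C) (min C (g0 n x))" for n x
  have C0: "C \<ge> 0" using C[of 0] by linarith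
  have g: "continuous_on UNIV (g n)" for n
    unfolding g_def[abs_def] by (intro continuous_intros g0)
  then have [measurable]: "g n \<in> borel_measurable borel" for n
    by (rule borel_measurable_continuous_onI)
  have gC: "\<bar>g n x\<bar> \<le> C" for n x using C0 by (auto simp: g_def)
  have AE: "AE x in lborel. x \<notin> N"
    using N by (subst AE_completion_iff[symmetric]) (auto simp: negligible_iff_null_sets intro: AE_not_in)
  have gl: "(\<lambda>n. g n x) \<longlonglongrightarrow> f x" if "x \<notin> N" for x
  proof -
    have "(\<lambda>n. max (- C) (min C (g0 n x))) \<longlonglongrightarrow> max (- C) (min C (f x))"
      by (intro tendsto_intros lim that)
    moreover have "max (- C) (min C (f x)) = f x" using C[of x] by auto
    ultimately show ?thesis by (simp add: g_def)
  qed
  have fg: "(f x - g n x)\<^sup>2 \<le> (2 * C)\<^sup>2" for n x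
  proof -
    have "\<bar>f x - g n x\<bar> \<le> 2 * C" using C[of x] gC[of n x] by linarith
    then show ?thesis by (metis abs_le_square_iff abs_of_nonneg abs_ge_zero order_trans)
  qed
  have intW: "integrable lborel (\<lambda>x. indicator W x * (2 * C)\<^sup>2)"
    using W by (intro integrable_mult_left integrable_real_indicator) auto
  have "(\<lambda>n. \<integral>x. indicator W x * (f x - g n x)\<^sup>2 \<partial>lborel) \<longlonglongrightarrow> (\<integral>x. 0 \<partial>(lborel :: (real^3) measure))"
  proof (rule integral_dominated_convergence[OF _ _ intW])
    show "AE x in lborel. (\<lambda>n. indicator W x * (f x - g n x)\<^sup>2) \<longlonglongrightarrow> 0"
      using AE
    proof eventually_elim
      case (elim x)
      have "(\<lambda>n. indicator W x * (f x - g n x)\<^sup>2) \<longlonglongrightarrow> indicator W x * (f x - f x)\<^sup>2"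
        by (intro tendsto_intros gl elim)
      then show ?case by simp
    qed
    show "AE x in lborel. norm (indicator W x * (f x - g n x)\<^sup>2) \<le> indicator W x * (2 * C)\<^sup>2" for n
      using fg by (intro AE_I2) (auto simp: abs_mult intro!: mult_left_mono)
  qed auto
  then have "\<forall>\<^sub>F n in sequentially. (\<integral>x. indicator W x * (f x - g n x)\<^sup>2 \<partial>lborel) < e"
    using \<open>e > 0\<close> by (intro order_tendstoD(2)) auto
  then obtain n where n: "(\<integral>x. indicator W x * (f x - g n x)\<^sup>2 \<partial>lborel) < e"
    by (auto simp: eventually_sequentially)
  have "(\<integral>\<^sup>+x. indicator W x * ennreal ((f x - g n x)\<^sup>2) \<partial>lborel) = (\<integral>\<^sup>+x. ennreal (indicator W x * (f x - g n x)\<^sup>2) \<partial>lborel)"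
    by (intro nn_integral_cong) (auto simp: indicator_def)
  also have "\<dots> = ennreal (\<integral>x. indicator W x * (f x - g n x)\<^sup>2 \<partial>lborel)"
  proof (rule nn_integral_eq_integral)
    show "integrable lborel (\<lambda>x. indicator W x * (f x - g n x)\<^sup>2)"
      by (rule Bochner_Integration.integrable_bound[OF intW])
        (use fg in \<open>auto simp: abs_mult intro!: mult_left_mono\<close>)
  qed simp
  finally show ?thesis using n g by (intro that[of "g n"]) (auto intro: ennreal_leI)
qed

lemma square_sum3_le: "(x - y)\<^sup>2 \<le> 3 * (x - p)\<^sup>2 + 3 * (p - q)\<^sup>2 + 3 * (y - q)\<^sup>2" for x y p q :: real
proof -
  \<comment> \<open>The defect of the inequality is a sum of squares of differences.\<close>
  have "3 * (a\<^sup>2 + b\<^sup>2 + c\<^sup>2) - (a + b + c)\<^sup>2 = (a - b)\<^sup>2 + (b - c)\<^sup>2 + (a - c)\<^sup>2" for a b c :: real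
    by (simp add: power2_eq_square algebra_simps)
  from this[of "x - p" "p - q" "q - y"] show ?thesis
    by (simp add: power2_commute[of q y])
      (smt (verit) zero_le_power2)
qed

lemma nn_integral_square_sum3_le:
  fixes F G P Q :: "'a \<Rightarrow> real"
  assumes [measurable]: "F \<in> borel_measurable M" "G \<in> borel_measurable M" "P \<in> borel_measurable M" "Q \<in> borel_measurable M"
  shows "(\<integral>\<^sup>+x. ennreal ((F x - G x)\<^sup>2) \<partial>M) \<le> 3 * (\<integral>\<^sup>+x. ennreal ((F x - P x)\<^sup>2) \<partial>M)
     + 3 * (\<integral>\<^sup>+x. ennreal ((P x - Q x)\<^sup>2) \<partial>M) + 3 * (\<integral>\<^sup>+x. ennreal ((G x - Q x)\<^sup>2) \<partial>M)"
proof -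
  have "ennreal ((F x - G x)\<^sup>2) \<le> 3 * ennreal ((F x - P x)\<^sup>2) + 3 * ennreal ((P x - Q x)\<^sup>2) + 3 * ennreal ((G x - Q x)\<^sup>2)" for x
  proof -
    have "ennreal ((F x - G x)\<^sup>2) \<le> ennreal (3 * (F x - P x)\<^sup>2 + 3 * (P x - Q x)\<^sup>2 + 3 * (G x - Q x)\<^sup>2)"
      by (rule ennreal_leI[OF square_sum3_le])
    then show ?thesis by (simp add: ennreal_mult)
  qed
  then have "(\<integral>\<^sup>+x. ennreal ((F x - G x)\<^sup>2) \<partial>M) \<le> (\<integral>\<^sup>+x. 3 * ennreal ((F x - P x)\<^sup>2) + 3 * ennreal ((P x - Q x)\<^sup>2) + 3 * ennreal ((G x - Q x)\<^sup>2) \<partial>M)"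
    by (intro nn_integral_mono)
  then show ?thesis by (simp add: nn_integral_add nn_integral_cmult)
qed

lemma ennreal_nine_ninths:
  assumes "e \<ge> 0"
  shows "3 * ennreal (e / 9) + 3 * ennreal (e / 9) + 3 * ennreal (e / 9) = ennreal e"
proof -
  have "3 * ennreal (e / 9) = ennreal (e / 3)"
    using ennreal_mult[of 3 "e / 9"] assms by simp
  then show ?thesis using assms by (simp add: ennreal_plus[symmetric] del: ennreal_plus)
qed

text \<open>A three-term splitting through a continuous approximant, which is uniformly continuous
  on the box [-1, 2]^3. Each error is made at most e/9 because squaring a sum of three terms costs a
  factor 3.\<close>

lemma translation_L2_bounded:
  assumes "bper f" "e > 0"
  shows "\<exists>d>0. \<forall>l. norm l < d \<longrightarrow> (\<integral>\<^sup>+x. ennreal ((f (x + l) - f x)\<^sup>2) \<partial>torus) \<le> ennreal e"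
proof -
  let ?W = "cbox (\<chi> i. -1) (\<chi> i. 2) :: (real^3) set"
  obtain C where C: "\<And>x. \<bar>f x\<bar> \<le> C" using assms by (meson bperE)
  have [measurable]: "f \<in> borel_measurable borel" using assms by (simp add: bper_iff)
  have e: "e / 9 > 0" using assms by simp
  obtain g where g: "continuous_on UNIV g"
    "(\<integral>\<^sup>+x. indicator ?W x * ennreal ((f x - g x)\<^sup>2) \<partial>lborel) \<le> ennreal (e / 9)"
    using continuous_L2_approx[of f C ?W "e / 9", OF _ C emeasure_lborel_cbox_finite _ e] by auto
  have [measurable]: "g \<in> borel_measurable borel" using g(1) by (rule borel_measurable_continuous_onI)
  have "uniformly_continuous_on ?W g"
    by (intro compact_uniformly_continuous continuous_on_subset[OF g(1)]) auto
  then obtain d where d: "d > 0" "\<And>x y. x \<in> ?W \<Longrightarrow> y \<in> ?W \<Longrightarrow> dist y x < d \<Longrightarrow> dist (g y) (g x) < sqrt (e / 9)"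
    unfolding uniformly_continuous_on_def using e by (metis real_sqrt_gt_0_iff)
  show ?thesis
  proof (intro exI[of _ "min d 1"] conjI allI impI)
    fix l :: "real^3" assume l: "norm l < min d 1"
    have 1: "(\<integral>\<^sup>+x. ennreal ((f (x + l) - g (x + l))\<^sup>2) \<partial>torus) \<le> ennreal (e / 9)"
      using l by (intro order_trans[OF nn_integral_torus_translate_le g(2)]) auto
    have 2: "(\<integral>\<^sup>+x. ennreal ((f x - g x)\<^sup>2) \<partial>torus) \<le> ennreal (e / 9)"
      using nn_integral_torus_translate_le[of "\<lambda>x. ennreal ((f x - g x)\<^sup>2)" 0] g(2) by simp
    have "(\<integral>\<^sup>+x. ennreal ((g (x + l) - g x)\<^sup>2) \<partial>torus) \<le> (\<integral>\<^sup>+x. ennreal (e / 9) \<partial>torus)"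
    proof (rule nn_integral_mono_AE)
      have "(g (x + l) - g x)\<^sup>2 \<le> e / 9" if x: "x \<in> unit_cube" for x
      proof -
        have "x \<in> ?W" "x + l \<in> ?W"
          unfolding mem_box_cart
        proof (safe, goal_cases)
          case (1 i) then show ?case using x by (simp add: unit_cube_def) (metis le_minus_one_simps(1) order_trans)
        next
          case (2 i) then show ?case using x unfolding unit_cube_def by (auto dest!: spec[of _ i])
        next
          case (3 i) then show ?case using x component_le_norm_cart[of l i] l unfolding unit_cube_def by (auto dest!: spec[of _ i])
        next
          case (4 i) then show ?case using x component_le_norm_cart[of l i] l unfolding unit_cube_def by (auto dest!: spec[of _ i])
        qed
        then have "\<bar>g (x + l) - g x\<bar> < sqrt (e / 9)"
          using d(2)[of x "x + l"] l by (simp add: dist_norm)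
        then have "\<bar>g (x + l) - g x\<bar>\<^sup>2 \<le> (sqrt (e / 9))\<^sup>2"
          by (intro power_mono) auto
        then show ?thesis using e by simp
      qed
      then show "AE x in torus. ennreal ((g (x + l) - g x)\<^sup>2) \<le> ennreal (e / 9)"
        unfolding AE_torus by (intro AE_I2) (auto intro: ennreal_leI)
    qed
    then have 3: "(\<integral>\<^sup>+x. ennreal ((g (x + l) - g x)\<^sup>2) \<partial>torus) \<le> ennreal (e / 9)"
      by (simp add: emeasure_torus_UNIV)
    have "(\<integral>\<^sup>+x. ennreal ((f (x + l) - f x)\<^sup>2) \<partial>torus) \<le> 3 * ennreal (e / 9) + 3 * ennreal (e / 9) + 3 * ennreal (e / 9)"
      by (rule order_trans[OF nn_integral_square_sum3_le[where P = "\<lambda>x. g (x + l)" and Q = g]])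
        (use 1 2 3 in \<open>auto intro!: add_mono mult_left_mono\<close>)
    also have "\<dots> = ennreal e" by (rule ennreal_nine_ninths) (use assms in simp)
    finally show "(\<integral>\<^sup>+x. ennreal ((f (x + l) - f x)\<^sup>2) \<partial>torus) \<le> ennreal e" .
  qed (use d in auto)
qed

text \<open>Truncation at height \<open>n\<close> reduces to bounded functions. The truncated
  function is still periodic, so the truncation error of the translate equals that of the function
  itself.\<close>

lemma translation_L2:
  fixes f :: "real^3 \<Rightarrow> real"
  assumes [measurable]: "f \<in> borel_measurable borel" and per: "periodic f"
    and sq: "integrable torus (\<lambda>x. (f x)\<^sup>2)" and "e > 0"
  shows "\<exists>d>0. \<forall>l. norm l < d \<longrightarrow> (\<integral>\<^sup>+x. ennreal ((f (x + l) - f x)\<^sup>2) \<partial>torus) \<le> ennreal e"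
proof -
  define g where "g n x = max (- real n) (min (real n) (f x))" for n x
  have [measurable]: "g n \<in> borel_measurable borel" for n unfolding g_def[abs_def] by measurable
  have per_g: "periodic (g n)" for n using per by (simp add: periodic_def g_def)
  have bg: "bper (g n)" for n
    unfolding bper_iff using per_g by (auto intro!: exI[of _ "real n"] simp: g_def)
  have dom: "\<bar>f x - g n x\<bar> \<le> \<bar>f x\<bar>" for n x by (auto simp: g_def)
  have "(\<lambda>n. \<integral>x. (f x - g n x)\<^sup>2 \<partial>torus) \<longlonglongrightarrow> (\<integral>x. 0 \<partial>torus)"
  proof (rule integral_dominated_convergence[OF _ _ sq])
    show "AE x in torus. (\<lambda>n. (f x - g n x)\<^sup>2) \<longlonglongrightarrow> 0"
    proof (intro AE_I2)
      fix x
      obtain N :: nat where "\<bar>f x\<bar> \<le> N" using real_arch_simple by blast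
      then have "(f x - g n x)\<^sup>2 = 0" if "n \<ge> N" for n using that by (auto simp: g_def)
      then show "(\<lambda>n. (f x - g n x)\<^sup>2) \<longlonglongrightarrow> 0"
        by (intro tendsto_eventually) (auto simp: eventually_sequentially)
    qed
    show "AE x in torus. norm ((f x - g n x)\<^sup>2) \<le> (f x)\<^sup>2" for n
      using dom by (intro AE_I2) (simp add: abs_le_square_iff)
  qed auto
  then have "\<forall>\<^sub>F n in sequentially. (\<integral>x. (f x - g n x)\<^sup>2 \<partial>torus) < e / 9"
    using \<open>e > 0\<close> by (intro order_tendstoD(2)) auto
  then obtain n where n: "(\<integral>x. (f x - g n x)\<^sup>2 \<partial>torus) < e / 9"
    by (auto simp: eventually_sequentially)
  have "integrable torus (\<lambda>x. (f x - g n x)\<^sup>2)"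
    by (rule Bochner_Integration.integrable_bound[OF sq]) (use dom in \<open>auto simp: abs_le_square_iff\<close>)
  then have 2: "(\<integral>\<^sup>+x. ennreal ((f x - g n x)\<^sup>2) \<partial>torus) \<le> ennreal (e / 9)"
    using n by (subst nn_integral_eq_integral) (auto intro: ennreal_leI)
  have 1: "(\<integral>\<^sup>+x. ennreal ((f (x + l) - g n (x + l))\<^sup>2) \<partial>torus) \<le> ennreal (e / 9)" for l
    using 2 per per_g[of n] by (subst nn_integral_torus_translate[of "\<lambda>x. ennreal ((f x - g n x)\<^sup>2)" l])
      (auto simp: periodic_def)
  have "e / 9 > 0" using \<open>e > 0\<close> by simp
  from translation_L2_bounded[OF bg[of n] this] obtain d where "d > 0"
    and 3: "\<And>l. norm l < d \<Longrightarrow> (\<integral>\<^sup>+x. ennreal ((g n (x + l) - g n x)\<^sup>2) \<partial>torus) \<le> ennreal (e / 9)"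
    by blast
  have "(\<integral>\<^sup>+x. ennreal ((f (x + l) - f x)\<^sup>2) \<partial>torus) \<le> ennreal e" if "norm l < d" for l
  proof -
    have "(\<integral>\<^sup>+x. ennreal ((f (x + l) - f x)\<^sup>2) \<partial>torus) \<le> 3 * ennreal (e / 9) + 3 * ennreal (e / 9) + 3 * ennreal (e / 9)"
      by (rule order_trans[OF nn_integral_square_sum3_le[where P = "\<lambda>x. g n (x + l)" and Q = "g n"]])
        (use 1[of l] 2 3[OF that] in \<open>auto intro!: add_mono mult_left_mono\<close>)
    also have "\<dots> = ennreal e" by (rule ennreal_nine_ninths) (use \<open>e > 0\<close> in simp)
    finally show ?thesis .
  qed
  then show ?thesis using \<open>d > 0\<close> by blast
qed

section \<open>Mollification in L2\<close>

context kernel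
begin

text \<open>The variance of \<open>f\<close> under the probability density \<eta> is
  nonnegative.\<close>

lemma jensen:
  assumes "integrable torus f" "integrable torus (\<lambda>l. (f l)\<^sup>2)"
  shows "(\<integral>l. \<eta> l * f l \<partial>torus)\<^sup>2 \<le> (\<integral>l. \<eta> l * (f l)\<^sup>2 \<partial>torus)"
proof -
  define p where "p = (\<integral>l. \<eta> l * f l \<partial>torus)"
  have sq: "\<eta> l * (f l - p)\<^sup>2 = \<eta> l * (f l)\<^sup>2 - 2 * p * (\<eta> l * f l) + p\<^sup>2 * \<eta> l" for l
    by (simp add: power2_eq_square algebra_simps)
  have [simp]: "integrable torus (\<lambda>l. \<eta> l * f l)" "integrable torus (\<lambda>l. \<eta> l * (f l)\<^sup>2)" "integrable torus \<eta>"
    using assms by (auto intro: bper_integrable_mult bper_integrable bper_\<eta>)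
  have "0 \<le> (\<integral>l. \<eta> l * (f l - p)\<^sup>2 \<partial>torus)"
    using nonneg_\<eta> by (intro Bochner_Integration.integral_nonneg) simp
  also have "\<dots> = (\<integral>l. \<eta> l * (f l)\<^sup>2 \<partial>torus) - p\<^sup>2"
    unfolding sq by (simp add: integral_\<eta> p_def[symmetric]) (simp add: power2_eq_square)
  finally show ?thesis by (simp add: p_def)
qed

text \<open>Jensen under the integral over x, then Tonelli and the unit mass of \<eta>. The bound is
  asked for only where \<eta> does not vanish. With translates for \<open>F\<close> this makes
  mollification a contraction of L2, with increments it gives convergence.\<close>

lemma mollify_L2:
  fixes F :: "real^3 \<Rightarrow> real^3 \<Rightarrow> real"
  assumes [measurable]: "(\<lambda>(l, x). F l x) \<in> borel_measurable (borel \<Otimes>\<^sub>M borel)"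
    and int: "\<And>x. integrable torus (\<lambda>l. F l x)" "\<And>x. integrable torus (\<lambda>l. (F l x)\<^sup>2)"
    and K: "\<And>l. l \<in> unit_cube \<Longrightarrow> \<eta> l \<noteq> 0 \<Longrightarrow> (\<integral>\<^sup>+x. ennreal ((F l x)\<^sup>2) \<partial>torus) \<le> K"
  shows "(\<integral>\<^sup>+x. ennreal ((\<integral>l. \<eta> l * F l x \<partial>torus)\<^sup>2) \<partial>torus) \<le> K"
proof -
  have [measurable]: "\<eta> \<in> borel_measurable borel" by (rule bper_measurable[OF bper_\<eta>])
  interpret pair_sigma_finite torus torus
    by (intro pair_sigma_finite.intro torus.sigma_finite_measure_axioms)
  have Q: "AE l in torus. l \<in> unit_cube" by (simp add: AE_torus)
  have [measurable]: "(\<lambda>x. F l x) \<in> borel_measurable borel" for l by measurable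
  have "(\<integral>\<^sup>+x. ennreal ((\<integral>l. \<eta> l * F l x \<partial>torus)\<^sup>2) \<partial>torus) \<le> (\<integral>\<^sup>+x. (\<integral>\<^sup>+l. ennreal (\<eta> l) * ennreal ((F l x)\<^sup>2) \<partial>torus) \<partial>torus)"
  proof (rule nn_integral_mono)
    fix x
    have "ennreal ((\<integral>l. \<eta> l * F l x \<partial>torus)\<^sup>2) \<le> ennreal (\<integral>l. \<eta> l * (F l x)\<^sup>2 \<partial>torus)"
      by (intro ennreal_leI jensen int)
    also have "\<dots> = (\<integral>\<^sup>+l. ennreal (\<eta> l * (F l x)\<^sup>2) \<partial>torus)"
      using nonneg_\<eta> by (intro nn_integral_eq_integral[symmetric] bper_integrable_mult bper_\<eta> int) auto
    finally show "ennreal ((\<integral>l. \<eta> l * F l x \<partial>torus)\<^sup>2) \<le> (\<integral>\<^sup>+l. ennreal (\<eta> l) * ennreal ((F l x)\<^sup>2) \<partial>torus)"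
      using nonneg_\<eta> by (simp add: ennreal_mult)
  qed
  also have "\<dots> = (\<integral>\<^sup>+l. (\<integral>\<^sup>+x. ennreal (\<eta> l) * ennreal ((F l x)\<^sup>2) \<partial>torus) \<partial>torus)"
    by (rule Fubini') measurable
  also have "\<dots> = (\<integral>\<^sup>+l. ennreal (\<eta> l) * (\<integral>\<^sup>+x. ennreal ((F l x)\<^sup>2) \<partial>torus) \<partial>torus)"
    by (simp add: nn_integral_cmult)
  also have "\<dots> \<le> (\<integral>\<^sup>+l. ennreal (\<eta> l) * K \<partial>torus)"
  proof (rule nn_integral_mono_AE, use Q in eventually_elim)
    case (elim l)
    then show ?case using K[of l] by (cases "\<eta> l = 0") (auto intro!: mult_left_mono)
  qed
  also have "\<dots> = K"
    using nonneg_\<eta> by (simp add: nn_integral_multc nn_integral_eq_integral bper_integrable bper_\<eta> integral_\<eta>)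
  finally show ?thesis .
qed

lemma corr_L2_bound:
  assumes [measurable]: "f \<in> borel_measurable borel" and per: "periodic f"
    and sq: "integrable torus (\<lambda>x. (f x)\<^sup>2)" and f: "integrable torus f"
  shows "(\<integral>x. (corr \<eta> f x)\<^sup>2 \<partial>torus) \<le> (\<integral>x. (f x)\<^sup>2 \<partial>torus)"
proof -
  have t: "integrable torus (\<lambda>l. f (l + x))" "integrable torus (\<lambda>l. (f (l + x))\<^sup>2)" for x
    using integrable_torus_translate[of f x] integrable_torus_translate[of "\<lambda>x. (f x)\<^sup>2" x] per sq f
    by (auto simp: periodic_def)
  have "(\<integral>\<^sup>+x. ennreal ((\<integral>l. \<eta> l * f (l + x) \<partial>torus)\<^sup>2) \<partial>torus) \<le> (\<integral>\<^sup>+x. ennreal ((f x)\<^sup>2) \<partial>torus)"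
  proof (rule mollify_L2)
    show "(\<integral>\<^sup>+x. ennreal ((f (l + x))\<^sup>2) \<partial>torus) \<le> (\<integral>\<^sup>+x. ennreal ((f x)\<^sup>2) \<partial>torus)" for l
      using nn_integral_torus_translate[of "\<lambda>x. ennreal ((f x)\<^sup>2)" l] per
      by (simp add: periodic_def add.commute)
  qed (use t in \<open>auto intro!: measurable_compose[OF _ \<open>f \<in> borel_measurable borel\<close>]\<close>)
  then have "ennreal (\<integral>x. (corr \<eta> f x)\<^sup>2 \<partial>torus) \<le> ennreal (\<integral>x. (f x)\<^sup>2 \<partial>torus)"
    using corr_translate[OF bper_\<eta> f per] sq bper_mult[OF bper_corr[OF bper_\<eta> f] bper_corr[OF bper_\<eta> f]]
    by (subst (1 2) nn_integral_eq_integral[symmetric])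
      (auto simp: add.commute power2_eq_square intro: bper_integrable)
  then show ?thesis by (simp add: ennreal_le_iff)
qed

lemma corr_L2_diff:
  assumes [measurable]: "f \<in> borel_measurable borel" and per: "periodic f"
    and sq: "integrable torus (\<lambda>x. (f x)\<^sup>2)" and f: "integrable torus f"
    and e: "\<And>l. l \<in> unit_cube \<Longrightarrow> \<eta> l \<noteq> 0 \<Longrightarrow> (\<integral>\<^sup>+x. ennreal ((f (x + l) - f x)\<^sup>2) \<partial>torus) \<le> ennreal e"
  shows "(\<integral>\<^sup>+x. ennreal ((corr \<eta> f x - f x)\<^sup>2) \<partial>torus) \<le> ennreal e"
proof -
  have t: "integrable torus (\<lambda>l. f (x + l))" "integrable torus (\<lambda>l. (f (x + l))\<^sup>2)" for x
    using integrable_torus_translate[of f x] integrable_torus_translate[of "\<lambda>x. (f x)\<^sup>2" x] per sq f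
    by (auto simp: periodic_def add.commute)
  have t2: "integrable torus (\<lambda>l. (f (x + l) - f x)\<^sup>2)" for x
    unfolding power2_diff
    by (intro Bochner_Integration.integrable_add Bochner_Integration.integrable_diff t torus.integrable_const
        integrable_mult_left integrable_mult_right)
  have "(\<integral>\<^sup>+x. ennreal ((\<integral>l. \<eta> l * (f (x + l) - f x) \<partial>torus)\<^sup>2) \<partial>torus) \<le> ennreal e"
    by (rule mollify_L2) (use t t2 e in \<open>auto simp: split_beta'\<close>)
  moreover have "(\<integral>l. \<eta> l * (f (x + l) - f x) \<partial>torus) = corr \<eta> f x - f x" for x
    unfolding right_diff_distrib corr_translate[OF bper_\<eta> f per]
    by (simp add: bper_integrable_mult[OF bper_\<eta>] t bper_integrable bper_\<eta> integral_\<eta>)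
  ultimately show ?thesis by simp
qed

end

text \<open>On the shrinking supports the translates of \<open>f\<close> are L2-close to
  \<open>f\<close>, so the mollifications converge in L2. The passage to squared norms uses a
  pointwise inequality with a free parameter \<open>s\<close> in place of the triangle inequality
  for norms.\<close>

lemma energy_mollified_tendsto:
  fixes f :: "real^3 \<Rightarrow> real"
  assumes [measurable]: "f \<in> borel_measurable borel" and per: "periodic f"
    and sq: "integrable torus (\<lambda>x. (f x)\<^sup>2)" and f: "integrable torus f"
    and ker: "\<And>n. kernel (\<eta> n)"
    and supp: "\<And>n l. l \<in> unit_cube \<Longrightarrow> \<eta> n l \<noteq> 0 \<Longrightarrow> norm l \<le> r n" and r: "r \<longlonglongrightarrow> 0"
  shows "(\<lambda>n. \<integral>x. (corr (\<eta> n) f x)\<^sup>2 \<partial>torus) \<longlonglongrightarrow> (\<integral>x. (f x)\<^sup>2 \<partial>torus)"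
proof -
  let ?u = "\<lambda>n. corr (\<eta> n) f"
  have bu: "bper (?u n)" for n by (intro bper_corr kernel.bper_\<eta> ker f)
  have iu: "integrable torus (\<lambda>x. (?u n x)\<^sup>2)" "integrable torus (\<lambda>x. ?u n x * f x)" for n
    using bper_integrable[OF bper_mult[OF bu bu]] by (auto simp: power2_eq_square intro: bper_integrable_mult bu f)
  have iuf: "integrable torus (\<lambda>x. (?u n x - f x)\<^sup>2)" for n
    unfolding power2_diff mult.assoc
    by (intro Bochner_Integration.integrable_add Bochner_Integration.integrable_diff iu sq integrable_mult_right)
  define M where "M = (\<integral>x. (f x)\<^sup>2 \<partial>torus)"
  have "M \<ge> 0" by (simp add: M_def)
  have d: "(\<lambda>n. \<integral>x. (?u n x - f x)\<^sup>2 \<partial>torus) \<longlonglongrightarrow> 0"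
  proof (rule LIMSEQ_I)
    fix e :: real assume "e > 0"
    then have "e / 2 > 0" by simp
    from translation_L2[OF assms(1) per sq this] obtain d where d: "d > 0"
      "\<And>l. norm l < d \<Longrightarrow> (\<integral>\<^sup>+x. ennreal ((f (x + l) - f x)\<^sup>2) \<partial>torus) \<le> ennreal (e / 2)" by blast
    obtain N where N: "\<And>n. n \<ge> N \<Longrightarrow> r n < d"
      using order_tendstoD(2)[OF r d(1)] by (auto simp: eventually_sequentially)
    have "norm ((\<integral>x. (?u n x - f x)\<^sup>2 \<partial>torus) - 0) < e" if "n \<ge> N" for n
    proof -
      have "(\<integral>\<^sup>+x. ennreal ((?u n x - f x)\<^sup>2) \<partial>torus) \<le> ennreal (e / 2)"
        by (rule kernel.corr_L2_diff[OF ker assms(1) per sq f])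
          (use N[OF that] supp[of _ n] in \<open>auto intro!: d(2) dest: le_less_trans\<close>)
      then have "(\<integral>x. (?u n x - f x)\<^sup>2 \<partial>torus) \<le> e / 2"
        using \<open>e > 0\<close> by (subst (asm) nn_integral_eq_integral[OF iuf]) (auto simp: ennreal_le_iff)
      then show ?thesis using \<open>e > 0\<close> by simp
    qed
    then show "\<exists>N. \<forall>n\<ge>N. norm ((\<integral>x. (?u n x - f x)\<^sup>2 \<partial>torus) - 0) < e" by blast
  qed
  have bound: "\<bar>(\<integral>x. (?u n x)\<^sup>2 \<partial>torus) - M\<bar> \<le> (1 + 1 / s) * (\<integral>x. (?u n x - f x)\<^sup>2 \<partial>torus) + s * M" if "s > 0" for n s
  proof -
    have ptw: "\<bar>(?u n x)\<^sup>2 - (f x)\<^sup>2\<bar> \<le> (1 + 1 / s) * (?u n x - f x)\<^sup>2 + s * (f x)\<^sup>2" for x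
    proof -
      define p q where "p = ?u n x - f x" and "q = f x"
      \<comment> \<open>The arithmetic-geometric mean inequality with weight: 2|pq| \<le> s q^2 +
        p^2 / s.\<close>
      have "0 \<le> (sqrt s * \<bar>q\<bar> - \<bar>p\<bar> / sqrt s)\<^sup>2" by simp
      also have "\<dots> = s * q\<^sup>2 + p\<^sup>2 / s - 2 * (\<bar>q\<bar> * \<bar>p\<bar>)"
        using that by (simp add: power2_diff power_mult_distrib power_divide)
      finally have "2 * \<bar>p * q\<bar> \<le> s * q\<^sup>2 + p\<^sup>2 / s" by (simp add: abs_mult mult.commute)
      moreover have "(?u n x)\<^sup>2 - (f x)\<^sup>2 = p\<^sup>2 + 2 * (p * q)"
        by (simp add: p_def q_def power2_eq_square algebra_simps)
      moreover have "\<bar>p\<^sup>2 + 2 * (p * q)\<bar> \<le> p\<^sup>2 + 2 * \<bar>p * q\<bar>"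
        using abs_triangle_ineq[of "p\<^sup>2" "2 * (p * q)"] by simp
      ultimately have "\<bar>(?u n x)\<^sup>2 - (f x)\<^sup>2\<bar> \<le> (1 + 1 / s) * p\<^sup>2 + s * q\<^sup>2"
        by (simp add: distrib_right)
      then show ?thesis by (simp add: p_def q_def)
    qed
    have "\<bar>(\<integral>x. (?u n x)\<^sup>2 \<partial>torus) - M\<bar> = \<bar>\<integral>x. (?u n x)\<^sup>2 - (f x)\<^sup>2 \<partial>torus\<bar>"
      by (simp add: M_def iu sq)
    also have "\<dots> \<le> (\<integral>x. \<bar>(?u n x)\<^sup>2 - (f x)\<^sup>2\<bar> \<partial>torus)" by (rule integral_abs_bound)
    also have "\<dots> \<le> (\<integral>x. (1 + 1 / s) * (?u n x - f x)\<^sup>2 + s * (f x)\<^sup>2 \<partial>torus)"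
      by (intro integral_mono integrable_abs Bochner_Integration.integrable_diff Bochner_Integration.integrable_add
          integrable_mult_right iu iuf sq ptw)
    also have "\<dots> = (1 + 1 / s) * (\<integral>x. (?u n x - f x)\<^sup>2 \<partial>torus) + s * M"
      by (simp add: iuf sq M_def)
    finally show ?thesis .
  qed
  show ?thesis
    unfolding M_def[symmetric]
  proof (rule LIMSEQ_I)
    fix e :: real assume "e > 0"
    \<comment> \<open>The parameter is fixed before \<open>n\<close>; the + 1 covers M = 0.\<close>
    define s where "s = e / (2 * (M + 1))"
    have s: "s > 0" "s * M \<le> e / 2"
      using \<open>e > 0\<close> \<open>M \<ge> 0\<close> by (auto simp: s_def field_simps)
    have "(\<lambda>n. (1 + 1 / s) * (\<integral>x. (?u n x - f x)\<^sup>2 \<partial>torus)) \<longlonglongrightarrow> (1 + 1 / s) * 0"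
      by (intro tendsto_intros d)
    then have "\<forall>\<^sub>F n in sequentially. (1 + 1 / s) * (\<integral>x. (?u n x - f x)\<^sup>2 \<partial>torus) < e / 2"
      using \<open>e > 0\<close> by (intro order_tendstoD(2)) auto
    then obtain N where N: "\<And>n. n \<ge> N \<Longrightarrow> (1 + 1 / s) * (\<integral>x. (?u n x - f x)\<^sup>2 \<partial>torus) < e / 2"
      by (auto simp: eventually_sequentially)
    have "norm ((\<integral>x. (?u n x)\<^sup>2 \<partial>torus) - M) < e" if "n \<ge> N" for n
      using bound[OF s(1), of n] s(2) N[OF that] unfolding real_norm_def by linarith
    then show "\<exists>N. \<forall>n\<ge>N. norm ((\<integral>x. (?u n x)\<^sup>2 \<partial>torus) - M) < e" by blast
  qed
qed

section \<open>Functions of time\<close>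

definition time_measure :: "real \<Rightarrow> real measure" where
  "time_measure T = density lborel (indicator {0<..<T})"

lemma space_time [simp]: "space (time_measure T) = UNIV"
  and sets_time [measurable_cong, simp]: "sets (time_measure T) = sets borel"
  by (simp_all add: time_measure_def)

lemma finite_measure_time: "finite_measure (time_measure T)"
  by standard (cases "0 \<le> T"; simp add: time_measure_def emeasure_density)

interpretation time: finite_measure "time_measure T"
  by (rule finite_measure_time)

lemma AE_time: "(AE t in time_measure T. Q t) \<longleftrightarrow> (AE t in lborel. t \<in> {0<..<T} \<longrightarrow> Q t)"
  unfolding time_measure_def by (subst AE_density) (auto simp: indicator_def)

lemma integral_time:
  fixes f :: "real \<Rightarrow> real"
  assumes [measurable]: "f \<in> borel_measurable borel"
  shows "(\<integral>t. f t \<partial>time_measure T) = (\<integral>t. indicator {0<..<T} t * f t \<partial>lborel)"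
proof -
  have "time_measure T = density lborel (\<lambda>t. ennreal (indicator {0<..<T} t))"
    by (simp add: time_measure_def ennreal_indicator)
  then show ?thesis by (simp add: integral_density)
qed

lemma bounded_borel_time: assumes "bounded_borel f" shows "integrable (time_measure T) f"
proof -
  obtain C where "\<And>x. \<bar>f x\<bar> \<le> C" using assms by (meson bounded_borelE)
  then show ?thesis
    using bounded_borel_measurable[OF assms] by (intro time.integrable_const_bound[where B = C]) auto
qed

lemma bounded_borel_indicator: "A \<in> sets borel \<Longrightarrow> bounded_borel (indicator A)"
  by (auto simp: bounded_borel_def indicator_def intro!: exI[of _ 1])

section \<open>Test functions and primitives in time\<close>

definition time_test :: "real \<Rightarrow> (real \<Rightarrow> real) \<Rightarrow> bool" where
  "time_test T \<theta> \<longleftrightarrow> smooth \<theta> \<and> (\<exists>t1 t2. 0 < t1 \<and> t2 < T \<and> (\<forall>t. t \<notin> {t1..t2} \<longrightarrow> \<theta> t = 0))"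

lemma bounded_borel_compact_support:
  fixes f :: "real \<Rightarrow> real"
  assumes "continuous_on UNIV f" "\<And>x. x \<notin> {a..b} \<Longrightarrow> f x = 0"
  shows "bounded_borel f"
proof -
  have "compact (f ` {a..b})"
    by (intro compact_continuous_image continuous_on_subset[OF assms(1)]) auto
  then obtain M where "\<And>x. x \<in> {a..b} \<Longrightarrow> \<bar>f x\<bar> \<le> M"
    by (metis compact_imp_bounded bounded_iff image_eqI real_norm_def)
  then have "\<bar>f x\<bar> \<le> max M 0" for x using assms(2)[of x] by (cases "x \<in> {a..b}") (auto simp: le_max_iff_disj)
  then show ?thesis
    using borel_measurable_continuous_onI[OF assms(1)] by (auto simp: bounded_borel_def)
qed

lemma time_test_bounded:
  assumes "time_test T \<theta>"
  shows "bounded_borel \<theta>" "bounded_borel (deriv \<theta>)"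
proof -
  obtain t1 t2 where s: "smooth \<theta>" and z: "\<And>t. t \<notin> {t1..t2} \<Longrightarrow> \<theta> t = 0"
    using assms by (auto simp: time_test_def)
  show "bounded_borel \<theta>" "bounded_borel (deriv \<theta>)"
    using smooth_continuous[OF s] smooth_continuous[OF smooth_deriv_real(2)[OF s]] z deriv_eq_0_outside[of t1 t2 \<theta>, OF z]
    by (auto intro!: bounded_borel_compact_support[of _ t1 t2])
qed

text \<open>Supplies the inner integral after an exchange of integrals: \<theta> vanishes at T, so
  only its value at the lower limit survives.\<close>

lemma time_test_FTC:
  assumes "time_test T \<theta>" "T > 0"
  shows "s \<in> {0<..<T} \<Longrightarrow> (\<integral>t. deriv \<theta> t * indicator {s<..} t \<partial>time_measure T) = - \<theta> s"
    and "(\<integral>t. deriv \<theta> t \<partial>time_measure T) = 0"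
proof -
  obtain t1 t2 where s: "smooth \<theta>" and z: "\<And>t. t \<notin> {t1..t2} \<Longrightarrow> \<theta> t = 0" and t: "0 < t1" "t2 < T"
    using assms by (auto simp: time_test_def)
  have [measurable]: "deriv \<theta> \<in> borel_measurable borel"
    by (rule bounded_borel_measurable[OF time_test_bounded(2)[OF assms(1)]])
  have ftc: "(\<integral>t. indicator {s..T} t * deriv \<theta> t \<partial>lborel) = - \<theta> s" if "s \<le> T" for s
  proof -
    have "(\<integral>t. indicator {s..T} t *\<^sub>R deriv \<theta> t \<partial>lborel) = \<theta> T - \<theta> s"
      using that smooth_deriv_real(1)[OF s] smooth_continuous[OF smooth_deriv_real(2)[OF s]]
      by (intro integral_FTC_atLeastAtMost)
        (auto intro: has_field_derivative_at_within continuous_on_subset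
          simp flip: has_real_derivative_iff_has_vector_derivative)
    then show ?thesis using z[of T] t by simp
  qed
  have *: "AE t in lborel. t \<noteq> c" for c :: real by (rule AE_lborel_singleton)
  show "(\<integral>t. deriv \<theta> t * indicator {s<..} t \<partial>time_measure T) = - \<theta> s" if "s \<in> {0<..<T}"
  proof -
    have "(\<integral>t. deriv \<theta> t * indicator {s<..} t \<partial>time_measure T)
        = (\<integral>t. indicator {s..T} t * deriv \<theta> t \<partial>lborel)"
      using *[of s] *[of T] that
      by (subst integral_time, measurable, intro integral_cong_AE) (auto simp: indicator_def)
    then show ?thesis using ftc that by simp
  qed
  have "(\<integral>t. deriv \<theta> t \<partial>time_measure T) = (\<integral>t. indicator {0..T} t * deriv \<theta> t \<partial>lborel)"
    using *[of 0] *[of T]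
    by (subst integral_time, measurable, intro integral_cong_AE) (auto simp: indicator_def)
  then show "(\<integral>t. deriv \<theta> t \<partial>time_measure T) = 0"
    using ftc[of 0] z[of 0] t assms(2) by simp
qed

text \<open>The primitive from time 0, written with an indicator so that Fubini over the square
  applies without a change of limits.\<close>

definition prim :: "real \<Rightarrow> (real \<Rightarrow> real) \<Rightarrow> real \<Rightarrow> real" where
  "prim T f t = (\<integral>s. indicator {..<t} s * f s \<partial>time_measure T)"

lemma pair_sigma_finite_time: "pair_sigma_finite (time_measure T) (time_measure T)"
  by (intro pair_sigma_finite.intro time.sigma_finite_measure_axioms)

lemma integral_time_swap:
  fixes f :: "real \<Rightarrow> real \<Rightarrow> real"
  assumes [measurable]: "(\<lambda>(s, t). f s t) \<in> borel_measurable (borel \<Otimes>\<^sub>M borel)" and C: "\<And>s t. \<bar>f s t\<bar> \<le> C"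
  shows "(\<integral>s. (\<integral>t. f s t \<partial>time_measure T) \<partial>time_measure T) = (\<integral>t. (\<integral>s. f s t \<partial>time_measure T) \<partial>time_measure T)"
proof -
  interpret P: pair_sigma_finite "time_measure T" "time_measure T" by (rule pair_sigma_finite_time)
  interpret F: finite_measure "time_measure T \<Otimes>\<^sub>M time_measure T"
    by (intro finite_measure_pair_measure finite_measure_time)
  have "integrable (time_measure T \<Otimes>\<^sub>M time_measure T) (\<lambda>(s, t). f s t)"
    by (rule F.integrable_const_bound[where B = C]) (use C in auto)
  from P.Fubini_integral[OF this] show ?thesis by simp
qed

lemma bounded_borel_prim:
  assumes "bounded_borel f" shows "bounded_borel (prim T f)"
proof -
  obtain C where C: "\<And>x. \<bar>f x\<bar> \<le> C" "C > 0" using assms by (meson bounded_borelE)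
  have [measurable]: "f \<in> borel_measurable borel" by (rule bounded_borel_measurable[OF assms])
  have "\<bar>prim T f t\<bar> \<le> (\<integral>s. C \<partial>time_measure T)" for t
  proof -
    have "\<bar>prim T f t\<bar> \<le> (\<integral>s. \<bar>indicator {..<t} s * f s\<bar> \<partial>time_measure T)"
      unfolding prim_def by (rule integral_abs_bound)
    also have "\<dots> \<le> (\<integral>s. C \<partial>time_measure T)"
    proof (rule integral_mono)
      show "integrable (time_measure T) (\<lambda>s. \<bar>indicator {..<t} s * f s\<bar>)"
        by (intro integrable_abs bounded_borel_time bounded_borel_mult bounded_borel_indicator assms) auto
      show "\<bar>indicator {..<t} s * f s\<bar> \<le> C" for s using C by (auto simp: indicator_def)
    qed auto
    finally show ?thesis .
  qed
  moreover have "prim T f \<in> borel_measurable borel"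
    unfolding prim_def[abs_def]
  proof (rule time.borel_measurable_lebesgue_integral)
    have "(\<lambda>p. (if snd p < fst p then f (snd p) else 0)) \<in> borel_measurable (borel \<Otimes>\<^sub>M time_measure T)"
      by measurable
    then show "(\<lambda>(t, s). indicator {..<t} s * f s) \<in> borel_measurable (borel \<Otimes>\<^sub>M time_measure T)"
      by (rule measurable_cong[THEN iffD1, rotated]) (auto simp: indicator_def)
  qed
  ultimately show ?thesis by (auto simp: bounded_borel_def)
qed

lemma indicator_less_measurable:
  "(\<lambda>(s, t). indicator {..<t} (s::real) :: real) \<in> borel_measurable (borel \<Otimes>\<^sub>M borel)"
proof -
  have "(\<lambda>p::real \<times> real. if fst p < snd p then 1 else 0 :: real) \<in> borel_measurable (borel \<Otimes>\<^sub>M borel)"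
    by measurable
  then show ?thesis by (rule measurable_cong[THEN iffD1, rotated]) (auto simp: indicator_def)
qed

text \<open>Fubini on the triangle s < t, then the fundamental theorem of calculus for \<theta> on
  (s, T), which gives -\<theta>(s). All differentiation falls on the smooth function, none on
  \<open>prim T f\<close>.\<close>

lemma prim_by_parts:
  assumes \<theta>: "time_test T \<theta>" and f: "bounded_borel f" and "T > 0"
  shows "(\<integral>t. deriv \<theta> t * prim T f t \<partial>time_measure T) = - (\<integral>t. \<theta> t * f t \<partial>time_measure T)"
proof -
  note bt = time_test_bounded[OF \<theta>]
  obtain C D where C: "\<And>x. \<bar>f x\<bar> \<le> C" "C > 0" and D: "\<And>x. \<bar>deriv \<theta> x\<bar> \<le> D" "D > 0"
    using f bt(2) by (meson bounded_borelE)
  have [measurable]: "f \<in> borel_measurable borel" "deriv \<theta> \<in> borel_measurable borel" "\<theta> \<in> borel_measurable borel"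
    using f bt by (simp_all add: bounded_borel_measurable)
  note [measurable] = indicator_less_measurable
  have "(\<integral>t. deriv \<theta> t * prim T f t \<partial>time_measure T)
      = (\<integral>t. (\<integral>s. deriv \<theta> t * (indicator {..<t} s * f s) \<partial>time_measure T) \<partial>time_measure T)"
    by (simp add: prim_def)
  also have "\<dots> = (\<integral>s. (\<integral>t. deriv \<theta> t * (indicator {..<t} s * f s) \<partial>time_measure T) \<partial>time_measure T)"
  proof (rule integral_time_swap[where C = "D * C"])
    have "(\<lambda>p. deriv \<theta> (snd p) * ((\<lambda>(s, t). indicator {..<t} s) p * f (fst p))) \<in> borel_measurable (borel \<Otimes>\<^sub>M borel)"
      by measurable
    from measurable_compose[OF measurable_pair_swap' this]
    show "(\<lambda>(t, s). deriv \<theta> t * (indicator {..<t} s * f s)) \<in> borel_measurable (borel \<Otimes>\<^sub>M borel)"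
      by (simp add: case_prod_unfold)
    show "\<bar>deriv \<theta> t * (indicator {..<t} s * f s)\<bar> \<le> D * C" for t s
      using C D by (auto simp: abs_mult indicator_def intro!: mult_mono)
  qed
  also have "\<dots> = (\<integral>s. f s * (\<integral>t. deriv \<theta> t * indicator {s<..} t \<partial>time_measure T) \<partial>time_measure T)"
  proof -
    have "deriv \<theta> t * (indicator {..<t} s * f s) = f s * (deriv \<theta> t * indicator {s<..} t)" for s t
      by (simp add: indicator_def)
    then show ?thesis by (simp only: integral_mult_right_zero)
  qed
  also have "\<dots> = (\<integral>s. - (\<theta> s * f s) \<partial>time_measure T)"
  proof (rule integral_cong_AE)
    show "AE s in time_measure T. f s * (\<integral>t. deriv \<theta> t * indicator {s<..} t \<partial>time_measure T) = - (\<theta> s * f s)"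
      unfolding AE_time using time_test_FTC(1)[OF \<theta> \<open>T > 0\<close>] by (intro AE_I2) auto
    have "(\<lambda>p. deriv \<theta> (snd p) * (\<lambda>(s, t). indicator {..<t} s) p) \<in> borel_measurable (borel \<Otimes>\<^sub>M borel)"
      by measurable
    then have "(\<lambda>(s, t). deriv \<theta> t * indicator {s<..} t) \<in> borel_measurable (borel \<Otimes>\<^sub>M time_measure T)"
      by (rule measurable_cong_sets[THEN equalityD1, THEN subsetD, rotated 2, OF measurable_cong[THEN iffD1, rotated]])
        (auto simp: indicator_def intro!: sets_pair_measure_cong)
    from time.borel_measurable_lebesgue_integral[OF this]
    show "(\<lambda>s. f s * (\<integral>t. deriv \<theta> t * indicator {s<..} t \<partial>time_measure T)) \<in> borel_measurable (time_measure T)"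
      by simp
  qed measurable
  finally show ?thesis by simp
qed

text \<open>The square of an integral is a double integral over a square, and the diagonal cuts it
  into two triangles of equal contribution; the diagonal itself is a null set.\<close>

lemma prim_square:
  assumes f: "bounded_borel f"
  shows "(prim T f t)\<^sup>2 = 2 * prim T (\<lambda>s. prim T f s * f s) t"
proof -
  obtain C where C: "\<And>x. \<bar>f x\<bar> \<le> C" "C > 0" using f by (meson bounded_borelE)
  note [measurable] = bounded_borel_measurable[OF f] indicator_less_measurable
  define h where "h s = indicator {..<t} s * f s" for s
  have bh: "bounded_borel h" unfolding h_def[abs_def] by (intro bounded_borel_mult bounded_borel_indicator f) auto
  have hC: "\<bar>h s\<bar> \<le> C" for s using C by (auto simp: h_def indicator_def)
  note [measurable] = bounded_borel_measurable[OF bh]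
  \<comment> \<open>The cut-off at \<open>t\<close> is absorbed into \<open>h\<close>, and
    \<open>K\<close> is the part of h(s) h(r) with r < s.\<close>
  define K where "K s r = indicator {..<s} r * (h s * h r)" for s r :: real
  have Km: "(\<lambda>(s, r). K s r) \<in> borel_measurable (borel \<Otimes>\<^sub>M borel)"
  proof -
    have "(\<lambda>p. (\<lambda>(s, t). indicator {..<t} s) p * (h (snd p) * h (fst p))) \<in> borel_measurable (borel \<Otimes>\<^sub>M borel)"
      by measurable
    from measurable_compose[OF measurable_pair_swap' this] show ?thesis
      by (simp add: case_prod_unfold K_def)
  qed
  have KC: "\<bar>K s r\<bar> \<le> C * C" for s r
    using hC[of s] hC[of r] C(2) by (auto simp: K_def abs_mult indicator_def intro!: mult_mono)
  have bK: "bounded_borel (K s)" "bounded_borel (\<lambda>r. K r s)" for s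
    using KC measurable_Pair2[OF Km, of s] measurable_Pair1[OF Km, of s] by (auto simp: bounded_borel_def)
  have bKI: "bounded_borel (\<lambda>s. \<integral>r. K s r \<partial>time_measure T)" "bounded_borel (\<lambda>s. \<integral>r. K r s \<partial>time_measure T)"
  proof -
    have eq: "(\<integral>r. K s r \<partial>time_measure T) = h s * prim T h s" for s
      by (simp add: K_def prim_def mult.left_commute)
    show "bounded_borel (\<lambda>s. \<integral>r. K s r \<partial>time_measure T)"
      unfolding eq by (intro bounded_borel_mult bounded_borel_prim bh)
    \<comment> \<open>The half r > s is everything minus r < s minus the point r = s. This expresses
      the section integral through \<open>prim\<close>, whose boundedness and measurability are
      known.\<close>
    have eq': "(\<integral>r. K r s \<partial>time_measure T) = h s * ((\<integral>r. h r \<partial>time_measure T) - prim T h s - (\<integral>r. indicator {s} r * h r \<partial>time_measure T))" for s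
    proof -
      have "K r s = h s * (h r - indicator {..<s} r * h r - indicator {s} r * h r)" for r
        by (auto simp: K_def indicator_def)
      then show ?thesis
        by (simp add: prim_def bounded_borel_time bounded_borel_mult bounded_borel_indicator bh)
    qed
    have z: "(\<integral>r. indicator {s} r * h r \<partial>time_measure T) = 0" for s
    proof -
      have "(\<integral>r. indicator {s} r * h r \<partial>time_measure T) = (\<integral>r. 0 \<partial>time_measure T)"
        using AE_lborel_singleton[of s]
        by (intro integral_cong_AE) (auto simp: AE_time)
      then show ?thesis by simp
    qed
    show "bounded_borel (\<lambda>s. \<integral>r. K r s \<partial>time_measure T)"
      unfolding eq' z by (intro bounded_borel_mult bounded_borel_prim bounded_borel_diff bounded_borel_const bh)
  qed
  have "(prim T f t)\<^sup>2 = (\<integral>s. (\<integral>r. h s * h r \<partial>time_measure T) \<partial>time_measure T)"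
    by (simp add: prim_def h_def power2_eq_square)
  also have "\<dots> = (\<integral>s. (\<integral>r. K s r \<partial>time_measure T) + (\<integral>r. K r s \<partial>time_measure T) \<partial>time_measure T)"
  proof (rule Bochner_Integration.integral_cong[OF refl])
    fix s
    have "(\<integral>r. h s * h r \<partial>time_measure T) = (\<integral>r. K s r + K r s \<partial>time_measure T)"
      using bounded_borel_measurable[OF bK(1)[of s]] bounded_borel_measurable[OF bK(2)[of s]] AE_lborel_singleton[of s]
      by (intro integral_cong_AE) (auto simp: AE_time K_def indicator_def)
    then show "(\<integral>r. h s * h r \<partial>time_measure T) = (\<integral>r. K s r \<partial>time_measure T) + (\<integral>r. K r s \<partial>time_measure T)"
      by (simp add: bounded_borel_time bK)
  qed
  also have "\<dots> = (\<integral>s. (\<integral>r. K s r \<partial>time_measure T) \<partial>time_measure T) + (\<integral>s. (\<integral>r. K r s \<partial>time_measure T) \<partial>time_measure T)"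
    by (simp add: bounded_borel_time bKI)
  also have "(\<integral>s. (\<integral>r. K r s \<partial>time_measure T) \<partial>time_measure T) = (\<integral>s. (\<integral>r. K s r \<partial>time_measure T) \<partial>time_measure T)"
    by (rule integral_time_swap[OF Km KC, symmetric])
  also have "(\<integral>s. (\<integral>r. K s r \<partial>time_measure T) \<partial>time_measure T) = prim T (\<lambda>s. prim T f s * f s) t"
  proof -
    have "(\<integral>r. K s r \<partial>time_measure T) = indicator {..<t} s * (prim T f s * f s)" for s
    proof (cases "s < t")
      case True
      then have "K s r = f s * (indicator {..<s} r * f r)" for r by (auto simp: K_def h_def indicator_def)
      then show ?thesis using True by (simp add: prim_def)
    qed (simp add: K_def h_def)
    then show ?thesis by (simp add: prim_def[of T "\<lambda>s. prim T f s * f s"])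
  qed
  finally show ?thesis by simp
qed

section \<open>The du Bois-Reymond lemma\<close>

lemma antiderivative_exists:
  fixes h :: "real \<Rightarrow> real"
  assumes c: "continuous_on UNIV h" and z: "\<And>x. x \<le> 0 \<Longrightarrow> h x = 0"
  obtains H where "\<And>x. (H has_real_derivative h x) (at x)" "\<And>x. x \<le> 0 \<Longrightarrow> H x = 0"
proof -
  \<comment> \<open>The lower limit -1 lies strictly to the left of where \<open>h\<close> can be
    nonzero, so every x \<ge> 0 is interior to the interval on which the primitive is
    differentiated.\<close>
  define H where "H x = integral {-1..x} h" for x
  have H0: "H x = 0" if "x \<le> 0" for x
  proof -
    have "integral {-1..x} h = integral {-1..x} (\<lambda>_. 0)"
      using that z by (intro Henstock_Kurzweil_Integration.integral_cong) auto
    then show ?thesis by (simp add: H_def)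
  qed
  have "(H has_real_derivative h x) (at x)" for x
  proof (cases "x < 0")
    case True
    have "((\<lambda>_. 0) has_real_derivative h x) (at x)" using True z by simp
    then show ?thesis
      by (rule has_field_derivative_transform_within_open[where S = "{..<0}"]) (use True H0 in auto)
  next
    case False
    have "(H has_real_derivative h x) (at x within {-1..x + 1})"
      unfolding H_def[abs_def] using False
      by (intro integral_has_real_derivative continuous_on_subset[OF c]) auto
    moreover have "at x within {-1..x + 1} = at x"
      using False by (intro at_within_interior) (simp add: interior_atLeastAtMost_real)
    ultimately show ?thesis by simp
  qed
  then show ?thesis using H0 by (rule that)
qed

text \<open>\<open>H\<close> is a smooth step from 0 to \<open>Z\<close>, and \<open>HH\<close> a
  smooth ramp that is affine with slope \<open>Z\<close> from 1 on. Differences of rescaled ramps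
  give smooth functions whose derivatives approximate indicators of intervals.\<close>

lemma smooth_ramp_exists:
  obtains HH H :: "real \<Rightarrow> real" and Z \<kappa> :: real
  where "smooth HH" "\<And>x. (HH has_real_derivative H x) (at x)" "\<And>x. x \<le> 0 \<Longrightarrow> HH x = 0"
    "\<And>x. x \<ge> 1 \<Longrightarrow> HH x = Z * x + \<kappa>" "\<And>x. x \<le> 0 \<Longrightarrow> H x = 0" "\<And>x. x \<ge> 1 \<Longrightarrow> H x = Z" "Z > 0"
    "bounded_borel H"
proof -
  obtain \<rho> :: "real \<Rightarrow> real" where \<rho>: "smooth \<rho>" "\<And>x. \<rho> x \<ge> 0" "\<And>x. x \<notin> {0<..<1} \<Longrightarrow> \<rho> x = 0"
    "\<And>x. x \<in> {0<..<1} \<Longrightarrow> \<rho> x > 0"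
    using smooth_bump_exists[of 0 1] by auto
  obtain H where H: "\<And>x. (H has_real_derivative \<rho> x) (at x)" "\<And>x. x \<le> 0 \<Longrightarrow> H x = 0"
    using antiderivative_exists[OF smooth_continuous[OF \<rho>(1)]] \<rho>(3) by auto
  have sH: "smooth H" by (rule smooth_antideriv[OF H(1) \<rho>(1)])
  obtain HH where HH: "\<And>x. (HH has_real_derivative H x) (at x)" "\<And>x. x \<le> 0 \<Longrightarrow> HH x = 0"
    using antiderivative_exists[OF smooth_continuous[OF sH]] H(2) by auto
  have sHH: "smooth HH" by (rule smooth_antideriv[OF HH(1) sH])
  have cont: "continuous_on A H" "continuous_on A HH" for A
    using smooth_continuous[OF sH] smooth_continuous[OF sHH] by (auto intro: continuous_on_subset)
  define Z where "Z = H 1"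
  have Z: "H x = Z" if "x \<ge> 1" for x
  proof (cases "x = 1")
    case False
    then show ?thesis
      unfolding Z_def using that \<rho>(3)
      by (intro DERIV_isconst_end cont) (auto intro: DERIV_cong[OF H(1)])
  qed (simp add: Z_def)
  have mono: "H x \<le> H y" if "x \<le> y" for x y
    using that \<rho>(2) by (intro DERIV_nonneg_imp_nondecreasing[of x y H]) (auto intro: H(1))
  \<comment> \<open>The bump is positive inside (0, 1), which makes the height of the step strictly
    positive.\<close>
  have "H (1/4) < H (3/4)"
    using \<rho>(4) by (intro DERIV_pos_imp_increasing[of "1/4" "3/4" H]) (auto intro!: exI H(1))
  then have "Z > 0" using mono[of 0 "1/4"] mono[of "3/4" 1] H(2)[of 0] by (simp add: Z_def)
  have "HH x = Z * x + (HH 1 - Z)" if "x \<ge> 1" for x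
  proof (cases "x = 1")
    case False
    have "HH x - Z * x = HH 1 - Z * 1"
      using that False Z
      by (intro DERIV_isconst_end[where f = "\<lambda>x. HH x - Z * x"] continuous_intros cont)
        (auto intro!: derivative_eq_intros HH(1))
    then show ?thesis by simp
  qed simp
  moreover have "bounded_borel H"
  proof -
    have "\<bar>H x\<bar> \<le> Z" for x
      using mono[of x "max x 1"] mono[of "min x 0" x] Z[of "max x 1"] H(2)[of "min x 0"] by simp
    then show ?thesis
      using borel_measurable_continuous_onI[OF cont(1)] by (auto simp: bounded_borel_def)
  qed
  ultimately show ?thesis
    using that[of HH H Z "HH 1 - Z"] sHH HH H(2) Z \<open>Z > 0\<close> by blast
qed

text \<open>The finite measures whose densities are the positive and the negative part of
  \<open>v\<close> agree on half-lines, an intersection-stable generator. Hence they coincide, and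
  their densities agree almost everywhere.\<close>

lemma AE_zero_if_atMost_integrals_zero:
  fixes v :: "real \<Rightarrow> real"
  assumes int: "integrable lborel v" and z: "\<And>a. (\<integral>t. indicator {..a} t * v t \<partial>lborel) = 0"
  shows "AE t in lborel. v t = 0"
proof -
  have [measurable]: "v \<in> borel_measurable borel" using int by auto
  define p where "p t = max 0 (v t)" for t
  define m where "m t = max 0 (- v t)" for t
  have pm: "integrable lborel p" "integrable lborel m" "\<And>t. v t = p t - m t"
    using int by (auto simp: p_def[abs_def] m_def[abs_def])
  have [measurable]: "p \<in> borel_measurable borel" "m \<in> borel_measurable borel" using pm by auto
  have nn: "p t \<ge> 0" "m t \<ge> 0" for t by (auto simp: p_def m_def)
  have I: "integrable lborel (\<lambda>t. indicator {..a} t * p t)" "integrable lborel (\<lambda>t. indicator {..a} t * m t)" for a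
    using pm by (auto intro!: integrable_mult_indicator[where 'b = real, simplified])
  have fin: "(\<integral>\<^sup>+t. ennreal (p t) \<partial>lborel) \<noteq> \<infinity>"
    using pm(1) nn by (simp add: nn_integral_eq_integral)
  have em: "emeasure (density lborel (\<lambda>t. ennreal (f t))) {..a} = ennreal (\<integral>t. indicator {..a} t * f t \<partial>lborel)"
    if "integrable lborel (\<lambda>t. indicator {..a} t * f t)" "\<And>t. f t \<ge> 0" "f \<in> borel_measurable borel" for f :: "real \<Rightarrow> real" and a
    using that borel_closed[OF closed_atMost[of a]] by (subst emeasure_density)
      (auto simp: nn_integral_eq_integral[symmetric] ennreal_mult' ennreal_indicator mult.commute intro!: nn_integral_cong)
  have "density lborel (\<lambda>t. ennreal (p t)) = density lborel (\<lambda>t. ennreal (m t))"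
  proof (rule measure_eqI_generator_eq[where E = "range (\<lambda>a. {..a})" and \<Omega> = UNIV and A = "\<lambda>n::nat. {..real n}"])
    show "Int_stable (range (\<lambda>a::real. {..a}))" by (auto simp: Int_stable_def)
    show "sets (density lborel (\<lambda>t. ennreal (p t))) = sigma_sets UNIV (range (\<lambda>a::real. {..a}))"
      "sets (density lborel (\<lambda>t. ennreal (m t))) = sigma_sets UNIV (range (\<lambda>a::real. {..a}))"
      by (simp_all add: borel_eq_atMost)
    fix X assume "X \<in> range (\<lambda>a::real. {..a})"
    then obtain a where X: "X = {..a}" by auto
    have "(\<integral>t. indicator {..a} t * p t \<partial>lborel) = (\<integral>t. indicator {..a} t * m t \<partial>lborel)"
      using z[of a] I by (simp add: pm(3) right_diff_distrib)
    then show "emeasure (density lborel (\<lambda>t. ennreal (p t))) X = emeasure (density lborel (\<lambda>t. ennreal (m t))) X"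
      unfolding X using em I nn by simp
  next
    show "(\<Union>i. {..real i}) = UNIV" using real_arch_simple by auto
    show "emeasure (density lborel (\<lambda>t. ennreal (p t))) {..real i} \<noteq> \<infinity>" for i
      using em I nn by simp
  qed auto
  then have "AE t in lborel. ennreal (p t) = ennreal (m t)"
    using fin by (subst (asm) finite_density_unique) auto
  then show ?thesis
  proof eventually_elim
    case (elim t)
    then show ?case using nn by (simp add: pm(3))
  qed
qed

text \<open>Two normalised smooth ramps over different intervals reach the same final height, so
  their difference has compact support and is admissible. In the limit of sharp corners it shows
  that \<open>u\<close> has the same average over any two intervals in (0, T); subtracting this
  average leaves a function whose integral over every interval vanishes.\<close>

lemma du_Bois_Reymond:
  assumes u: "bounded_borel u" and "T > 0"
    and weak: "\<And>\<theta>. time_test T \<theta> \<Longrightarrow> (\<integral>t. deriv \<theta> t * u t \<partial>time_measure T) = 0"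
  shows "\<exists>c. AE t in time_measure T. u t = c"
proof -
  obtain HH H Z \<kappa> where HH: "smooth HH" "\<And>x. (HH has_real_derivative H x) (at x)" "\<And>x. x \<le> 0 \<Longrightarrow> HH x = 0"
    "\<And>x. x \<ge> 1 \<Longrightarrow> HH x = Z * x + \<kappa>" "\<And>x. x \<le> 0 \<Longrightarrow> H x = 0" "\<And>x. x \<ge> 1 \<Longrightarrow> H x = Z" "Z > 0"
    "bounded_borel H"
    using smooth_ramp_exists by blast
  note [measurable] = bounded_borel_measurable[OF u] bounded_borel_measurable[OF HH(8)]
  obtain M where M: "\<And>x. \<bar>H x\<bar> \<le> M" "M > 0" using HH(8) by (meson bounded_borelE)
  obtain C where C: "\<And>x. \<bar>u x\<bar> \<le> C" "C > 0" using u by (meson bounded_borelE)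
  define I where "I a b = (\<integral>t. indicator {a<..b} t * u t \<partial>time_measure T)" for a b
  have avg: "I a1 b1 / (b1 - a1) = I a2 b2 / (b2 - a2)"
    if ab: "0 < a1" "a1 < b1" "b1 < T" "0 < a2" "a2 < b2" "b2 < T" for a1 b1 a2 b2
  proof -
    \<comment> \<open>For positive n each of the two quotients vanishes up to the left end of its
      interval and equals \<open>Z\<close> from 1/n beyond the right end on.\<close>
    define \<theta> where "\<theta> n t = (HH (n * (t - a1)) - HH (n * (t - b1))) / (n * (b1 - a1))
        - (HH (n * (t - a2)) - HH (n * (t - b2))) / (n * (b2 - a2))" for n t
    define d where "d n t = (H (n * (t - a1)) - H (n * (t - b1))) / (b1 - a1)
        - (H (n * (t - a2)) - H (n * (t - b2))) / (b2 - a2)" for n t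
    have s1: "smooth (\<lambda>t. HH (n * (t - a)))" for n a
      using smooth_compose_affine[OF bounded_linear_mult_right HH(1), of n "- n * a"] by (simp add: algebra_simps)
    have smooth\<theta>: "smooth (\<theta> n)" for n
    proof -
      have "smooth (\<lambda>t. (1 / (n * (b1 - a1))) * (HH (n * (t - a1)) - HH (n * (t - b1)))
          - (1 / (n * (b2 - a2))) * (HH (n * (t - a2)) - HH (n * (t - b2))))"
        by (intro smooth_diff smooth_cmult s1)
      then show ?thesis by (simp add: \<theta>_def[abs_def])
    qed
    have \<theta>0: "\<theta> n t = 0" if n: "n > 0" "t \<notin> {min a1 a2..max b1 b2 + 1 / n}" for n t
    proof (cases "t < min a1 a2")
      case True
      then show ?thesis using n ab unfolding \<theta>_def by (subst (1 2 3 4) HH(3)) (auto simp: mult_le_0_iff)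
    next
      case False
      then have "t > max b1 b2 + 1 / n" using n by auto
      then have ge: "n * (t - c) \<ge> 1" if "c \<le> max b1 b2" for c
        using n that by (simp add: field_simps) (smt (verit) mult_left_mono mult.commute)
      have "\<theta> n t = (Z * (n * (b1 - a1))) / (n * (b1 - a1)) - (Z * (n * (b2 - a2))) / (n * (b2 - a2))"
      proof -
        have *: "HH (n * (t - c)) = Z * (n * (t - c)) + \<kappa>" if "c \<le> max b1 b2" for c
          by (rule HH(4)[OF ge[OF that]])
        have "HH (n * (t - a1)) - HH (n * (t - b1)) = Z * (n * (b1 - a1))"
          "HH (n * (t - a2)) - HH (n * (t - b2)) = Z * (n * (b2 - a2))"
          using ab by (subst (1 2) *; simp add: algebra_simps)+
        then show ?thesis by (simp add: \<theta>_def)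
      qed
      also have "\<dots> = 0" using n ab by simp
      finally show ?thesis .
    qed
    have d_eq: "deriv (\<theta> n) t = d n t" if "n > 0" for n t
    proof (rule DERIV_imp_deriv)
      have D: "((\<lambda>t. HH (n * (t - a))) has_real_derivative H (n * (t - a)) * n) (at t)" for a
        by (rule DERIV_chain2[OF HH(2)]) (auto intro!: derivative_eq_intros)
      have "(\<theta> n has_real_derivative (H (n * (t - a1)) * n - H (n * (t - b1)) * n) / (n * (b1 - a1))
          - (H (n * (t - a2)) * n - H (n * (t - b2)) * n) / (n * (b2 - a2))) (at t)"
        unfolding \<theta>_def[abs_def] by (intro DERIV_diff DERIV_cdivide D)
      moreover have "(x * n - y * n) / (n * r) = (x - y) / r" for x y r
        using that by (simp add: left_diff_distrib[symmetric])
      ultimately show "(\<theta> n has_real_derivative d n t) (at t)" by (simp add: d_def)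
    qed
    have ev: "(\<integral>t. d n t * u t \<partial>time_measure T) = 0" if "n > 0" "max b1 b2 + 1 / n < T" for n
    proof -
      have "0 < min a1 a2 \<and> max b1 b2 + 1 / n < T \<and> (\<forall>t. t \<notin> {min a1 a2..max b1 b2 + 1 / n} \<longrightarrow> \<theta> n t = 0)"
        using ab that \<theta>0[OF that(1)] by auto
      then have "time_test T (\<theta> n)"
        unfolding time_test_def using smooth\<theta>[of n] by blast
      from weak[OF this] show ?thesis using \<open>n > 0\<close> by (simp add: d_eq)
    qed
    have lim1: "(\<lambda>n. H (real n * (t - a))) \<longlonglongrightarrow> Z * indicator {a<..} t" for t a
    proof (cases "a < t")
      case True
      then obtain N :: nat where N: "1 / (t - a) \<le> N" using real_arch_simple by blast
      have "H (real n * (t - a)) = Z" if "n \<ge> N" for n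
      proof (rule HH(6))
        have "1 / (t - a) \<le> real n" using N that by linarith
        then show "1 \<le> real n * (t - a)" using True by (simp add: field_simps)
      qed
      then have "\<forall>\<^sub>F n in sequentially. H (real n * (t - a)) = Z * indicator {a<..} t"
        using True by (auto simp: eventually_sequentially)
      then show ?thesis by (rule tendsto_eventually)
    next
      case False
      then show ?thesis by (subst HH(5)) (auto simp: mult_le_0_iff)
    qed
    \<comment> \<open>The limit of the derivatives: \<open>Z\<close> times the difference of the
      normalised indicators of the two intervals.\<close>
    define l where "l t = Z * (indicator {a1<..b1} t / (b1 - a1) - indicator {a2<..b2} t / (b2 - a2))" for t :: real
    have lim2: "(\<lambda>n. d (real n) t * u t) \<longlonglongrightarrow> l t * u t" for t
    proof -
      have "(\<lambda>n. d (real n) t) \<longlonglongrightarrow> (Z * indicator {a1<..} t - Z * indicator {b1<..} t) / (b1 - a1)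
        - (Z * indicator {a2<..} t - Z * indicator {b2<..} t) / (b2 - a2)"
        unfolding d_def by (intro tendsto_intros lim1) (use ab in auto)
      moreover have "(Z * indicator {a1<..} t - Z * indicator {b1<..} t) / (b1 - a1)
        - (Z * indicator {a2<..} t - Z * indicator {b2<..} t) / (b2 - a2) = l t"
        using ab by (auto simp: l_def indicator_def right_diff_distrib)
      ultimately show ?thesis by (auto intro: tendsto_mult_right)
    qed
    have db: "\<bar>d n t\<bar> \<le> 2 * M / (b1 - a1) + 2 * M / (b2 - a2)" for n t
    proof -
      have *: "\<bar>(H x - H y) / r\<bar> \<le> 2 * M / r" if "r > 0" for x y r
        using that M(1)[of x] M(1)[of y] by (auto simp: abs_divide intro!: divide_right_mono)
      show ?thesis unfolding d_def
        by (rule order_trans[OF abs_triangle_ineq4]) (intro add_mono *; use ab in simp)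
    qed
    have dm: "d n \<in> borel_measurable borel" for n unfolding d_def[abs_def] by measurable
    have lim3: "(\<lambda>n. \<integral>t. d (real n) t * u t \<partial>time_measure T) \<longlonglongrightarrow> (\<integral>t. l t * u t \<partial>time_measure T)"
    proof (rule integral_dominated_convergence[where w = "\<lambda>_. (2 * M / (b1 - a1) + 2 * M / (b2 - a2)) * C"])
      show "AE t in time_measure T. norm (d (real n) t * u t) \<le> (2 * M / (b1 - a1) + 2 * M / (b2 - a2)) * C" for n
        using db C ab M by (intro AE_I2) (auto simp: abs_mult intro!: mult_mono add_nonneg_nonneg divide_nonneg_pos)
      show "(\<lambda>t. l t * u t) \<in> borel_measurable (time_measure T)" unfolding l_def by measurable
      show "(\<lambda>t. d (real n) t * u t) \<in> borel_measurable (time_measure T)" for n using dm by simp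
    qed (use lim2 in auto)
    have ev0: "\<forall>\<^sub>F n in sequentially. (\<integral>t. d (real n) t * u t \<partial>time_measure T) = 0"
    proof -
      have "(\<lambda>n. max b1 b2 + 1 / real n) \<longlonglongrightarrow> max b1 b2 + 0"
        by (intro tendsto_intros lim_1_over_n)
      then have "\<forall>\<^sub>F n in sequentially. max b1 b2 + 1 / real n < T"
        by (rule order_tendstoD(2)) (use ab in simp)
      then show ?thesis using eventually_gt_at_top[of 0]
        by eventually_elim (auto intro: ev)
    qed
    have "(\<integral>t. l t * u t \<partial>time_measure T) = 0"
      by (rule LIMSEQ_unique[OF lim3 tendsto_eventually[OF ev0]])
    moreover have "(\<integral>t. l t * u t \<partial>time_measure T) = Z * (I a1 b1 / (b1 - a1) - I a2 b2 / (b2 - a2))"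
    proof -
      have "l t * u t = Z * (indicator {a1<..b1} t * u t / (b1 - a1) - indicator {a2<..b2} t * u t / (b2 - a2))" for t
        by (simp add: l_def algebra_simps)
      then show ?thesis
        by (simp add: I_def bounded_borel_time bounded_borel_mult bounded_borel_indicator u)
    qed
    ultimately show ?thesis using HH(7) by simp
  qed
  \<comment> \<open>The common average, read off from the middle third of (0, T).\<close>
  define c where "c = I (T / 3) (2 * T / 3) / (T / 3)"
  have Ic: "(\<integral>t. indicator {a<..b} t * (u t - c) \<partial>time_measure T) = 0" if "0 < a" "b < T" for a b
  proof (cases "a < b")
    case True
    have "I a b / (b - a) = c"
      using avg[of a b "T / 3" "2 * T / 3"] that True \<open>T > 0\<close> by (simp add: c_def)
    then have I: "I a b = c * (b - a)" using True by (simp add: field_simps)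
    have "(\<integral>t. indicat_real {a<..b} t \<partial>time_measure T) = (\<integral>t. indicat_real {0<..<T} t * indicat_real {a<..b} t \<partial>lborel)"
      by (rule integral_time) simp
    also have "\<dots> = (\<integral>t. indicat_real {a<..b} t \<partial>lborel)"
      using that by (intro Bochner_Integration.integral_cong) (auto simp: indicator_def)
    also have "\<dots> = b - a" using True by simp
    finally have m: "(\<integral>t. indicat_real {a<..b} t \<partial>time_measure T) = b - a" .
    have "(\<integral>t. indicator {a<..b} t * (u t - c) \<partial>time_measure T) = I a b - c * (\<integral>t. indicat_real {a<..b} t \<partial>time_measure T)"
      unfolding right_diff_distrib I_def
      by (subst Bochner_Integration.integral_diff)
        (auto intro!: bounded_borel_time bounded_borel_mult bounded_borel_indicator bounded_borel_const u)
    then show ?thesis using I m by simp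
  qed simp
  define v where "v t = indicator {0<..<T} t * (u t - c)" for t
  have buc: "bounded_borel (\<lambda>t. u t - c)" by (intro bounded_borel_diff u bounded_borel_const)
  obtain D where D: "\<And>t. \<bar>u t - c\<bar> \<le> D" "D > 0" using buc by (meson bounded_borelE)
  have "integrable lborel v"
  proof (rule Bochner_Integration.integrable_bound)
    show "integrable lborel (\<lambda>t. indicator {0<..<T} t * D)"
      using \<open>T > 0\<close> by (intro integrable_mult_left integrable_real_indicator) auto
    show "AE t in lborel. norm (v t) \<le> norm (indicator {0<..<T} t * D)"
      using D by (intro AE_I2) (auto simp: v_def indicator_def)
    show "v \<in> borel_measurable lborel" unfolding v_def by measurable
  qed
  moreover have "(\<integral>t. indicator {..a} t * v t \<partial>lborel) = 0" for a
  proof -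
    \<comment> \<open>The averages are known only for intervals away from 0 and T, so (0, T) is
      exhausted from inside.\<close>
    define lo where "lo n = T / (real n + 3)" for n
    have lo: "0 < lo n" "lo n < T" for n
    proof -
      show "0 < lo n" using \<open>T > 0\<close> by (simp add: lo_def)
      have "T * 1 < T * (real n + 3)" using \<open>T > 0\<close> by (intro mult_strict_left_mono) auto
      then show "lo n < T" by (simp add: lo_def divide_less_eq)
    qed
    have "(\<lambda>n. T * inverse (real (n + 3))) \<longlonglongrightarrow> T * 0"
      by (intro tendsto_mult tendsto_const LIMSEQ_ignore_initial_segment[OF lim_inverse_n])
    then have lo0: "lo \<longlonglongrightarrow> 0" by (simp add: lo_def[abs_def] divide_inverse)
    let ?A = "\<lambda>n. {lo n<..min a (T - lo n)}"
    have "(\<lambda>n. \<integral>t. indicator (?A n) t * (u t - c) \<partial>time_measure T) \<longlonglongrightarrow> (\<integral>t. indicator {..a} t * (u t - c) \<partial>time_measure T)"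
    proof (rule integral_dominated_convergence[where w = "\<lambda>_. D"])
      show "AE t in time_measure T. (\<lambda>n. indicator (?A n) t * (u t - c)) \<longlonglongrightarrow> indicator {..a} t * (u t - c)"
        unfolding AE_time
      proof (intro AE_I2 impI)
        fix t assume t: "t \<in> {0<..<T}"
        have "\<forall>\<^sub>F n in sequentially. lo n < min t (T - t)"
          using t by (intro order_tendstoD(2)[OF lo0]) auto
        then have "\<forall>\<^sub>F n in sequentially. indicator (?A n) t * (u t - c) = indicator {..a} t * (u t - c)"
          by eventually_elim (auto simp: indicator_def)
        then show "(\<lambda>n. indicator (?A n) t * (u t - c)) \<longlonglongrightarrow> indicator {..a} t * (u t - c)"
          by (rule tendsto_eventually)
      qed
      show "AE t in time_measure T. norm (indicator (?A n) t * (u t - c)) \<le> D" for n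
        using D by (intro AE_I2) (auto simp: indicator_def)
    qed auto
    then have "(\<integral>t. indicator {..a} t * (u t - c) \<partial>time_measure T) = 0"
      using lo by (subst (asm) Ic) (auto simp: LIMSEQ_const_iff min_less_iff_disj)
    then show ?thesis
      by (subst (asm) integral_time) (auto simp: v_def mult.left_commute)
  qed
  ultimately have "AE t in lborel. v t = 0" by (rule AE_zero_if_atMost_integrals_zero)
  then have "AE t in time_measure T. u t = c"
    unfolding AE_time by eventually_elim (auto simp: v_def)
  then show ?thesis by blast
qed

text \<open>
  \<open>u\<close> is almost everywhere a constant plus a primitive of \<open>f\<close>; Fubini's theorem gives the square of the
  primitive, so no theory of absolutely continuous functions is involved.
\<close>

lemma weak_derivative_square:
  assumes u: "bounded_borel u" and f: "bounded_borel f" and "T > 0"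
    and weak: "\<And>\<theta>. time_test T \<theta> \<Longrightarrow> (\<integral>t. deriv \<theta> t * u t + \<theta> t * f t \<partial>time_measure T) = 0"
    and \<theta>: "time_test T \<theta>"
  shows "(\<integral>t. deriv \<theta> t * (u t)\<^sup>2 + 2 * (\<theta> t * (u t * f t)) \<partial>time_measure T) = 0"
proof -
  let ?G = "prim T f"
  note [intro] = bounded_borel_time bounded_borel_mult bounded_borel_diff bounded_borel_add bounded_borel_const
    bounded_borel_prim u f
  have bG: "bounded_borel ?G" "bounded_borel (prim T (\<lambda>s. ?G s * f s))" by auto
  have "(\<integral>t. deriv \<theta> t * (u t - ?G t) \<partial>time_measure T) = 0" if t: "time_test T \<theta>" for \<theta>
  proof -
    have [intro]: "bounded_borel \<theta>" "bounded_borel (deriv \<theta>)" using time_test_bounded[OF t] by auto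
    have "(\<integral>t. deriv \<theta> t * u t \<partial>time_measure T) + (\<integral>t. \<theta> t * f t \<partial>time_measure T) = 0"
      using weak[OF t] by (subst (asm) Bochner_Integration.integral_add) auto
    moreover have "(\<integral>t. deriv \<theta> t * (u t - ?G t) \<partial>time_measure T) =
        (\<integral>t. deriv \<theta> t * u t \<partial>time_measure T) - (\<integral>t. deriv \<theta> t * ?G t \<partial>time_measure T)"
      unfolding right_diff_distrib by (rule Bochner_Integration.integral_diff) auto
    ultimately show ?thesis using prim_by_parts[OF t f \<open>T > 0\<close>] by simp
  qed
  then obtain c where c: "AE t in time_measure T. u t - ?G t = c"
    using du_Bois_Reymond[of "\<lambda>t. u t - ?G t" T] \<open>T > 0\<close> by auto
  note b\<theta> = time_test_bounded[OF \<theta>]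
  note [measurable] = u[THEN bounded_borel_measurable] f[THEN bounded_borel_measurable] bG[THEN bounded_borel_measurable]
    time_test_bounded[OF \<theta>, THEN bounded_borel_measurable]
  let ?P = "prim T (\<lambda>s. ?G s * f s)"
  \<comment> \<open>With u = c + G and G^2 = 2P, where P is the primitive of G f, the integrand
    splits into the weak forms for a constant, for G and for P, each of which integrates to
    0.\<close>
  have "(\<integral>t. deriv \<theta> t * (u t)\<^sup>2 + 2 * (\<theta> t * (u t * f t)) \<partial>time_measure T)
      = (\<integral>t. (c\<^sup>2 * deriv \<theta> t + 2 * c * (deriv \<theta> t * ?G t + \<theta> t * f t)) + 2 * (deriv \<theta> t * ?P t + \<theta> t * (?G t * f t)) \<partial>time_measure T)"
  proof (rule integral_cong_AE)
    show "AE t in time_measure T. deriv \<theta> t * (u t)\<^sup>2 + 2 * (\<theta> t * (u t * f t))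
      = (c\<^sup>2 * deriv \<theta> t + 2 * c * (deriv \<theta> t * ?G t + \<theta> t * f t)) + 2 * (deriv \<theta> t * ?P t + \<theta> t * (?G t * f t))"
      using c
    proof eventually_elim
      case (elim t)
      then have "u t = c + ?G t" by simp
      moreover have "(c + ?G t)\<^sup>2 = c\<^sup>2 + 2 * c * ?G t + 2 * ?P t"
        using prim_square[OF f, of T t] by (simp add: power2_sum)
      ultimately show ?case by (simp add: algebra_simps)
    qed
  qed measurable
  also have "\<dots> = c\<^sup>2 * (\<integral>t. deriv \<theta> t \<partial>time_measure T)
      + 2 * c * ((\<integral>t. deriv \<theta> t * ?G t \<partial>time_measure T) + (\<integral>t. \<theta> t * f t \<partial>time_measure T))
      + 2 * ((\<integral>t. deriv \<theta> t * ?P t \<partial>time_measure T) + (\<integral>t. \<theta> t * (?G t * f t) \<partial>time_measure T))"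
  proof -
    have "integrable (time_measure T) (deriv \<theta>)" "integrable (time_measure T) (\<lambda>t. deriv \<theta> t * ?G t)"
      "integrable (time_measure T) (\<lambda>t. \<theta> t * f t)" "integrable (time_measure T) (\<lambda>t. deriv \<theta> t * ?P t)"
      "integrable (time_measure T) (\<lambda>t. \<theta> t * (?G t * f t))"
      by (intro bounded_borel_time bounded_borel_mult bG b\<theta> f)+
    then show ?thesis by simp
  qed
  also have "\<dots> = 0"
    using time_test_FTC(2)[OF \<theta> \<open>T > 0\<close>] prim_by_parts[OF \<theta> f \<open>T > 0\<close>]
      prim_by_parts[OF \<theta> bounded_borel_mult[OF bG(1) f] \<open>T > 0\<close>] by simp
  finally show ?thesis .
qed

section \<open>The mollified energy balance\<close>

abbreviation bounded_borel2 :: "(real \<Rightarrow> real^3 \<Rightarrow> real) \<Rightarrow> bool" where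
  "bounded_borel2 F \<equiv> bounded_borel (\<lambda>p. F (fst p) (snd p))"

lemma bounded_borel2_iff:
  "bounded_borel2 F \<longleftrightarrow> (\<lambda>(t, x). F t x) \<in> borel_measurable (borel \<Otimes>\<^sub>M borel) \<and> (\<exists>C. \<forall>t x. \<bar>F t x\<bar> \<le> C)"
  by (simp add: bounded_borel_def borel_prod case_prod_unfold)

lemma bounded_borel2_bound: "bounded_borel2 F \<Longrightarrow> \<exists>C. \<forall>t x. \<bar>F t x\<bar> \<le> C"
  by (simp add: bounded_borel2_iff)

lemma bounded_borel2_measurable: "bounded_borel2 F \<Longrightarrow> (\<lambda>(t, x). F t x) \<in> borel_measurable (borel \<Otimes>\<^sub>M borel)"
  by (simp add: bounded_borel2_iff)

lemma bounded_borel2_time: "bounded_borel f \<Longrightarrow> bounded_borel2 (\<lambda>t x. f t)"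
  unfolding bounded_borel2_iff[of "\<lambda>t x. f t"] bounded_borel_def[of f] by auto

lemma bounded_borel2_section:
  assumes "bounded_borel2 F"
  shows "bounded_borel (\<lambda>t. F t x)" "bounded_borel (F t)"
proof -
  note m = bounded_borel2_measurable[OF assms]
  obtain C where "\<And>t x. \<bar>F t x\<bar> \<le> C" using bounded_borel2_bound[OF assms] by blast
  then show "bounded_borel (\<lambda>t. F t x)" "bounded_borel (F t)"
    using measurable_Pair2[OF m, of t] measurable_Pair1[OF m, of x] by (auto simp: bounded_borel_def)
qed

lemma bounded_borel2_swap:
  assumes "bounded_borel2 F"
  shows "(\<integral>x. (\<integral>t. F t x \<partial>time_measure T) \<partial>torus) = (\<integral>t. (\<integral>x. F t x \<partial>torus) \<partial>time_measure T)"
proof -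
  obtain C where C: "\<And>t x. \<bar>F t x\<bar> \<le> C" using bounded_borel2_bound[OF assms] by blast
  interpret P: pair_sigma_finite "time_measure T" torus
    by (intro pair_sigma_finite.intro time.sigma_finite_measure_axioms torus.sigma_finite_measure_axioms)
  interpret F: finite_measure "time_measure T \<Otimes>\<^sub>M torus"
    by (intro finite_measure_pair_measure finite_measure_time finite_measure_torus)
  have "(\<lambda>(t, x). F t x) \<in> borel_measurable (time_measure T \<Otimes>\<^sub>M torus)"
    using bounded_borel2_measurable[OF assms]
    by (simp add: measurable_cong_sets[OF sets_pair_measure_cong[OF sets_time sets_torus] refl])
  then have "integrable (time_measure T \<Otimes>\<^sub>M torus) (\<lambda>(t, x). F t x)"
    by (rule F.integrable_const_bound[where B = C, rotated]) (use C in auto)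
  from P.Fubini_integral[OF this] show ?thesis by simp
qed

lemma bounded_borel_integral_torus:
  assumes "bounded_borel2 F" shows "bounded_borel (\<lambda>t. \<integral>x. F t x \<partial>torus)"
proof -
  obtain C where C: "\<And>t x. \<bar>F t x\<bar> \<le> C" using bounded_borel2_bound[OF assms] by blast
  have "\<bar>\<integral>x. F t x \<partial>torus\<bar> \<le> C" for t
  proof -
    have "\<bar>\<integral>x. F t x \<partial>torus\<bar> \<le> (\<integral>x. \<bar>F t x\<bar> \<partial>torus)" by (rule integral_abs_bound)
    also have "\<dots> \<le> (\<integral>x. C \<partial>torus)"
      using C by (intro integral_mono integrable_abs bounded_borel_torus bounded_borel2_section[OF assms] bounded_borel_const)
    finally show ?thesis by simp
  qed
  moreover have "(\<lambda>t. \<integral>x. F t x \<partial>torus) \<in> borel_measurable borel"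
    using bounded_borel2_measurable[OF assms]
    by (intro torus.borel_measurable_lebesgue_integral)
      (simp add: measurable_cong_sets[OF sets_pair_measure_cong[OF refl sets_torus] refl])
  ultimately show ?thesis by (auto simp: bounded_borel_def)
qed

text \<open>An L1 bound uniform in t makes the correlation bounded in t and x jointly, so later
  exchanges of integrals concern bounded functions over finite measures.\<close>

lemma bounded_borel2_corr:
  assumes \<kappa>: "bper \<kappa>" and [measurable]: "(\<lambda>(t, y). g t y) \<in> borel_measurable (borel \<Otimes>\<^sub>M borel)"
    and int: "\<And>t. integrable torus (g t)" and D: "\<And>t. (\<integral>y. \<bar>g t y\<bar> \<partial>torus) \<le> D"
  shows "bounded_borel2 (\<lambda>t x. corr \<kappa> (g t) x)"
proof -
  obtain C where C: "\<And>x. \<bar>\<kappa> x\<bar> \<le> C" "C > 0" using \<kappa> by (meson bperE)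
  have [measurable]: "\<kappa> \<in> borel_measurable borel" by (rule bper_measurable[OF \<kappa>])
  have "\<bar>corr \<kappa> (g t) x\<bar> \<le> C * D" for t x
  proof -
    have "\<bar>corr \<kappa> (g t) x\<bar> \<le> (\<integral>y. \<bar>\<kappa> (y - x) * g t y\<bar> \<partial>torus)"
      unfolding corr_def by (rule integral_abs_bound)
    also have "\<dots> \<le> (\<integral>y. C * \<bar>g t y\<bar> \<partial>torus)"
      using \<kappa> int C by (intro integral_mono integrable_abs corr_integrable integrable_mult_right)
        (auto intro!: mult_right_mono simp: abs_mult)
    also have "\<dots> \<le> C * D" using D[of t] C by (simp add: mult_left_mono)
    finally show ?thesis .
  qed
  moreover have "(\<lambda>(t, x). corr \<kappa> (g t) x) \<in> borel_measurable (borel \<Otimes>\<^sub>M borel)"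
  proof -
    have "(\<lambda>q. \<kappa> (snd q - snd (fst q)) * (\<lambda>(t, y). g t y) (fst (fst q), snd q))
        \<in> borel_measurable ((borel \<Otimes>\<^sub>M borel) \<Otimes>\<^sub>M torus)"
      by measurable
    then have "(\<lambda>(p, y). \<kappa> (y - snd p) * g (fst p) y) \<in> borel_measurable ((borel \<Otimes>\<^sub>M borel) \<Otimes>\<^sub>M torus)"
      by (simp add: case_prod_unfold)
    from torus.borel_measurable_lebesgue_integral[OF this] show ?thesis
      by (simp add: corr_def case_prod_unfold)
  qed
  ultimately show ?thesis unfolding bounded_borel2_iff[of "\<lambda>t x. corr \<kappa> (g t) x"] by blast
qed

text \<open>The spatial conditions are asked for at every t and not merely at almost every t, so
  that slices can be used freely under Fubini. The last condition is the equation tested with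
  \<theta>(t) \<eta>(y - x) e_i: it says that \<open>kernel.hall\<close> is the weak time derivative
  of the mollified component at the fixed point x.\<close>

locale emhd_borel =
  fixes T M :: real and B :: "real \<Rightarrow> real^3 \<Rightarrow> real^3"
  assumes T: "T > 0"
    and meas [measurable]: "(\<lambda>(t, x). B t x) \<in> borel_measurable (borel \<Otimes>\<^sub>M borel)"
    and per: "periodic (B t)"
    and sq_int: "integrable torus (\<lambda>x. (norm (B t x))\<^sup>2)"
    and sq_bound: "(\<integral>x. (norm (B t x))\<^sup>2 \<partial>torus) \<le> M"
    and weak: "kernel \<eta> \<Longrightarrow> time_test T \<theta> \<Longrightarrow>
      (\<integral>t. deriv \<theta> t * corr \<eta> (\<lambda>y. B t y $ i) x + \<theta> t * kernel.hall \<eta> i (B t) x \<partial>time_measure T) = 0"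
begin

lemma meas_section [measurable]: "B t \<in> borel_measurable borel"
  using measurable_Pair2[OF meas, of t] by simp

lemma comp_int: "integrable torus (\<lambda>x. B t x $ i)" "integrable torus (\<lambda>x. B t x $ k * B t x $ i)"
  using square_integrable_components[OF meas_section sq_int] by auto

lemma comp_sq_int: "integrable torus (\<lambda>x. (B t x $ i)\<^sup>2)"
  using comp_int(2)[of t i i] by (simp add: power2_eq_square)

lemma comp_bound: "(\<integral>x. \<bar>B t x $ i\<bar> \<partial>torus) \<le> 1 + M" "(\<integral>x. \<bar>B t x $ k * B t x $ i\<bar> \<partial>torus) \<le> M"
proof -
  have c: "\<bar>B t x $ k\<bar> \<le> norm (B t x)" for x k by (rule component_le_norm_cart)
  have "\<bar>B t x $ k * B t x $ i\<bar> \<le> (norm (B t x))\<^sup>2" for x k i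
    unfolding abs_mult power2_eq_square by (intro mult_mono c) auto
  then have "(\<integral>x. \<bar>B t x $ k * B t x $ i\<bar> \<partial>torus) \<le> (\<integral>x. (norm (B t x))\<^sup>2 \<partial>torus)"
    by (intro integral_mono integrable_abs comp_int sq_int)
  then show "(\<integral>x. \<bar>B t x $ k * B t x $ i\<bar> \<partial>torus) \<le> M" using sq_bound by (rule order_trans)
  have "\<bar>B t x $ i\<bar> \<le> 1 + (norm (B t x))\<^sup>2" for x
    using sum_squares_bound[of "norm (B t x)" 1] norm_ge_zero[of "B t x"] c[of x i]
    unfolding one_power2 mult_1_right by linarith
  then have "(\<integral>x. \<bar>B t x $ i\<bar> \<partial>torus) \<le> (\<integral>x. 1 + (norm (B t x))\<^sup>2 \<partial>torus)"
    by (intro integral_mono integrable_abs comp_int sq_int Bochner_Integration.integrable_add torus.integrable_const)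
  also have "\<dots> \<le> 1 + M" using sq_bound[of t] sq_int by simp
  finally show "(\<integral>x. \<bar>B t x $ i\<bar> \<partial>torus) \<le> 1 + M" .
qed

lemma bounded_borel2_mollified:
  assumes "bper \<kappa>"
  shows "bounded_borel2 (\<lambda>t x. corr \<kappa> (\<lambda>y. B t y $ i) x)"
    "bounded_borel2 (\<lambda>t x. corr \<kappa> (\<lambda>y. B t y $ k * B t y $ i) x)"
proof -
  have c: "(\<lambda>p. (\<lambda>(t, x). B t x) p $ k) \<in> borel_measurable (borel \<Otimes>\<^sub>M borel)" for k
    by measurable
  then have m: "(\<lambda>(t, y). B t y $ i) \<in> borel_measurable (borel \<Otimes>\<^sub>M borel)"
    "(\<lambda>(t, y). B t y $ k * B t y $ i) \<in> borel_measurable (borel \<Otimes>\<^sub>M borel)"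
    using borel_measurable_times[OF c[of k] c[of i]] by (simp_all add: case_prod_unfold)
  show "bounded_borel2 (\<lambda>t x. corr \<kappa> (\<lambda>y. B t y $ i) x)"
    by (rule bounded_borel2_corr[OF assms m(1) comp_int(1) comp_bound(1)])
  show "bounded_borel2 (\<lambda>t x. corr \<kappa> (\<lambda>y. B t y $ k * B t y $ i) x)"
    by (rule bounded_borel2_corr[OF assms m(2) comp_int(2) comp_bound(2)])
qed

lemma bounded_borel2_hall: assumes "kernel \<eta>" shows "bounded_borel2 (\<lambda>t x. kernel.hall \<eta> i (B t) x)"
  unfolding kernel.hall_def[OF assms]
  by (cases "i = 1"; cases "i = 2"; simp;
      intro bounded_borel_sum bounded_borel_diff bounded_borel2_mollified kernel.bper_\<eta>2[OF assms])

lemma bounded_borel_flux: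
  assumes "kernel \<eta>" shows "bounded_borel (\<lambda>t. kernel.flux \<eta> (B t))"
  unfolding kernel.flux_def[OF assms]
  by (intro bounded_borel_integral_torus bounded_borel_sum bounded_borel_mult bounded_borel2_mollified
      bounded_borel2_hall assms kernel.bper_\<eta>[OF assms])

text \<open>For fixed x and i the mollified component is bounded with bounded weak derivative, so
  \<open>weak_derivative_square\<close> applies to it. Integrating the result over x and exchanging
  the integrals assembles energy and flux.\<close>

lemma mollified_energy_balance:
  assumes ker: "kernel \<eta>" and \<theta>: "time_test T \<theta>"
  shows "(\<integral>t. deriv \<theta> t * (\<integral>x. (\<Sum>i\<in>UNIV. (corr \<eta> (\<lambda>y. B t y $ i) x)\<^sup>2) \<partial>torus)
     + 2 * (\<theta> t * kernel.flux \<eta> (B t)) \<partial>time_measure T) = 0"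
proof -
  note bu = bounded_borel2_mollified(1)[OF kernel.bper_\<eta>[OF ker]] and bh = bounded_borel2_hall[OF ker]
  note b\<theta> = time_test_bounded[OF \<theta>]
  let ?u = "\<lambda>i t x. corr \<eta> (\<lambda>y. B t y $ i) x" and ?h = "\<lambda>i t x. kernel.hall \<eta> i (B t) x"
  define F where "F i t x = deriv \<theta> t * (?u i t x * ?u i t x) + 2 * (\<theta> t * (?u i t x * ?h i t x))" for i t x
  have bF: "bounded_borel2 (F i)" for i
    unfolding F_def[abs_def]
    by (intro bounded_borel_add bounded_borel_mult bounded_borel2_time bounded_borel_const bu bh b\<theta>)
  have "(\<integral>t. F i t x \<partial>time_measure T) = 0" for i x
    unfolding F_def using weak_derivative_square[OF bounded_borel2_section(1)[OF bu] bounded_borel2_section(1)[OF bh] T weak[OF ker] \<theta>]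
    by (simp add: power2_eq_square)
  then have "(\<Sum>i\<in>UNIV. (\<integral>x. (\<integral>t. F i t x \<partial>time_measure T) \<partial>torus)) = 0" by simp
  then have "(\<Sum>i\<in>UNIV. (\<integral>t. (\<integral>x. F i t x \<partial>torus) \<partial>time_measure T)) = 0"
    by (simp add: bounded_borel2_swap[OF bF])
  then have "(\<integral>t. (\<Sum>i\<in>UNIV. (\<integral>x. F i t x \<partial>torus)) \<partial>time_measure T) = 0"
    by (simp add: bounded_borel_time bounded_borel_integral_torus bF)
  moreover have "(\<Sum>i\<in>UNIV. (\<integral>x. F i t x \<partial>torus)) = deriv \<theta> t * (\<integral>x. (\<Sum>i\<in>UNIV. (?u i t x)\<^sup>2) \<partial>torus)
     + 2 * (\<theta> t * kernel.flux \<eta> (B t))" for t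
  proof -
    have i1: "integrable torus (\<lambda>x. ?u i t x * ?u i t x)" "integrable torus (\<lambda>x. ?u i t x * ?h i t x)" for i
      using bounded_borel2_section(2)[OF bounded_borel_mult[OF bu[of i] bu[of i]], of t]
        bounded_borel2_section(2)[OF bounded_borel_mult[OF bu[of i] bh[of i]], of t]
      by (auto intro: bounded_borel_torus)
    then show ?thesis
      by (simp add: F_def kernel.flux_def[OF ker] power2_eq_square sum.distrib sum_distrib_left)
  qed
  ultimately show ?thesis by simp
qed

text \<open>The mollified energies converge for every t and are bounded by \<open>M\<close>, while
  the flux is eventually at most an arbitrarily small multiple of a fixed integrable function. In
  the limit the energy has weak derivative 0.\<close>

lemma energy_constant:
  assumes ker: "\<And>n. kernel (\<eta> n)"
    and supp: "\<And>n l. l \<in> unit_cube \<Longrightarrow> \<eta> n l \<noteq> 0 \<Longrightarrow> norm l \<le> r n" and r: "r \<longlonglongrightarrow> 0"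
    and W: "integrable (time_measure T) W"
    and flux: "\<And>\<delta>. \<delta> > 0 \<Longrightarrow> \<forall>\<^sub>F n in sequentially. \<forall>t. \<bar>kernel.flux (\<eta> n) (B t)\<bar> \<le> \<delta> * W t"
  shows "\<exists>c. AE t in time_measure T. (\<integral>x. (norm (B t x))\<^sup>2 \<partial>torus) = c"
proof (rule du_Bois_Reymond[OF _ T])
  let ?E = "\<lambda>t. \<integral>x. (norm (B t x))\<^sup>2 \<partial>torus"
  define En where "En n t = (\<integral>x. (\<Sum>i\<in>UNIV. (corr (\<eta> n) (\<lambda>y. B t y $ i) x)\<^sup>2) \<partial>torus)" for n t
  have n2: "(norm (B t x))\<^sup>2 = (\<Sum>i\<in>UNIV. (B t x $ i)\<^sup>2)" for t x
    by (simp add: norm_vec_def L2_set_def sum_nonneg)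
  note bu = bounded_borel2_mollified(1)[OF kernel.bper_\<eta>[OF ker]]
  have iu: "integrable torus (\<lambda>x. (corr (\<eta> n) (\<lambda>y. B t y $ i) x)\<^sup>2)" for n t i
    using bounded_borel_torus[OF bounded_borel2_section(2)[OF bounded_borel_mult[OF bu[of n i] bu[of n i]], of t]]
    by (simp add: power2_eq_square)
  have En_eq: "En n t = (\<Sum>i\<in>UNIV. (\<integral>x. (corr (\<eta> n) (\<lambda>y. B t y $ i) x)\<^sup>2 \<partial>torus))" for n t
    unfolding En_def by (rule Bochner_Integration.integral_sum) (rule iu)
  have E_eq: "?E t = (\<Sum>i\<in>UNIV. (\<integral>x. (B t x $ i)\<^sup>2 \<partial>torus))" for t
    unfolding n2 by (rule Bochner_Integration.integral_sum) (rule comp_sq_int)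
  have cper: "periodic (\<lambda>x. B t x $ i)" for t i using per[of t] by (simp add: periodic_def)
  have "(\<lambda>n. En n t) \<longlonglongrightarrow> ?E t" for t
    unfolding En_eq E_eq
    by (intro tendsto_sum energy_mollified_tendsto[where r = r] ker r cper comp_sq_int comp_int supp) measurable
  note En_lim = this
  have bEn: "bounded_borel (En n)" for n
    unfolding En_def[abs_def] power2_eq_square
    by (intro bounded_borel_integral_torus bounded_borel_sum bounded_borel_mult bu)
  have En_bound: "\<bar>En n t\<bar> \<le> M" for n t
  proof -
    have "En n t \<le> ?E t"
      unfolding En_eq E_eq
      by (intro sum_mono kernel.corr_L2_bound[OF ker] cper comp_sq_int comp_int) measurable
    moreover have "En n t \<ge> 0" unfolding En_eq by (intro sum_nonneg) simp
    ultimately show ?thesis using sq_bound[of t] by simp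
  qed
  have E_bound: "\<bar>?E t\<bar> \<le> M" for t using sq_bound[of t] by simp
  \<comment> \<open>Measurability of the energy in time is inherited from the mollified
    energies.\<close>
  have [measurable]: "?E \<in> borel_measurable borel"
    by (rule borel_measurable_LIMSEQ_real[OF En_lim]) (auto intro: bounded_borel_measurable[OF bEn])
  show "bounded_borel ?E" using E_bound by (auto simp: bounded_borel_def)
  fix \<theta> assume \<theta>: "time_test T \<theta>"
  note b\<theta> = time_test_bounded[OF \<theta>]
  note [measurable] = bounded_borel_measurable[OF b\<theta>(1)] bounded_borel_measurable[OF b\<theta>(2)] bounded_borel_measurable[OF bEn]
  obtain C D where C: "\<And>t. \<bar>\<theta> t\<bar> \<le> C" "C > 0" and D: "\<And>t. \<bar>deriv \<theta> t\<bar> \<le> D" "D > 0"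
    using b\<theta> by (meson bounded_borelE)
  have 1: "(\<lambda>n. \<integral>t. deriv \<theta> t * En n t \<partial>time_measure T) \<longlonglongrightarrow> (\<integral>t. deriv \<theta> t * ?E t \<partial>time_measure T)"
  proof (rule integral_dominated_convergence[where w = "\<lambda>_. D * M"])
    show "AE t in time_measure T. norm (deriv \<theta> t * En n t) \<le> D * M" for n
      using D En_bound[of n] by (intro AE_I2) (auto simp: abs_mult intro!: mult_mono)
  qed (use En_lim in \<open>auto intro!: tendsto_mult\<close>)
  have fl: "integrable (time_measure T) (\<lambda>t. \<theta> t * kernel.flux (\<eta> n) (B t))" for n
    by (intro bounded_borel_time bounded_borel_mult b\<theta> bounded_borel_flux ker)
  have 2: "(\<integral>t. deriv \<theta> t * En n t \<partial>time_measure T) = - 2 * (\<integral>t. \<theta> t * kernel.flux (\<eta> n) (B t) \<partial>time_measure T)" for n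
  proof -
    have "integrable (time_measure T) (\<lambda>t. deriv \<theta> t * En n t)"
      by (intro bounded_borel_time bounded_borel_mult b\<theta> bEn)
    then show ?thesis
      using mollified_energy_balance[OF ker \<theta>, of n] fl[of n] by (simp add: En_def[symmetric])
  qed
  \<comment> \<open>The bound on the flux itself forces \<open>W\<close> to be nonnegative.\<close>
  have W0: "W t \<ge> 0" for t
  proof -
    obtain n where "\<bar>kernel.flux (\<eta> n) (B t)\<bar> \<le> 1 * W t"
      using flux[of 1] by (auto simp: eventually_sequentially)
    then show ?thesis by (simp add: order_trans[OF abs_ge_zero])
  qed
  define I where "I = (\<integral>t. W t \<partial>time_measure T)"
  have "I \<ge> 0" unfolding I_def using W0 by simp
  have 3: "(\<lambda>n. \<integral>t. \<theta> t * kernel.flux (\<eta> n) (B t) \<partial>time_measure T) \<longlonglongrightarrow> 0"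
  proof (rule tendstoI)
    fix e :: real assume "e > 0"
    \<comment> \<open>With this choice C \<delta> I is at most e/2; the + 1 covers I = 0.\<close>
    define \<delta> where "\<delta> = e / (2 * C * (I + 1))"
    have "\<delta> > 0" using \<open>e > 0\<close> C(2) \<open>I \<ge> 0\<close> by (simp add: \<delta>_def)
    from flux[OF this]
    show "\<forall>\<^sub>F n in sequentially. dist (\<integral>t. \<theta> t * kernel.flux (\<eta> n) (B t) \<partial>time_measure T) 0 < e"
    proof eventually_elim
      case (elim n)
      have "\<bar>\<integral>t. \<theta> t * kernel.flux (\<eta> n) (B t) \<partial>time_measure T\<bar> \<le> (\<integral>t. \<bar>\<theta> t * kernel.flux (\<eta> n) (B t)\<bar> \<partial>time_measure T)"
        by (rule integral_abs_bound)
      also have "\<dots> \<le> (\<integral>t. C * (\<delta> * W t) \<partial>time_measure T)"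
        unfolding abs_mult using C elim
        by (intro integral_mono integrable_mult_right W mult_mono) (use fl[of n] in \<open>auto simp: abs_mult[symmetric]\<close>)
      also have "\<dots> = C * \<delta> * I" by (simp add: I_def)
      also have "\<dots> < e"
      proof -
        have "C * \<delta> * I = e / 2 * (I / (I + 1))" using C(2) by (simp add: \<delta>_def)
        also have "\<dots> \<le> e / 2 * 1" using \<open>e > 0\<close> \<open>I \<ge> 0\<close> by (intro mult_left_mono) auto
        finally show ?thesis using \<open>e > 0\<close> by simp
      qed
      finally show ?case by simp
    qed
  qed
  have "(\<lambda>n. \<integral>t. deriv \<theta> t * En n t \<partial>time_measure T) \<longlonglongrightarrow> - 2 * 0"
    unfolding 2 by (intro tendsto_intros 3)
  from LIMSEQ_unique[OF 1 this]
  show "(\<integral>t. deriv \<theta> t * ?E t \<partial>time_measure T) = 0" by simp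
qed

end

section \<open>Borel representatives\<close>

text \<open>The passage from the completed measure to Borel functions: \<open>f\<close> is known
  only through its agreement almost everywhere with the Borel function \<open>g\<close>, so its
  measurability on the set comes from completeness.\<close>

lemma lebesgue_on_transfer:
  fixes f g :: "'a::euclidean_space \<Rightarrow> real"
  assumes [measurable]: "\<Omega> \<in> sets borel" "g \<in> borel_measurable borel"
    and ae: "AE x in lborel. x \<in> \<Omega> \<longrightarrow> f x = g x"
  shows "(LINT x|lebesgue_on \<Omega>. f x) = (\<integral>x. indicator \<Omega> x * g x \<partial>lborel)"
    and "integrable (lebesgue_on \<Omega>) f \<longleftrightarrow> integrable lborel (\<lambda>x. indicator \<Omega> x * g x)"
proof -
  have G: "(\<lambda>x. indicator \<Omega> x * g x) \<in> borel_measurable borel" by measurable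
  have ae': "AE x in lebesgue. indicator \<Omega> x * g x = indicator \<Omega> x * f x"
    using ae by (subst AE_completion_iff) (auto elim!: eventually_mono simp: indicator_def)
  have F: "(\<lambda>x. indicator \<Omega> x * f x) \<in> borel_measurable lebesgue"
    by (rule borel_measurable_AE[OF _ ae']) (use G in \<open>simp add: measurable_completion\<close>)
  have S: "\<Omega> \<inter> space lebesgue \<in> sets lebesgue" by simp
  have "(LINT x|lebesgue_on \<Omega>. f x) = (LINT x|lebesgue. indicator \<Omega> x * f x)"
    by (simp add: integral_restrict_space[OF S])
  also have "\<dots> = (LINT x|lebesgue. indicator \<Omega> x * g x)"
    using ae' F G by (intro integral_cong_AE) (auto simp: measurable_completion)
  also have "\<dots> = (\<integral>x. indicator \<Omega> x * g x \<partial>lborel)"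
    using G by (intro integral_completion) simp
  finally show "(LINT x|lebesgue_on \<Omega>. f x) = (\<integral>x. indicator \<Omega> x * g x \<partial>lborel)" .
  have "integrable (lebesgue_on \<Omega>) f \<longleftrightarrow> integrable lebesgue (\<lambda>x. indicator \<Omega> x * f x)"
    by (simp add: integrable_restrict_space[OF S])
  also have "\<dots> \<longleftrightarrow> integrable lebesgue (\<lambda>x. indicator \<Omega> x * g x)"
    using ae' F G by (intro integrable_cong_AE) (auto simp: measurable_completion)
  also have "\<dots> \<longleftrightarrow> integrable lborel (\<lambda>x. indicator \<Omega> x * g x)"
    using G by (intro integrable_completion) simp
  finally show "integrable (lebesgue_on \<Omega>) f \<longleftrightarrow> integrable lborel (\<lambda>x. indicator \<Omega> x * g x)" .
qed

lemma torus_eq_density: "torus = density lborel (\<lambda>x. ennreal (indicator unit_cube x))"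
  by (simp add: torus_def ennreal_indicator)

lemma time_measure_eq_density: "time_measure T = density lborel (\<lambda>t. ennreal (indicator {0<..<T} t))"
  by (simp add: time_measure_def ennreal_indicator)

lemma torus_transfer:
  fixes f g :: "real^3 \<Rightarrow> real"
  assumes [measurable]: "g \<in> borel_measurable borel" and ae: "AE x in torus. f x = g x"
  shows "(LINT x|lebesgue_on unit_cube. f x) = (\<integral>x. g x \<partial>torus)"
    and "integrable (lebesgue_on unit_cube) f \<longleftrightarrow> integrable torus g"
  using lebesgue_on_transfer[OF unit_cube_borel assms(1), of f] ae
  by (simp_all add: AE_torus, simp_all add: torus_eq_density integral_density integrable_density)

lemma AE_lebesgue_on:
  assumes "\<Omega> \<in> sets borel"
  shows "(AE x in lebesgue_on \<Omega>. P x) \<longleftrightarrow> (AE x in lborel. x \<in> \<Omega> \<longrightarrow> P x)"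
  using assms by (subst AE_restrict_space_iff) (auto simp: AE_completion_iff)

lemma AE_lebesgue_on_time: "(AE t in lebesgue_on {0<..<T}. P t) \<longleftrightarrow> (AE t in time_measure T. P t)"
  by (simp add: AE_lebesgue_on AE_time)

lemma borel_representative:
  fixes f :: "'a::euclidean_space \<Rightarrow> real^3"
  assumes f: "f \<in> borel_measurable lebesgue"
  obtains g where "g \<in> borel_measurable borel" "AE x in lborel. f x = g x"
proof -
  have "\<exists>h\<in>borel_measurable lborel. AE x in lborel. f x $ i = h x" for i
    by (rule completion_ex_borel_measurable_real) (use f in measurable)
  then obtain h where h: "\<And>i. h i \<in> borel_measurable lborel" "\<And>i. AE x in lborel. f x $ i = h i x"
    by metis
  define g where "g x = (\<chi> i. h i x)" for x
  have "g \<in> borel_measurable borel"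
    using h(1) by (subst borel_measurable_euclidean_space) (auto simp: Basis_vec_def inner_axis g_def)
  moreover have "AE x in lborel. \<forall>i. f x $ i = h i x"
    using h(2) by (simp add: AE_all_countable)
  then have "AE x in lborel. f x = g x"
    by eventually_elim (simp add: g_def vec_eq_iff)
  ultimately show ?thesis by (rule that)
qed

text \<open>The wrapped translation preserves the measure, hence sets of full measure; periodicity
  removes the wrapping.\<close>

lemma AE_torus_translate:
  assumes "AE x in torus. Q x" and per: "periodic Q"
  shows "AE x in torus. Q (x + a)"
proof -
  have "AE x in distr torus torus (\<lambda>x. wrap (x + a)). Q x"
    unfolding distr_torus_wrap by (rule assms(1))
  from AE_distrD[OF _ this] have "AE x in torus. Q (wrap (x + a))" by simp
  then show ?thesis by (simp add: periodic_wrap[OF per])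
qed

lemma periodic_wrap_comp: "periodic (\<lambda>x. f (wrap x))"
proof -
  have "wrap (x + axis k 1) = wrap x" for x k
    by (auto simp: wrap_def vec_eq_iff axis_def frac_1_eq)
  then show ?thesis by (simp add: periodic_def)
qed

lemma periodic_borel_representative:
  fixes v :: "real^3 \<Rightarrow> real^3"
  assumes "v \<in> borel_measurable (lebesgue_on unit_cube)"
  obtains V where "V \<in> borel_measurable borel" "periodic V" "AE x in torus. V x = v x"
proof -
  have "(\<lambda>x. if x \<in> unit_cube then v x else 0) \<in> borel_measurable lebesgue"
    using assms by (subst borel_measurable_if) auto
  then obtain g where g: "g \<in> borel_measurable borel" "AE x in lborel. (if x \<in> unit_cube then v x else 0) = g x"
    by (rule borel_representative)
  note [measurable] = g(1)
  show ?thesis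
  proof (rule that[of "\<lambda>x. g (wrap x)"])
    show "AE x in torus. g (wrap x) = v x"
      unfolding AE_torus using g(2) by eventually_elim (auto simp: wrap_id)
  qed (simp_all add: periodic_wrap_comp)
qed

text \<open>For fixed l the increments of a representative are those of the field, up to a null set
  depending on l. This is enough because norms of increments are taken for one l at a time.\<close>

lemma AE_eq_translate:
  fixes V v :: "real^3 \<Rightarrow> 'a::minus"
  assumes "periodic V" "periodic v" "AE x in torus. V x = v x"
  shows "AE x in torus. V (x + l) - V x = v (x + l) - v x"
proof -
  have "periodic (\<lambda>x. V x = v x)" using assms(1,2) by (simp add: periodic_def)
  from AE_torus_translate[OF assms(3) this, of l] assms(3) show ?thesis
    by eventually_elim simp
qed

lemma in_Lp_transfer:
  assumes [measurable]: "V \<in> borel_measurable borel" and ae: "AE x in torus. V x = v x"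
    and "in_Lp p v" "Lp_norm p v \<le> A" "p > 0"
  shows "integrable torus (\<lambda>x. norm (V x) powr p)"
    and "(\<integral>x. norm (V x) powr p \<partial>torus) \<le> A powr p"
    and "(\<integral>\<^sup>+x. ennreal (norm (V x) powr p) \<partial>torus) \<le> ennreal (A powr p)"
proof -
  have ae': "AE x in torus. norm (v x) powr p = norm (V x) powr p"
    using ae by eventually_elim simp
  note tr = torus_transfer[OF _ ae']
  show i: "integrable torus (\<lambda>x. norm (V x) powr p)"
    using assms(3) tr(2) by (simp add: in_Lp_def)
  define I where "I = (\<integral>x. norm (V x) powr p \<partial>torus)"
  have "I \<ge> 0" unfolding I_def by simp
  have "I powr (1 / p) \<le> A" using assms(4) tr(1) by (simp add: Lp_norm_def I_def)
  then have "(I powr (1 / p)) powr p \<le> A powr p" using \<open>p > 0\<close> by (intro powr_mono2) auto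
  then show I: "(\<integral>x. norm (V x) powr p \<partial>torus) \<le> A powr p"
    using \<open>p > 0\<close> \<open>I \<ge> 0\<close> by (simp add: powr_powr I_def)
  then show "(\<integral>\<^sup>+x. ennreal (norm (V x) powr p) \<partial>torus) \<le> ennreal (A powr p)"
    by (subst nn_integral_eq_integral[OF i]) (auto intro: ennreal_leI)
qed

lemma pderiv_dir_translate:
  fixes g :: "real^3 \<Rightarrow> real"
  assumes "smooth g" shows "pderiv_dir k (\<lambda>y. g (y - x)) = (\<lambda>y. pderiv_dir k g (y - x))"
proof (rule has_pd_unique[OF smooth_has_pd])
  show "smooth (\<lambda>y. g (y - x))" using smooth_translate[OF assms, of "- x"] by simp
  show "has_pd k (\<lambda>y. g (y - x)) (\<lambda>y. pderiv_dir k g (y - x))"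
    unfolding has_pd_def
  proof
    fix y
    have "y + s *\<^sub>R axis k 1 - x = (y - x) + s *\<^sub>R axis k (1::real)" for s by simp
    then show "((\<lambda>s. g (y + s *\<^sub>R axis k 1 - x)) has_real_derivative pderiv_dir k g (y - x)) (at 0)"
      using smooth_has_pd[OF assms, of k] unfolding has_pd_def by presburger
  qed
qed

lemma pderiv_dir_scaleR:
  fixes g :: "real^3 \<Rightarrow> real" and v :: "real^3"
  assumes "smooth g" shows "pderiv_dir k (\<lambda>y. g y *\<^sub>R v) y = pderiv_dir k g y *\<^sub>R v"
proof -
  have "((\<lambda>y. g y *\<^sub>R v) has_derivative (\<lambda>h. frechet_derivative g (at y) h *\<^sub>R v)) (at y)"
    by (intro has_derivative_scaleR_left smooth_has_derivative assms)
  from frechet_derivative_at[OF this] show ?thesis unfolding pderiv_dir_def by (simp add: fun_eq_iff)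
qed

lemma curl_axis:
  fixes g :: "real^3 \<Rightarrow> real"
  assumes "smooth g"
  shows "curl (\<lambda>y. g y *\<^sub>R axis 1 1) y = vector [0, pderiv_dir 3 g y, - pderiv_dir 2 g y]"
    "curl (\<lambda>y. g y *\<^sub>R axis 2 1) y = vector [- pderiv_dir 3 g y, 0, pderiv_dir 1 g y]"
    "curl (\<lambda>y. g y *\<^sub>R axis 3 1) y = vector [pderiv_dir 2 g y, - pderiv_dir 1 g y, 0]"
  by (simp_all add: curl_def pderiv_dir_scaleR[OF assms] axis_def vec_eq_iff forall_3)

lemma smooth_scaleR_const: "smooth g \<Longrightarrow> smooth (\<lambda>y. g y *\<^sub>R (v :: real^3))"
  by (rule smooth_bounded_linear[OF bounded_linear_scaleR_left])

section \<open>Weak divergence, weak curl and weak equation for representatives\<close>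

text \<open>The test function is the translate of \<kappa> by x.\<close>

lemma weakly_div_free_transfer:
  assumes [measurable]: "V \<in> borel_measurable borel" and ae: "AE x in torus. V x = v x"
    and int: "integrable torus (\<lambda>x. norm (V x))"
    and "weakly_div_free v"
  shows "div_free V"
  unfolding div_free_def
proof (intro allI impI)
  fix \<kappa> :: "real^3 \<Rightarrow> real" and x assume \<kappa>: "smooth \<kappa> \<and> periodic \<kappa>"
  then have s: "smooth (\<lambda>y. \<kappa> (y - x))" "periodic (\<lambda>y. \<kappa> (y - x))"
    using smooth_translate[of \<kappa> "- x"] by (auto simp: periodic_diff)
  have b: "bper (pderiv_dir k \<kappa>)" for k
    using \<kappa> by (simp add: smooth_periodic_bper smooth_pderiv_dir smooth_periodic_pderiv)
  have [measurable]: "pderiv_dir k \<kappa> \<in> borel_measurable borel" for k by (rule bper_measurable[OF b])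
  have Vi: "integrable torus (\<lambda>y. V y $ k)" for k
    by (rule Bochner_Integration.integrable_bound[OF int]) (auto simp: component_le_norm_cart)
  have "(LINT y|lebesgue_on unit_cube. v y \<bullet> grad (\<lambda>y. \<kappa> (y - x)) y) = 0"
    using assms(4) s by (auto simp: weakly_div_free_def)
  moreover have "(LINT y|lebesgue_on unit_cube. v y \<bullet> grad (\<lambda>y. \<kappa> (y - x)) y)
      = (\<integral>y. (\<Sum>k\<in>UNIV. pderiv_dir k \<kappa> (y - x) * V y $ k) \<partial>torus)"
  proof (rule torus_transfer)
    show "AE y in torus. v y \<bullet> grad (\<lambda>y. \<kappa> (y - x)) y = (\<Sum>k\<in>UNIV. pderiv_dir k \<kappa> (y - x) * V y $ k)"
      using ae by (rule eventually_mono) (use \<kappa> in \<open>simp add: inner_vec_def grad_def pderiv_dir_translate mult.commute\<close>)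
  qed measurable
  moreover have "integrable torus (\<lambda>y. pderiv_dir k \<kappa> (y - x) * V y $ k)" for k
    by (intro corr_integrable b Vi)
  ultimately show "(\<Sum>k\<in>UNIV. corr (pderiv_dir k \<kappa>) (\<lambda>y. V y $ k) x) = 0"
    by (simp add: corr_def)
qed

text \<open>The test fields are the translates of \<kappa> by x in the three coordinate directions.
  Their curls have two components each that need not vanish, and these give the differences in
  \<open>curl_of\<close>.\<close>

lemma has_weak_curl_transfer:
  assumes [measurable]: "V \<in> borel_measurable borel" and aeV: "AE x in torus. V x = v x"
    and [measurable]: "J \<in> borel_measurable borel" and aeJ: "AE x in torus. J x = j x"
    and intV: "integrable torus (\<lambda>x. norm (V x))"
    and "has_weak_curl v j"
  shows "curl_of V J"
  unfolding curl_of_def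
proof (intro allI impI)
  fix \<kappa> :: "real^3 \<Rightarrow> real" and x assume \<kappa>: "smooth \<kappa> \<and> periodic \<kappa>"
  have s: "smooth (\<lambda>y. \<kappa> (y - x))" "periodic (\<lambda>y. \<kappa> (y - x))"
    using \<kappa> smooth_translate[of \<kappa> "- x"] by (auto simp: periodic_diff)
  have b: "bper \<kappa>" "bper (pderiv_dir k \<kappa>)" for k
    using \<kappa> by (simp_all add: smooth_periodic_bper smooth_pderiv_dir smooth_periodic_pderiv)
  have [measurable]: "\<kappa> \<in> borel_measurable borel" "pderiv_dir k \<kappa> \<in> borel_measurable borel" for k
    by (rule bper_measurable[OF b(1)] bper_measurable[OF b(2)])+
  have Vi: "integrable torus (\<lambda>y. V y $ k)" for k
    by (rule Bochner_Integration.integrable_bound[OF intV]) (auto simp: component_le_norm_cart)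
  have ci: "integrable torus (\<lambda>y. pderiv_dir k \<kappa> (y - x) * V y $ i)" for k i
    by (intro corr_integrable b Vi)
  have p: "pderiv_dir k (\<lambda>y. \<kappa> (y - x)) y = pderiv_dir k \<kappa> (y - x)" for k y
    using \<kappa> by (simp add: pderiv_dir_translate)
  have main: "corr \<kappa> (\<lambda>y. J y $ i) x = (\<integral>y. g y \<partial>torus)"
    if [measurable]: "g \<in> borel_measurable borel"
      and g: "\<And>y. V y \<bullet> curl (\<lambda>y. \<kappa> (y - x) *\<^sub>R axis i 1) y = g y" for i g
  proof -
    let ?\<phi> = "\<lambda>y. \<kappa> (y - x) *\<^sub>R axis i (1::real) :: real^3"
    have "smooth ?\<phi>" "periodic ?\<phi>" using s smooth_scaleR_const[OF s(1)] by (auto simp: periodic_def)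
    then have "(LINT y|lebesgue_on unit_cube. j y \<bullet> ?\<phi> y) = (LINT y|lebesgue_on unit_cube. v y \<bullet> curl ?\<phi> y)"
      using assms(6) by (auto simp: has_weak_curl_def)
    moreover have "(LINT y|lebesgue_on unit_cube. j y \<bullet> ?\<phi> y) = corr \<kappa> (\<lambda>y. J y $ i) x"
      unfolding corr_def
    proof (rule torus_transfer)
      show "AE y in torus. j y \<bullet> ?\<phi> y = \<kappa> (y - x) * J y $ i"
        using aeJ by eventually_elim (simp add: inner_axis)
    qed measurable
    moreover have "(LINT y|lebesgue_on unit_cube. v y \<bullet> curl ?\<phi> y) = (\<integral>y. g y \<partial>torus)"
    proof (rule torus_transfer)
      show "AE y in torus. v y \<bullet> curl ?\<phi> y = g y"
        using aeV by eventually_elim (simp add: g[symmetric])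
    qed measurable
    ultimately show ?thesis by simp
  qed
  let ?c = "\<lambda>k i. corr (pderiv_dir k \<kappa>) (\<lambda>y. V y $ i) x" and ?p = "\<lambda>k y. pderiv_dir k \<kappa> (y - x)"
  have "corr \<kappa> (\<lambda>y. J y $ 1) x = (\<integral>y. ?p 3 y * V y $ 2 - ?p 2 y * V y $ 3 \<partial>torus)"
    by (rule main) (measurable, simp add: curl_axis[OF s(1)] p inner_vec_def sum_3)
  moreover have "corr \<kappa> (\<lambda>y. J y $ 2) x = (\<integral>y. ?p 1 y * V y $ 3 - ?p 3 y * V y $ 1 \<partial>torus)"
    by (rule main) (measurable, simp add: curl_axis[OF s(1)] p inner_vec_def sum_3)
  moreover have "corr \<kappa> (\<lambda>y. J y $ 3) x = (\<integral>y. ?p 2 y * V y $ 1 - ?p 1 y * V y $ 2 \<partial>torus)"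
    by (rule main) (measurable, simp add: curl_axis[OF s(1)] p inner_vec_def sum_3)
  ultimately show "corr \<kappa> (\<lambda>y. J y $ 1) x = ?c 3 2 - ?c 2 3 \<and> corr \<kappa> (\<lambda>y. J y $ 2) x = ?c 1 3 - ?c 3 1 \<and>
      corr \<kappa> (\<lambda>y. J y $ 3) x = ?c 2 1 - ?c 1 2"
    by (simp add: corr_def ci)
qed

lemma space_time_measure_eq_density:
  "time_measure T \<Otimes>\<^sub>M torus = density lborel (\<lambda>p. ennreal (indicator ({0<..<T} \<times> unit_cube) p))"
proof -
  have "time_measure T \<Otimes>\<^sub>M torus =
      density (lborel \<Otimes>\<^sub>M lborel) (\<lambda>(t, x). ennreal (indicator {0<..<T} t) * ennreal (indicator unit_cube x))"
    unfolding torus_eq_density time_measure_eq_density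
    by (rule pair_measure_density)
      (auto simp flip: torus_eq_density intro: lborel.sigma_finite_measure_axioms torus.sigma_finite_measure_axioms)
  also have "(\<lambda>(t, x). ennreal (indicator {0<..<T} t) * ennreal (indicator unit_cube x))
      = (\<lambda>p. ennreal (indicator ({0<..<T} \<times> unit_cube) p))"
    by (auto simp: fun_eq_iff indicator_def)
  finally show ?thesis by (simp add: lborel_prod)
qed

lemma space_time_borel: "{0<..<T::real} \<times> unit_cube \<in> sets borel"
  by (intro borel_Times unit_cube_borel) simp

text \<open>The weak equation is a single integral over space-time, while the mollified equation
  needs the integral over space at each t; Fubini is applied to the integrable Borel
  representative.\<close>

lemma space_time_transfer:
  fixes F G :: "real \<Rightarrow> real^3 \<Rightarrow> real"
  assumes G: "(\<lambda>(t, x). G t x) \<in> borel_measurable (borel \<Otimes>\<^sub>M borel)"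
    and ae: "AE p in lborel. p \<in> {0<..<T} \<times> unit_cube \<longrightarrow> F (fst p) (snd p) = G (fst p) (snd p)"
    and int: "integrable (time_measure T \<Otimes>\<^sub>M torus) (\<lambda>(t, x). G t x)"
  shows "(LINT (t, x)|lebesgue_on ({0<..<T} \<times> unit_cube). F t x) = (\<integral>t. (\<integral>x. G t x \<partial>torus) \<partial>time_measure T)"
proof -
  interpret P: pair_sigma_finite "time_measure T" torus
    by (intro pair_sigma_finite.intro time.sigma_finite_measure_axioms torus.sigma_finite_measure_axioms)
  note [measurable] = space_time_borel
  have [measurable]: "(\<lambda>p. G (fst p) (snd p)) \<in> borel_measurable borel"
    using G by (simp add: borel_prod case_prod_unfold)
  have "(LINT (t, x)|lebesgue_on ({0<..<T} \<times> unit_cube). F t x)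
      = (\<integral>p. indicator ({0<..<T} \<times> unit_cube) p * G (fst p) (snd p) \<partial>lborel)"
    by (rule lebesgue_on_transfer(1)) (use ae in \<open>simp_all add: case_prod_unfold\<close>)
  also have "\<dots> = (\<integral>p. G (fst p) (snd p) \<partial>(time_measure T \<Otimes>\<^sub>M torus))"
    unfolding space_time_measure_eq_density by (subst integral_density) auto
  also have "\<dots> = (\<integral>t. (\<integral>x. G t x \<partial>torus) \<partial>time_measure T)"
    using P.integral_fst[of G] int by (simp add: case_prod_unfold)
  finally show ?thesis .
qed

context kernel
begin

text \<open>The integrand of \<open>hall\<close> in terms of the value w of the field at y and the
  displacement z = y - x. It is quadratic in w with bounded coefficients, which gives domination by
  the square of the field.\<close>

definition hall_density :: "3 \<Rightarrow> real^3 \<Rightarrow> real^3 \<Rightarrow> real" where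
  "hall_density i w z = (\<Sum>k\<in>UNIV.
     if i = 1 then \<eta>2 k 3 z * (w $ k * w $ 2) - \<eta>2 k 2 z * (w $ k * w $ 3)
     else if i = 2 then \<eta>2 k 1 z * (w $ k * w $ 3) - \<eta>2 k 3 z * (w $ k * w $ 1)
     else \<eta>2 k 2 z * (w $ k * w $ 1) - \<eta>2 k 1 z * (w $ k * w $ 2))"

lemma hall_eq_integral:
  assumes "\<And>k i. integrable torus (\<lambda>y. b y $ k * b y $ i)"
  shows "hall i b x = (\<integral>y. hall_density i (b y) (y - x) \<partial>torus)"
proof -
  have "integrable torus (\<lambda>y. \<eta>2 k m (y - x) * (b y $ k' * b y $ i'))" for k m k' i'
    by (intro corr_integrable bper_\<eta>2 assms)
  then show ?thesis
    by (cases "i = 1"; cases "i = 2") (simp_all add: hall_def hall_density_def corr_def)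
qed

text \<open>The curl of g e_i involves only first derivatives of g, in the two other components; one
  more derivative produces the second derivatives of \<eta> in \<open>hall_density\<close>.\<close>

lemma hall_test:
  "(\<Sum>i'\<in>UNIV. \<Sum>k\<in>UNIV. w $ k * w $ i' * pderiv_dir k (\<lambda>z. curl (\<lambda>y. (c * \<eta> (y - x)) *\<^sub>R axis i 1) z $ i') y)
    = c * hall_density i w (y - x)"
proof -
  have tr: "smooth (\<lambda>y. f (y - x))" if "smooth f" for f :: "real^3 \<Rightarrow> real"
    using smooth_translate[OF that, of "- x"] by simp
  have s: "smooth (\<lambda>y. c * \<eta> (y - x))" by (intro smooth_cmult tr smooth_\<eta>)
  have p1: "pderiv_dir m (\<lambda>y. c * \<eta> (y - x)) = (\<lambda>y. c * \<eta>1 m (y - x))" for m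
    by (simp add: pderiv_dir_cmult[OF tr[OF smooth_\<eta>]] pderiv_dir_translate[OF smooth_\<eta>])
  have p2: "pderiv_dir k (\<lambda>y. c * \<eta>1 m (y - x)) y = c * \<eta>2 k m (y - x)" for k m y
    by (simp add: pderiv_dir_cmult[OF tr[OF smooth_\<eta>1]] pderiv_dir_translate[OF smooth_\<eta>1])
  have p2': "pderiv_dir k (\<lambda>y. - (c * \<eta>1 m (y - x))) y = - (c * \<eta>2 k m (y - x))" for k m y
    using pderiv_dir_cmult[OF tr[OF smooth_\<eta>1], of k "- c" m] by (simp add: pderiv_dir_translate[OF smooth_\<eta>1])
  have p0: "pderiv_dir k (\<lambda>y. 0 :: real) y = 0" for k y
    using pderiv_dir_cmult[OF smooth_\<eta>, of k 0] by simp
  consider "i = 1" | "i = 2" | "i = 3" using exhaust_3 by blast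
  then show ?thesis
    by cases (simp_all add: curl_axis[OF s] p1 p2 p2' p0 sum_3 hall_density_def algebra_simps)
qed

end

text \<open>The test field \<theta>(t) \<eta>(y - x) e_i is smooth, periodic and compactly supported
  in time, and turns the weak equation into an identity for the mollified component at x.\<close>

lemma weak_form_transfer:
  fixes B b :: "real \<Rightarrow> real^3 \<Rightarrow> real^3"
  assumes T: "T > 0" and sol: "emhd_weak_solution T b"
    and meas: "(\<lambda>(t, x). B t x) \<in> borel_measurable (borel \<Otimes>\<^sub>M borel)"
    and sq_int: "\<And>t. integrable torus (\<lambda>x. (norm (B t x))\<^sup>2)"
    and sq_bound: "\<And>t. (\<integral>x. (norm (B t x))\<^sup>2 \<partial>torus) \<le> M"
    and ae: "AE p in lborel. p \<in> {0<..<T} \<times> unit_cube \<longrightarrow> b (fst p) (snd p) = B (fst p) (snd p)"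
    and ker: "kernel \<eta>" and \<theta>: "time_test T \<theta>"
  shows "(\<integral>t. deriv \<theta> t * corr \<eta> (\<lambda>y. B t y $ i) x + \<theta> t * kernel.hall \<eta> i (B t) x \<partial>time_measure T) = 0"
proof -
  interpret kernel \<eta> by (rule ker)
  interpret P: pair_sigma_finite "time_measure T" torus
    by (intro pair_sigma_finite.intro time.sigma_finite_measure_axioms torus.sigma_finite_measure_axioms)
  note b\<theta> = time_test_bounded[OF \<theta>]
  have s\<theta>: "smooth \<theta>" using \<theta> by (simp add: time_test_def)
  have [measurable]: "\<theta> \<in> borel_measurable borel" "deriv \<theta> \<in> borel_measurable borel"
    "\<eta> \<in> borel_measurable borel" "\<eta>2 k m \<in> borel_measurable borel" for k m
    by (rule bounded_borel_measurable[OF b\<theta>(1)] bounded_borel_measurable[OF b\<theta>(2)] bper_measurable[OF bper_\<eta>]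
        bper_measurable[OF bper_\<eta>2])+
  have Bm [measurable]: "B t \<in> borel_measurable borel" for t
    using measurable_Pair2[OF meas, of t] by simp
  note comp = square_integrable_components[OF Bm sq_int]
  define \<phi> where "\<phi> t y = (\<theta> t * \<eta> (y - x)) *\<^sub>R axis i (1::real)" for t y
  define G where "G t y = deriv \<theta> t * (\<eta> (y - x) * B t y $ i) + \<theta> t * hall_density i (B t y) (y - x)" for t y
  have "test_field T \<phi>"
    unfolding test_field_def
  proof (intro conjI allI)
    have "smooth (\<lambda>p::real \<times> (real^3). \<theta> (fst p + 0))" "smooth (\<lambda>p::real \<times> (real^3). \<eta> (snd p + (- x)))"
      by (intro smooth_compose_affine bounded_linear_fst bounded_linear_snd s\<theta> smooth_\<eta>)+
    from smooth_mult[OF this]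
    have "smooth (\<lambda>p::real \<times> (real^3). \<theta> (fst p) * \<eta> (snd p - x))" by simp
    from smooth_bounded_linear[OF bounded_linear_scaleR_left this]
    show "smooth (\<lambda>(t, y). \<phi> t y)" by (simp add: \<phi>_def case_prod_unfold)
    show "periodic (\<phi> t)" for t
      using periodic_diff[OF periodic_\<eta>, of x] by (simp add: \<phi>_def periodic_def)
    show "\<exists>t1 t2. 0 < t1 \<and> t2 < T \<and> (\<forall>t x. t \<notin> {t1..t2} \<longrightarrow> \<phi> t x = 0)"
      using \<theta> unfolding time_test_def \<phi>_def by (metis mult_zero_left scaleR_zero_left)
  qed
  then have "(LINT (t, y)|lebesgue_on ({0<..<T} \<times> unit_cube).
           b t y \<bullet> vector_derivative (\<lambda>s. \<phi> s y) (at t) +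
           (\<Sum>i\<in>UNIV. \<Sum>k\<in>UNIV. b t y $ k * b t y $ i * pderiv_dir k (\<lambda>y. curl (\<phi> t) y $ i) y)) = 0"
    using sol by (auto simp: emhd_weak_solution_def)
  moreover have "(LINT (t, y)|lebesgue_on ({0<..<T} \<times> unit_cube).
           b t y \<bullet> vector_derivative (\<lambda>s. \<phi> s y) (at t) +
           (\<Sum>i\<in>UNIV. \<Sum>k\<in>UNIV. b t y $ k * b t y $ i * pderiv_dir k (\<lambda>y. curl (\<phi> t) y $ i) y))
      = (\<integral>t. (\<integral>y. G t y \<partial>torus) \<partial>time_measure T)"
  proof (rule space_time_transfer)
    have Bj: "(\<lambda>p. (\<lambda>(t, x). B t x) p $ k) \<in> borel_measurable (borel \<Otimes>\<^sub>M borel)" for k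
      using meas by measurable
    have Bj' [measurable]: "(\<lambda>p. B (fst p) (snd p) $ k) \<in> borel_measurable (borel \<Otimes>\<^sub>M borel)" for k
      using Bj[of k] by (simp add: case_prod_unfold)
    have Gm: "(\<lambda>p. G (fst p) (snd p)) \<in> borel_measurable (borel \<Otimes>\<^sub>M borel)"
      unfolding G_def hall_density_def
      by (cases "i = 1"; cases "i = 2"; simp; measurable)
    then show Gm': "(\<lambda>(t, y). G t y) \<in> borel_measurable (borel \<Otimes>\<^sub>M borel)" by (simp add: case_prod_unfold)
    have vd: "vector_derivative (\<lambda>s. \<phi> s y) (at t) = (deriv \<theta> t * \<eta> (y - x)) *\<^sub>R axis i 1" for t y
    proof (rule vector_derivative_at)
      have "(\<theta> has_vector_derivative deriv \<theta> t) (at t)"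
        using smooth_deriv_real(1)[OF s\<theta>] by (simp add: has_real_derivative_iff_has_vector_derivative)
      from bounded_linear.has_vector_derivative[OF bounded_linear_scaleR_left this, of "\<eta> (y - x) *\<^sub>R axis i 1"]
      show "((\<lambda>s. \<phi> s y) has_vector_derivative (deriv \<theta> t * \<eta> (y - x)) *\<^sub>R axis i 1) (at t)"
        by (simp add: \<phi>_def)
    qed
    have eq: "w \<bullet> vector_derivative (\<lambda>s. \<phi> s y) (at t) +
        (\<Sum>i\<in>UNIV. \<Sum>k\<in>UNIV. w $ k * w $ i * pderiv_dir k (\<lambda>y. curl (\<phi> t) y $ i) y)
        = deriv \<theta> t * (\<eta> (y - x) * w $ i) + \<theta> t * hall_density i w (y - x)" for w t y
      unfolding vd using hall_test[of w "\<theta> t" x i y] by (simp add: \<phi>_def[abs_def] inner_axis)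
    show "AE p in lborel. p \<in> {0<..<T} \<times> unit_cube \<longrightarrow>
        b (fst p) (snd p) \<bullet> vector_derivative (\<lambda>s. \<phi> s (snd p)) (at (fst p)) +
           (\<Sum>i\<in>UNIV. \<Sum>k\<in>UNIV. b (fst p) (snd p) $ k * b (fst p) (snd p) $ i * pderiv_dir k (\<lambda>y. curl (\<phi> (fst p)) y $ i) (snd p))
        = G (fst p) (snd p)"
      using ae by (rule eventually_mono) (simp add: eq G_def)
    obtain C1 where C1: "\<And>t. \<bar>deriv \<theta> t\<bar> \<le> C1" "C1 > 0" using b\<theta>(2) by (meson bounded_borelE)
    obtain C0 where C0: "\<And>t. \<bar>\<theta> t\<bar> \<le> C0" "C0 > 0" using b\<theta>(1) by (meson bounded_borelE)
    obtain E where E: "\<And>x. \<bar>\<eta> x\<bar> \<le> E" "E > 0" using bper_\<eta> by (meson bperE)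
    have "\<forall>k m. \<exists>c>0. \<forall>x. \<bar>\<eta>2 k m x\<bar> \<le> c" using bper_\<eta>2 by (meson bperE)
    then obtain E2 where E2: "\<And>k m. E2 k m > 0" "\<And>k m x. \<bar>\<eta>2 k m x\<bar> \<le> E2 k m" by metis
    define K where "K = (\<Sum>k\<in>(UNIV::3 set). \<Sum>m\<in>(UNIV::3 set). E2 k m)"
    have K: "\<bar>\<eta>2 k m z\<bar> \<le> K" for k m z
    proof -
      have "E2 k m \<le> (\<Sum>m\<in>(UNIV::3 set). E2 k m)"
        by (rule member_le_sum) (auto intro: less_imp_le E2)
      also have "\<dots> \<le> K" unfolding K_def
        by (rule member_le_sum[of k UNIV "\<lambda>k. \<Sum>m\<in>(UNIV::3 set). E2 k m"]) (simp_all add: sum_nonneg less_imp_le E2)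
      finally show ?thesis using E2(2)[of k m z] by linarith
    qed
    have "K \<ge> 0" using K[of 1 1 0] by linarith
    have hd: "\<bar>hall_density i w z\<bar> \<le> 6 * K * (norm w)\<^sup>2" for w z
    proof -
      have c: "\<bar>\<eta>2 k m z * (w $ k' * w $ i')\<bar> \<le> K * (norm w)\<^sup>2" for k m k' i'
        unfolding abs_mult power2_eq_square using K \<open>K \<ge> 0\<close>
        by (intro mult_mono component_le_norm_cart) auto
      have d: "\<bar>p - q\<bar> \<le> 2 * (K * (norm w)\<^sup>2)" if "\<bar>p\<bar> \<le> K * (norm w)\<^sup>2" "\<bar>q\<bar> \<le> K * (norm w)\<^sup>2" for p q
        using that by linarith
      have "\<bar>hall_density i w z\<bar> \<le> (\<Sum>k\<in>(UNIV::3 set). 2 * (K * (norm w)\<^sup>2))"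
        unfolding hall_density_def by (intro order_trans[OF sum_abs] sum_mono) (auto intro!: d c)
      then show ?thesis by simp
    qed
    \<comment> \<open>Both terms are dominated by a multiple of 1 + |B|^2, which is integrable over
      space-time because the energy is bounded uniformly in time.\<close>
    have Gb: "\<bar>G t y\<bar> \<le> (C1 * E + C0 * (6 * K)) * (1 + (norm (B t y))\<^sup>2)" for t y
    proof -
      have n: "\<bar>B t y $ i\<bar> \<le> 1 + (norm (B t y))\<^sup>2"
        using sum_squares_bound[of "norm (B t y)" 1] norm_ge_zero[of "B t y"] component_le_norm_cart[of "B t y" i]
        unfolding one_power2 mult_1_right by linarith
      have "\<bar>deriv \<theta> t * (\<eta> (y - x) * B t y $ i)\<bar> \<le> C1 * (E * (1 + (norm (B t y))\<^sup>2))"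
        unfolding abs_mult using C1 E n by (intro mult_mono) auto
      moreover have "\<bar>\<theta> t * hall_density i (B t y) (y - x)\<bar> \<le> C0 * (6 * K * (1 + (norm (B t y))\<^sup>2))"
        unfolding abs_mult
      proof (intro mult_mono)
        have "6 * K * (norm (B t y))\<^sup>2 \<le> 6 * K * (1 + (norm (B t y))\<^sup>2)" using \<open>K \<ge> 0\<close> by (intro mult_left_mono) auto
        then show "\<bar>hall_density i (B t y) (y - x)\<bar> \<le> 6 * K * (1 + (norm (B t y))\<^sup>2)"
          using hd[of "B t y" "y - x"] by linarith
      qed (use C0 in auto)
      ultimately show ?thesis unfolding G_def
        using abs_triangle_ineq[of "deriv \<theta> t * (\<eta> (y - x) * B t y $ i)" "\<theta> t * hall_density i (B t y) (y - x)"]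
        by (simp add: algebra_simps)
    qed
    have nm [measurable]: "(\<lambda>p. norm (B (fst p) (snd p))) \<in> borel_measurable (borel \<Otimes>\<^sub>M borel)"
      using measurable_compose[OF meas borel_measurable_norm] by (simp add: case_prod_unfold)
    have cs: "borel_measurable (time_measure T \<Otimes>\<^sub>M torus) = (borel_measurable (borel \<Otimes>\<^sub>M borel) :: (real \<times> (real^3) \<Rightarrow> real) set)"
      by (intro measurable_cong_sets sets_pair_measure_cong) simp_all
    show "integrable (time_measure T \<Otimes>\<^sub>M torus) (\<lambda>(t, y). G t y)"
    proof (rule Bochner_Integration.integrable_bound)
      have "integrable (time_measure T \<Otimes>\<^sub>M torus) (\<lambda>p. 1 + (norm (B (fst p) (snd p)))\<^sup>2)"
      proof (rule P.Fubini_integrable)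
        show "(\<lambda>p. 1 + (norm (B (fst p) (snd p)))\<^sup>2) \<in> borel_measurable (time_measure T \<Otimes>\<^sub>M torus)"
          unfolding cs by measurable
        show "AE t in time_measure T. integrable torus (\<lambda>y. 1 + (norm (B (fst (t, y)) (snd (t, y))))\<^sup>2)"
          using sq_int by (intro AE_I2) simp
        have "bounded_borel (\<lambda>t. \<integral>y. norm (1 + (norm (B t y))\<^sup>2) \<partial>torus)"
          unfolding bounded_borel_def
        proof (intro conjI exI allI)
          have "(\<lambda>(t, y). norm (1 + (norm (B t y))\<^sup>2)) \<in> borel_measurable (borel \<Otimes>\<^sub>M torus)"
          proof -
            have "(\<lambda>p. norm (1 + (norm (B (fst p) (snd p)))\<^sup>2)) \<in> borel_measurable (borel \<Otimes>\<^sub>M borel)" by measurable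
            then show ?thesis
              by (simp add: case_prod_unfold measurable_cong_sets[OF sets_pair_measure_cong[OF refl sets_torus] refl])
          qed
          from torus.borel_measurable_lebesgue_integral[OF this]
          show "(\<lambda>t. \<integral>y. norm (1 + (norm (B t y))\<^sup>2) \<partial>torus) \<in> borel_measurable borel" .
          show "\<bar>\<integral>y. norm (1 + (norm (B t y))\<^sup>2) \<partial>torus\<bar> \<le> 1 + M" for t
            using sq_bound[of t] sq_int[of t] by (simp add: add_nonneg_nonneg)
        qed
        then show "integrable (time_measure T) (\<lambda>t. \<integral>y. norm (1 + (norm (B (fst (t, y)) (snd (t, y))))\<^sup>2) \<partial>torus)"
          using bounded_borel_time by simp
      qed
      then show "integrable (time_measure T \<Otimes>\<^sub>M torus) (\<lambda>p. (C1 * E + C0 * (6 * K)) * (1 + (norm (B (fst p) (snd p)))\<^sup>2))"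
        by (rule integrable_mult_right)
      show "(\<lambda>(t, y). G t y) \<in> borel_measurable (time_measure T \<Otimes>\<^sub>M torus)" unfolding cs by (rule Gm')
      show "AE p in time_measure T \<Otimes>\<^sub>M torus. norm ((\<lambda>(t, y). G t y) p)
          \<le> norm ((C1 * E + C0 * (6 * K)) * (1 + (norm (B (fst p) (snd p)))\<^sup>2))"
        using Gb by (intro AE_I2) (auto simp: case_prod_unfold intro: order_trans[OF _ abs_ge_self])
    qed
  qed
  moreover have "(\<integral>y. G t y \<partial>torus) = deriv \<theta> t * corr \<eta> (\<lambda>y. B t y $ i) x + \<theta> t * hall i (B t) x" for t
  proof -
    have "integrable torus (\<lambda>y. \<eta> (y - x) * B t y $ i)" by (intro corr_integrable bper_\<eta> comp)
    moreover have "integrable torus (\<lambda>y. hall_density i (B t y) (y - x))"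
    proof -
      have "integrable torus (\<lambda>y. \<eta>2 k m (y - x) * (B t y $ k' * B t y $ i'))" for k m k' i'
        by (intro corr_integrable bper_\<eta>2 comp)
      then show ?thesis by (cases "i = 1"; cases "i = 2") (simp_all add: hall_density_def)
    qed
    ultimately show ?thesis
      by (simp add: G_def corr_def[of \<eta>] hall_eq_integral comp)
  qed
  ultimately show ?thesis by simp
qed

section \<open>Energy conservation\<close>

text \<open>The ratio n/\<epsilon> lies in [1/2, 3]. For nonnegative \<alpha> the upper end decides,
  for negative \<alpha> the lower end, and since 3 exceeds 2 one constant serves both signs.\<close>

lemma powr_comparable:
  fixes n \<epsilon> \<alpha> :: real
  assumes "\<epsilon> > 0" "\<epsilon> / 2 \<le> n" "n \<le> 3 * \<epsilon>"
  shows "n powr \<alpha> \<le> 3 powr \<bar>\<alpha>\<bar> * \<epsilon> powr \<alpha>"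
proof -
  define r where "r = n / \<epsilon>"
  have r: "1 / 2 \<le> r" "r \<le> 3" "n = r * \<epsilon>" using assms by (auto simp: r_def field_simps)
  have "r powr \<alpha> \<le> 3 powr \<bar>\<alpha>\<bar>"
  proof (cases "\<alpha> \<ge> 0")
    case True
    then show ?thesis using r by (simp add: powr_mono2)
  next
    case False
    have "r powr \<alpha> = (1 / r) powr (- \<alpha>)" using r by (simp add: powr_divide powr_minus field_simps)
    also have "\<dots> \<le> 3 powr (- \<alpha>)" using r False by (intro powr_mono2) (auto simp: field_simps)
    finally show ?thesis using False by simp
  qed
  then show ?thesis using r assms by (simp add: powr_mult mult_right_mono)
qed

text \<open>One coordinate gives the lower bound, the sum of the three coordinates the upper
  one.\<close>

lemma norm_in_corner_box:
  fixes l :: "real^3"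
  assumes "\<forall>i. \<epsilon> / 2 \<le> l $ i \<and> l $ i \<le> \<epsilon>" "\<epsilon> > 0"
  shows "\<epsilon> / 2 \<le> norm l" "norm l \<le> 3 * \<epsilon>"
proof -
  have *: "\<epsilon> / 2 \<le> l $ i" "l $ i \<le> \<epsilon>" for i using assms(1) by auto
  show "\<epsilon> / 2 \<le> norm l"
    using component_le_norm_cart[of l 1] *(1)[of 1] by linarith
  have "\<bar>l $ i\<bar> \<le> \<epsilon>" for i using *[of i] assms(2) by linarith
  then have "(\<Sum>i\<in>UNIV. \<bar>l $ i\<bar>) \<le> (\<Sum>i\<in>(UNIV::3 set). \<epsilon>)" by (intro sum_mono)
  then show "norm l \<le> 3 * \<epsilon>" using norm_le_l1_cart[of l] by simp
qed

text \<open>Young's inequality with weights 2/r1 and 1/r2, which add up to 1. It turns the time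
  weights of the increment bounds into an integrable function of time.\<close>

lemma young_time_weights:
  fixes x y r\<^sub>1 r\<^sub>2 :: real
  assumes "2 / r\<^sub>1 + 1 / r\<^sub>2 = 1" "1 < r\<^sub>1" "1 < r\<^sub>2" "x \<ge> 0" "y \<ge> 0"
  shows "(x powr (1 / r\<^sub>1))\<^sup>2 * y powr (1 / r\<^sub>2) \<le> x + y"
proof (cases "x = 0 \<or> y = 0")
  case True
  then show ?thesis using assms by auto
next
  case False
  then have xy: "x > 0" "y > 0" using assms by auto
  have w: "0 \<le> 2 / r\<^sub>1" "0 \<le> 1 / r\<^sub>2" using assms by auto
  have "(x powr (1 / r\<^sub>1))\<^sup>2 * y powr (1 / r\<^sub>2) = x powr (2 / r\<^sub>1) * y powr (1 / r\<^sub>2)"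
    using xy by (simp add: powr_powr flip: powr_numeral)
  also have "\<dots> \<le> 2 / r\<^sub>1 * x + 1 / r\<^sub>2 * y"
    using Youngs_inequality_0[OF w assms(1) xy] .
  also have "\<dots> \<le> 1 * x + 1 * y"
    using xy w assms(1) by (intro add_mono mult_right_mono) linarith+
  finally show ?thesis by simp
qed

text \<open>Only one modulus is known to tend to 0, but the flux bound contains the product of both.
  The other is bounded by a constant, and the small one is chosen against that constant. The origin
  is excluded because a limit at 0 says nothing about the value there.\<close>

lemma small_moduli:
  fixes \<sigma>\<^sub>1 \<sigma>\<^sub>2 :: "real^3 \<Rightarrow> real"
  assumes U: "open U" "0 \<in> U"
    and b1: "bounded (\<sigma>\<^sub>1 ` U)" "\<And>l. l \<in> U \<Longrightarrow> \<sigma>\<^sub>1 l \<ge> 0"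
    and b2: "bounded (\<sigma>\<^sub>2 ` U)" "\<And>l. l \<in> U \<Longrightarrow> \<sigma>\<^sub>2 l \<ge> 0"
    and lim: "(\<sigma>\<^sub>1 \<longlongrightarrow> 0) (at 0) \<or> (\<sigma>\<^sub>2 \<longlongrightarrow> 0) (at 0)" and "\<delta> > 0"
  obtains s1 s2 \<rho> where "s1 \<ge> 0" "s2 \<ge> 0" "s1\<^sup>2 * s2 \<le> \<delta>" "\<rho> > 0"
    "\<And>l. l \<noteq> 0 \<Longrightarrow> norm l < \<rho> \<Longrightarrow> l \<in> U \<and> \<sigma>\<^sub>1 l powr (1/3) \<le> s1 \<and> \<sigma>\<^sub>2 l powr (1/3) \<le> s2"
proof -
  obtain M1 where M1: "\<And>l. l \<in> U \<Longrightarrow> \<sigma>\<^sub>1 l \<le> M1"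
    using b1(1) unfolding bounded_iff by (metis abs_le_iff image_eqI real_norm_def)
  obtain M2 where M2: "\<And>l. l \<in> U \<Longrightarrow> \<sigma>\<^sub>2 l \<le> M2"
    using b2(1) unfolding bounded_iff by (metis abs_le_iff image_eqI real_norm_def)
  obtain \<rho>0 where \<rho>0: "\<rho>0 > 0" "\<And>l. norm l < \<rho>0 \<Longrightarrow> l \<in> U"
    using U by (metis open_contains_ball mem_ball_0 subsetD)
  have near: "\<exists>\<rho>>0. \<forall>l. l \<noteq> 0 \<and> norm l < \<rho> \<longrightarrow> l \<in> U \<and> \<sigma> l powr (1/3) \<le> s"
    if h: "(\<sigma> \<longlongrightarrow> 0) (at 0)" "s > 0" "\<And>l. l \<in> U \<Longrightarrow> \<sigma> l \<ge> 0" for \<sigma> :: "real^3 \<Rightarrow> real" and s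
  proof -
    \<comment> \<open>The modulus enters with the power 1/3, so it is compared with s^3.\<close>
    have s3: "s ^ 3 > 0" using h by simp
    obtain \<rho>1 where \<rho>1: "\<rho>1 > 0" "\<And>l. l \<noteq> 0 \<Longrightarrow> norm l < \<rho>1 \<Longrightarrow> \<bar>\<sigma> l\<bar> < s ^ 3"
      using tendstoD[OF h(1) s3] unfolding eventually_at by (metis dist_0_norm dist_commute real_norm_def UNIV_I)
    have "l \<in> U \<and> \<sigma> l powr (1/3) \<le> s" if l: "l \<noteq> 0" "norm l < min \<rho>0 \<rho>1" for l
    proof -
      have "l \<in> U" using \<rho>0 l by simp
      moreover have "\<sigma> l powr (1/3) \<le> (s ^ 3) powr (1/3)"
        using \<rho>1(2)[of l] l \<open>l \<in> U\<close> h(3)[of l] by (intro powr_mono2) auto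
      moreover have "(s ^ 3) powr (1/3) = s"
        using h(2) by (simp add: powr_powr flip: powr_numeral)
      ultimately show ?thesis by simp
    qed
    then show ?thesis using \<rho>0(1) \<rho>1(1) by (intro exI[of _ "min \<rho>0 \<rho>1"]) auto
  qed
  from lim show ?thesis
  proof
    assume l1: "(\<sigma>\<^sub>1 \<longlongrightarrow> 0) (at 0)"
    define s2 where "s2 = M2 powr (1/3)"
    \<comment> \<open>The + 1 keeps the denominator positive when the bound for the other modulus is
      0.\<close>
    define s1 where "s1 = sqrt (\<delta> / (s2 + 1))"
    have "s2 \<ge> 0" by (simp add: s2_def)
    then have "s1 > 0" using \<open>\<delta> > 0\<close> by (simp add: s1_def)
    obtain \<rho> where "\<rho> > 0" "\<And>l. l \<noteq> 0 \<Longrightarrow> norm l < \<rho> \<Longrightarrow> l \<in> U \<and> \<sigma>\<^sub>1 l powr (1/3) \<le> s1"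
      using near[OF l1 \<open>s1 > 0\<close> b1(2)] by blast
    moreover have "\<sigma>\<^sub>2 l powr (1/3) \<le> s2" if "l \<in> U" for l
      unfolding s2_def using M2 b2(2) that by (intro powr_mono2) auto
    moreover have "s1\<^sup>2 * s2 \<le> \<delta>"
    proof -
      have "s1\<^sup>2 * s2 = \<delta> * (s2 / (s2 + 1))" using \<open>\<delta> > 0\<close> \<open>s2 \<ge> 0\<close> by (simp add: s1_def)
      also have "\<dots> \<le> \<delta> * 1" using \<open>\<delta> > 0\<close> \<open>s2 \<ge> 0\<close> by (intro mult_left_mono) auto
      finally show ?thesis by simp
    qed
    ultimately show ?thesis using \<open>s1 > 0\<close> \<open>s2 \<ge> 0\<close> by (intro that[of s1 s2 \<rho>]) auto
  next
    assume l2: "(\<sigma>\<^sub>2 \<longlongrightarrow> 0) (at 0)"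
    define s1 where "s1 = M1 powr (1/3)"
    define s2 where "s2 = \<delta> / (s1\<^sup>2 + 1)"
    have "s1 \<ge> 0" by (simp add: s1_def)
    have "s2 > 0" using \<open>\<delta> > 0\<close> by (simp add: s2_def add_nonneg_pos)
    obtain \<rho> where "\<rho> > 0" "\<And>l. l \<noteq> 0 \<Longrightarrow> norm l < \<rho> \<Longrightarrow> l \<in> U \<and> \<sigma>\<^sub>2 l powr (1/3) \<le> s2"
      using near[OF l2 \<open>s2 > 0\<close> b2(2)] by blast
    moreover have "\<sigma>\<^sub>1 l powr (1/3) \<le> s1" if "l \<in> U" for l
      unfolding s1_def using M1 b1(2) that by (intro powr_mono2) auto
    moreover have "s1\<^sup>2 * s2 \<le> \<delta>"
    proof -
      have "s1\<^sup>2 * s2 = \<delta> * (s1\<^sup>2 / (s1\<^sup>2 + 1))" by (simp add: s2_def)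
      also have "\<dots> \<le> \<delta> * 1" using \<open>\<delta> > 0\<close> by (intro mult_left_mono) (auto simp: divide_le_eq add_nonneg_pos)
      finally show ?thesis by simp
    qed
    ultimately show ?thesis using \<open>s2 > 0\<close> \<open>s1 \<ge> 0\<close> by (intro that[of s1 s2 \<rho>]) auto
  qed
qed

text \<open>The increment of the field enters squared, so Hoelder's inequality is used with the pair
  9/5 and 9/4: the power 9/4 of a square is the power 9/2. The displacements in the two factors are
  independent, and each bound is used at its own one.\<close>

lemma (in kernel_field) flux_increment_bound:
  assumes A: "A \<ge> 0" "A' \<ge> 0"
    and b_incr: "\<And>l. l \<in> S \<Longrightarrow> (\<integral>\<^sup>+x. ennreal (norm (b (x + l) - b x) powr (9/2)) \<partial>torus) \<le> ennreal (A powr (9/2))"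
    and j_incr: "\<And>l. l \<in> S \<Longrightarrow> (\<integral>\<^sup>+x. ennreal (norm (j (x + l) - j x) powr (9/5)) \<partial>torus) \<le> ennreal (A' powr (9/5))"
    and supp: "\<And>l. l \<in> unit_cube \<Longrightarrow> l \<notin> S \<Longrightarrow> \<eta> l = 0 \<and> (\<forall>k. \<eta>1 k l = 0)"
    and G: "\<And>k. (\<integral>l. \<bar>\<eta>1 k l\<bar> \<partial>torus) \<le> G"
  shows "\<bar>flux b\<bar> \<le> 18 * G * (A' * A\<^sup>2)"
proof (rule flux_bound[where S = S])
  fix l l' assume l: "l \<in> S" "l' \<in> S"
  have sq: "(z\<^sup>2) powr (9/4) = z powr (9/2)" if "z \<ge> 0" for z :: real
    using that by (simp add: powr_powr flip: powr_numeral)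
  show "(\<integral>\<^sup>+x. ennreal (norm (j (x + l) - j x) * (norm (b (x + l') - b x))\<^sup>2) \<partial>torus) \<le> ennreal (A' * A\<^sup>2)"
    by (rule nn_integral_Holder[where p = "9/5" and q = "9/4"])
      (use A b_incr[OF l(2)] j_incr[OF l(1)] in \<open>simp_all add: sq\<close>)
qed (use supp G A in auto)

text \<open>Settles the exceptional times, at which the Borel field is set to 0.\<close>

lemma (in kernel) flux_zero: "flux (\<lambda>x. 0) = 0"
  by (simp add: flux_def corr_def)

text \<open>The weights are only Lebesgue integrable, but the dominating function of time has to be
  Borel.\<close>

lemma lebesgue_integrable_borel_representative:
  fixes C :: "real \<Rightarrow> real"
  assumes "integrable (lebesgue_on {0..T}) C"
  obtains D where "D \<in> borel_measurable borel" "integrable (time_measure T) D" "AE t in time_measure T. C t = D t"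
proof -
  have "C \<in> borel_measurable (lebesgue_on {0..T})" using assms by auto
  then have "(\<lambda>t. if t \<in> {0..T} then C t else 0) \<in> borel_measurable lebesgue"
    by (subst borel_measurable_if) auto
  then obtain D where D: "D \<in> borel_measurable lborel" "AE t in lborel. (if t \<in> {0..T} then C t else 0) = D t"
    using completion_ex_borel_measurable_real by blast
  then have [measurable]: "D \<in> borel_measurable borel" by simp
  have eq: "AE t in lborel. t \<in> {0..T} \<longrightarrow> C t = D t" using D(2) by (rule eventually_mono) auto
  have "integrable lborel (\<lambda>t. indicator {0..T} t * D t)"
    using lebesgue_on_transfer(2)[OF _ _ eq] assms by simp
  then have "integrable lborel (\<lambda>t. indicator {0<..<T} t * D t)"
    by (rule Bochner_Integration.integrable_bound) (auto simp: indicator_def)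
  then have "integrable (time_measure T) D"
    unfolding time_measure_eq_density by (subst integrable_density) auto
  moreover have "AE t in time_measure T. C t = D t"
    unfolding AE_time using eq by (rule eventually_mono) auto
  ultimately show ?thesis by (intro that[of D]) auto
qed

theorem corollary1p2:
  fixes T r\<^sub>1 r\<^sub>2 \<alpha> \<beta> :: real
    and b j :: "real \<Rightarrow> real^3 \<Rightarrow> real^3"
    and C\<^sub>1 C\<^sub>2 :: "real \<Rightarrow> real"
    and \<sigma>\<^sub>1 \<sigma>\<^sub>2 :: "real^3 \<Rightarrow> real"
    and U :: "(real^3) set"
  assumes "T > 0"
    and "emhd_weak_solution T b"
    and "AE t in lebesgue_on {0<..<T}. has_weak_curl (b t) (j t)"
    and "2 / r\<^sub>1 + 1 / r\<^sub>2 = 1" and "1 < r\<^sub>1" and "1 < r\<^sub>2"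
    and "2 * \<alpha> + \<beta> \<ge> 1"
    and "integrable (lebesgue_on {0..T}) C\<^sub>1" and "\<And>t. t \<in> {0..T} \<Longrightarrow> C\<^sub>1 t \<ge> 0"
    and "integrable (lebesgue_on {0..T}) C\<^sub>2" and "\<And>t. t \<in> {0..T} \<Longrightarrow> C\<^sub>2 t \<ge> 0"
    and "open U" and "0 \<in> U"
    and "bounded (\<sigma>\<^sub>1 ` U)" and "\<And>l. l \<in> U \<Longrightarrow> \<sigma>\<^sub>1 l \<ge> 0"
    and "bounded (\<sigma>\<^sub>2 ` U)" and "\<And>l. l \<in> U \<Longrightarrow> \<sigma>\<^sub>2 l \<ge> 0"
    and "(\<sigma>\<^sub>1 \<longlongrightarrow> 0) (at 0) \<or> (\<sigma>\<^sub>2 \<longlongrightarrow> 0) (at 0)"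
    and "AE t in lebesgue_on {0<..<T}. \<forall>l\<in>U.
           in_Lp (9/2) (\<lambda>x. b t (x + l) - b t x) \<and>
           Lp_norm (9/2) (\<lambda>x. b t (x + l) - b t x)
             \<le> C\<^sub>1 t powr (1 / r\<^sub>1) * norm l powr \<alpha> * \<sigma>\<^sub>1 l powr (1/3)"
    and "AE t in lebesgue_on {0<..<T}. \<forall>l\<in>U.
           in_Lp (9/5) (\<lambda>x. j t (x + l) - j t x) \<and>
           Lp_norm (9/5) (\<lambda>x. j t (x + l) - j t x)
             \<le> C\<^sub>2 t powr (1 / r\<^sub>2) * norm l powr \<beta> * \<sigma>\<^sub>2 l powr (1/3)"
  shows "energy_conserved T b"
proof -
  note T = assms(1) and sol = assms(2) and weak_curl = assms(3) and C\<^sub>1_int = assms(8) and C\<^sub>1_nonneg = assms(9)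
    and C\<^sub>2_int = assms(10) and C\<^sub>2_nonneg = assms(11) and b_incr = assms(19) and j_incr = assms(20)
  obtain M\<^sub>0 where M\<^sub>0: "AE t in lebesgue_on {0<..<T}. in_Lp 2 (b t) \<and> Lp_norm 2 (b t) \<le> M\<^sub>0"
    using sol by (auto simp: emhd_weak_solution_def)
  have divf: "AE t in lebesgue_on {0<..<T}. weakly_div_free (b t)"
    using sol by (simp add: emhd_weak_solution_def)
  have "(\<lambda>(t, x). b t x) \<in> borel_measurable (lebesgue_on ({0<..<T} \<times> UNIV))"
    using sol by (simp add: emhd_weak_solution_def)
  then have "(\<lambda>p. if p \<in> {0<..<T} \<times> UNIV then (\<lambda>(t, x). b t x) p else 0) \<in> borel_measurable lebesgue"
    using borel_Times[of "{0<..<T}" "UNIV :: (real^3) set"] by (subst borel_measurable_if) auto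
  then obtain b' where b'_meas [measurable]: "b' \<in> borel_measurable borel"
    and b': "AE p in lborel. (if p \<in> {0<..<T} \<times> UNIV then (\<lambda>(t, x). b t x) p else 0) = b' p"
    by (rule borel_representative)
  \<comment> \<open>Equality almost everywhere in space-time gives, for almost every time, equality
    almost everywhere in space.\<close>
  have b'_slice: "AE t in time_measure T. AE x in lborel. b t x = b' (t, x)"
  proof -
    have "AE p in lborel \<Otimes>\<^sub>M lborel.
        (if p \<in> {0<..<T} \<times> UNIV then (\<lambda>(t, x). b t x) p else 0) = b' p"
      using b' by (simp only: lborel_prod)
    from lborel_pair.AE_pair[OF this] show ?thesis
      unfolding AE_time by (rule eventually_mono) auto
  qed
  obtain D\<^sub>1 where D\<^sub>1: "D\<^sub>1 \<in> borel_measurable borel" "integrable (time_measure T) D\<^sub>1" "AE t in time_measure T. C\<^sub>1 t = D\<^sub>1 t"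
    using lebesgue_integrable_borel_representative[OF C\<^sub>1_int] .
  obtain D\<^sub>2 where D\<^sub>2: "D\<^sub>2 \<in> borel_measurable borel" "integrable (time_measure T) D\<^sub>2" "AE t in time_measure T. C\<^sub>2 t = D\<^sub>2 t"
    using lebesgue_integrable_borel_representative[OF C\<^sub>2_int] .
  \<comment> \<open>Everything that holds for almost every time is collected, so that a single null
    set has to be removed. The bounds on increments hold for all l in \<open>U\<close>
    simultaneously.\<close>
  define good where "good t \<longleftrightarrow> in_Lp 2 (b t) \<and> Lp_norm 2 (b t) \<le> M\<^sub>0 \<and> weakly_div_free (b t) \<and> has_weak_curl (b t) (j t) \<and>
    (AE x in lborel. b t x = b' (t, x)) \<and> C\<^sub>1 t = D\<^sub>1 t \<and> C\<^sub>2 t = D\<^sub>2 t \<and>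
    (\<forall>l\<in>U. in_Lp (9/2) (\<lambda>x. b t (x + l) - b t x) \<and> Lp_norm (9/2) (\<lambda>x. b t (x + l) - b t x)
             \<le> C\<^sub>1 t powr (1 / r\<^sub>1) * norm l powr \<alpha> * \<sigma>\<^sub>1 l powr (1/3)) \<and>
    (\<forall>l\<in>U. in_Lp (9/5) (\<lambda>x. j t (x + l) - j t x) \<and> Lp_norm (9/5) (\<lambda>x. j t (x + l) - j t x)
             \<le> C\<^sub>2 t powr (1 / r\<^sub>2) * norm l powr \<beta> * \<sigma>\<^sub>2 l powr (1/3))" for t
  have "AE t in time_measure T. good t"
    using M\<^sub>0[unfolded AE_lebesgue_on_time] divf[unfolded AE_lebesgue_on_time] weak_curl[unfolded AE_lebesgue_on_time]
      b'_slice D\<^sub>1(3) D\<^sub>2(3) b_incr[unfolded AE_lebesgue_on_time] j_incr[unfolded AE_lebesgue_on_time]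
    unfolding good_def by eventually_elim blast
  then have "AE t in lborel. t \<in> {0<..<T} \<longrightarrow> good t" by (simp add: AE_time)
  \<comment> \<open>The exceptional times are enclosed in a Borel null set, so that the set
    \<open>A\<close> of remaining times is Borel.\<close>
  then obtain N where N: "{t \<in> space lborel. \<not> (t \<in> {0<..<T} \<longrightarrow> good t)} \<subseteq> N" "emeasure lborel N = 0" "N \<in> sets lborel"
    by (rule AE_E)
  then have N_null: "N \<in> null_sets lborel" by auto
  define A where "A = {0<..<T} - N"
  have [measurable]: "A \<in> sets borel" using N(3) by (simp add: A_def)
  have A_good: "good t" "t \<in> {0<..<T}" if "t \<in> A" for t using that N(1) by (auto simp: A_def)
  have A_AE: "AE t in time_measure T. t \<in> A"
    unfolding AE_time using AE_not_in[OF N_null] by (rule eventually_mono) (auto simp: A_def)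
  \<comment> \<open>Composition with \<open>wrap\<close> makes the representative exactly periodic;
    setting it to 0 outside \<open>A\<close> makes its bounds hold at every time.\<close>
  define B where "B t x = (if t \<in> A then b' (t, wrap x) else 0)" for t x
  have B_meas: "(\<lambda>(t, x). B t x) \<in> borel_measurable (borel \<Otimes>\<^sub>M borel)"
  proof -
    have [measurable]: "b' \<in> borel_measurable (borel \<Otimes>\<^sub>M borel)" by (simp add: borel_prod)
    have "(\<lambda>p. if fst p \<in> A then b' (fst p, wrap (snd p)) else 0) \<in> borel_measurable (borel \<Otimes>\<^sub>M borel)"
      by measurable
    then show ?thesis by (simp add: B_def case_prod_unfold)
  qed
  have B_sec [measurable]: "B t \<in> borel_measurable borel" for t
    using measurable_Pair2[OF B_meas, of t] by simp
  have B_per: "periodic (B t)" for t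
    using periodic_wrap_comp[of "\<lambda>x. b' (t, x)"] by (simp add: B_def periodic_def)
  have B_eq: "AE x in torus. B t x = b t x" if "t \<in> A" for t
    unfolding AE_torus using A_good(1)[OF that] unfolding good_def
    by (auto elim!: eventually_mono simp: B_def that wrap_id)
  have B_sq: "integrable torus (\<lambda>x. (norm (B t x))\<^sup>2)" "(\<integral>x. (norm (B t x))\<^sup>2 \<partial>torus) \<le> M\<^sub>0 powr 2" for t
  proof -
    have "integrable torus (\<lambda>x. (norm (B t x))\<^sup>2) \<and> (\<integral>x. (norm (B t x))\<^sup>2 \<partial>torus) \<le> M\<^sub>0 powr 2"
    proof (cases "t \<in> A")
      case True
      from in_Lp_transfer(1,2)[OF B_sec B_eq[OF True], of 2 M\<^sub>0] A_good(1)[OF True] show ?thesis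
        by (simp add: good_def)
    qed (simp add: B_def)
    then show "integrable torus (\<lambda>x. (norm (B t x))\<^sup>2)" "(\<integral>x. (norm (B t x))\<^sup>2 \<partial>torus) \<le> M\<^sub>0 powr 2" by auto
  qed
  have B_joint: "AE p in lborel. p \<in> {0<..<T} \<times> unit_cube \<longrightarrow> b (fst p) (snd p) = B (fst p) (snd p)"
  proof -
    have "N \<times> (UNIV :: (real^3) set) \<in> null_sets (lborel \<Otimes>\<^sub>M lborel)"
      using N_null by (intro lborel.times_in_null_sets1) auto
    then have "AE p in (lborel :: (real \<times> (real^3)) measure). p \<notin> N \<times> UNIV"
      unfolding lborel_prod by (rule AE_not_in)
    then show ?thesis
      using b' by eventually_elim (auto simp: B_def A_def wrap_id)
  qed
  \<comment> \<open>The current is represented at each time separately. The choice depends on t in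
    no controlled way, which is harmless because the flux as a function of time does not involve
    it.\<close>
  have "\<exists>J. J \<in> borel_measurable borel \<and> periodic J \<and> (AE x in torus. J x = j t x)" if "t \<in> A" for t
  proof -
    have "j t \<in> borel_measurable (lebesgue_on unit_cube)"
      using A_good(1)[OF that] by (simp add: good_def has_weak_curl_def in_Lp_def)
    from periodic_borel_representative[OF this] show ?thesis by blast
  qed
  then have "\<forall>t\<in>A. \<exists>J. J \<in> borel_measurable borel \<and> periodic J \<and> (AE x in torus. J x = j t x)"
    by blast
  then obtain J where "\<forall>t\<in>A. J t \<in> borel_measurable borel \<and> periodic (J t) \<and> (AE x in torus. J t x = j t x)"
    by (rule bchoice[THEN exE])
  then have J: "\<And>t. t \<in> A \<Longrightarrow> J t \<in> borel_measurable borel" "\<And>t. t \<in> A \<Longrightarrow> periodic (J t)"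
    "\<And>t. t \<in> A \<Longrightarrow> AE x in torus. J t x = j t x"
    by simp_all
  interpret emhd_borel T "M\<^sub>0 powr 2" B
    using weak_form_transfer[OF T sol B_meas B_sq B_joint]
    by unfold_locales (auto intro: T B_meas B_per B_sq)

  obtain C where C: "C > 0" "\<And>\<epsilon>. 0 < \<epsilon> \<Longrightarrow> \<epsilon> < 1 \<Longrightarrow> \<exists>\<eta>. kernel \<eta> \<and>
    (\<forall>l\<in>unit_cube. \<not> (\<forall>i. \<epsilon> / 2 \<le> l $ i \<and> l $ i \<le> \<epsilon>) \<longrightarrow> \<eta> l = 0 \<and> (\<forall>k. pderiv_dir k \<eta> l = 0)) \<and>
    (\<forall>k. (\<integral>l. \<bar>pderiv_dir k \<eta> l\<bar> \<partial>torus) \<le> C / \<epsilon>)"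
    using kernel_exists by blast
  \<comment> \<open>The + 2 keeps the scale below 1 from n = 0 on, so that the support fits into the
    cube.\<close>
  define \<epsilon> where "\<epsilon> n = 1 / (real n + 2)" for n
  have \<epsilon>: "0 < \<epsilon> n" "\<epsilon> n < 1" for n by (auto simp: \<epsilon>_def divide_less_eq)
  have "(\<lambda>n. inverse (real (n + 2))) \<longlonglongrightarrow> 0"
    by (rule LIMSEQ_ignore_initial_segment[OF lim_inverse_n])
  then have \<epsilon>_lim: "\<epsilon> \<longlonglongrightarrow> 0" by (simp add: \<epsilon>_def[abs_def] inverse_eq_divide add.commute)
  have "\<forall>n. \<exists>\<eta>. kernel \<eta> \<and>
    (\<forall>l\<in>unit_cube. \<not> (\<forall>i. \<epsilon> n / 2 \<le> l $ i \<and> l $ i \<le> \<epsilon> n) \<longrightarrow> \<eta> l = 0 \<and> (\<forall>k. pderiv_dir k \<eta> l = 0)) \<and>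
    (\<forall>k. (\<integral>l. \<bar>pderiv_dir k \<eta> l\<bar> \<partial>torus) \<le> C / \<epsilon> n)"
    using C(2)[OF \<epsilon>] by blast
  then obtain \<eta> where ker: "\<And>n. kernel (\<eta> n)"
    and supp: "\<And>n l. l \<in> unit_cube \<Longrightarrow> \<not> (\<forall>i. \<epsilon> n / 2 \<le> l $ i \<and> l $ i \<le> \<epsilon> n) \<Longrightarrow> \<eta> n l = 0 \<and> (\<forall>k. pderiv_dir k (\<eta> n) l = 0)"
    and grad: "\<And>n k. (\<integral>l. \<bar>pderiv_dir k (\<eta> n) l\<bar> \<partial>torus) \<le> C / \<epsilon> n"
    by metis
  \<comment> \<open>On \<open>A\<close> this is the sum of the two weights; outside \<open>A\<close>
    both the flux and \<open>W\<close> are 0.\<close>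
  define W where "W t = indicator A t * (D\<^sub>1 t + D\<^sub>2 t)" for t
  have W_int: "integrable (time_measure T) W"
    unfolding W_def[abs_def] real_scaleR_def[symmetric]
    by (intro integrable_mult_indicator Bochner_Integration.integrable_add D\<^sub>1 D\<^sub>2) simp
  define c\<^sub>1 c\<^sub>2 where "c\<^sub>1 = 3 powr \<bar>\<alpha>\<bar>" and "c\<^sub>2 = 3 powr \<bar>\<beta>\<bar>"
  have c: "c\<^sub>1 > 0" "c\<^sub>2 > 0" by (simp_all add: c\<^sub>1_def c\<^sub>2_def)
  \<comment> \<open>All constants independent of n and t: 18 from the flux bound, \<open>C\<close>
    from the kernel gradient, the others from comparing powers of |l| and \<epsilon>.\<close>
  define K where "K = 18 * C * c\<^sub>1\<^sup>2 * c\<^sub>2"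
  have "K > 0" using C(1) c by (simp add: K_def)
  have flux: "\<forall>\<^sub>F n in sequentially. \<forall>t. \<bar>kernel.flux (\<eta> n) (B t)\<bar> \<le> \<delta> * W t" if "\<delta> > 0" for \<delta>
  proof -
    have "\<delta> / K > 0" using that \<open>K > 0\<close> by simp
    then obtain s1 s2 \<rho> where s: "s1 \<ge> 0" "s2 \<ge> 0" "s1\<^sup>2 * s2 \<le> \<delta> / K" and "\<rho> > 0"
      and near: "\<And>l. l \<noteq> 0 \<Longrightarrow> norm l < \<rho> \<Longrightarrow> l \<in> U \<and> \<sigma>\<^sub>1 l powr (1/3) \<le> s1 \<and> \<sigma>\<^sub>2 l powr (1/3) \<le> s2"
      using small_moduli[OF assms(12-18)] by blast
    \<comment> \<open>Displacements in the support are no longer than 3\<epsilon>.\<close>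
    have "\<forall>\<^sub>F n in sequentially. \<epsilon> n < \<rho> / 3"
      using \<open>\<rho> > 0\<close> by (intro order_tendstoD(2)[OF \<epsilon>_lim]) simp
    then show ?thesis
    proof eventually_elim
      case (elim n)
      interpret kernel "\<eta> n" by (rule ker)
      have "\<bar>flux (B t)\<bar> \<le> \<delta> * W t" for t
      proof (cases "t \<in> A")
        case False
        then have "B t = (\<lambda>x. 0)" by (simp add: B_def fun_eq_iff)
        then show ?thesis using False by (simp add: flux_zero W_def)
      next
        case True
        note g = A_good(1)[OF True, unfolded good_def]
        have j_norm: "integrable torus (\<lambda>x. norm (J t x))"
          using in_Lp_transfer(1)[OF J(1)[OF True] J(3)[OF True], of 1 "Lp_norm 1 (j t)"] g
          by (simp add: has_weak_curl_def)
        have b_norm: "integrable torus (\<lambda>x. norm (B t x))"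
          by (rule square_integrable_components(3)[OF B_sec B_sq(1)])
        interpret F: kernel_field "\<eta> n" "B t" "J t"
        proof
          show "div_free (B t)"
            by (rule weakly_div_free_transfer[OF B_sec B_eq[OF True] b_norm]) (use g in blast)
          show "curl_of (B t) (J t)"
            by (rule has_weak_curl_transfer[OF B_sec B_eq[OF True] J(1)[OF True] J(3)[OF True] b_norm]) (use g in blast)
        qed (use B_per B_sq J True j_norm in auto)
        define S where "S = {l::real^3. \<forall>i. \<epsilon> n / 2 \<le> l $ i \<and> l $ i \<le> \<epsilon> n}"
        define a\<^sub>1 a\<^sub>2 where "a\<^sub>1 = C\<^sub>1 t powr (1 / r\<^sub>1)" and "a\<^sub>2 = C\<^sub>2 t powr (1 / r\<^sub>2)"
        \<comment> \<open>Bounds for the increments of the field and of the current, uniform over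
          displacements in the support.\<close>
        define X where "X = a\<^sub>1 * (c\<^sub>1 * \<epsilon> n powr \<alpha>) * s1"
        define Y where "Y = a\<^sub>2 * (c\<^sub>2 * \<epsilon> n powr \<beta>) * s2"
        have a: "a\<^sub>1 \<ge> 0" "a\<^sub>2 \<ge> 0" by (simp_all add: a\<^sub>1_def a\<^sub>2_def)
        have XY: "X \<ge> 0" "Y \<ge> 0" using a c s by (auto simp: X_def Y_def)
        have l: "l \<in> U" "norm l powr \<alpha> \<le> c\<^sub>1 * \<epsilon> n powr \<alpha>" "norm l powr \<beta> \<le> c\<^sub>2 * \<epsilon> n powr \<beta>"
          "\<sigma>\<^sub>1 l powr (1/3) \<le> s1" "\<sigma>\<^sub>2 l powr (1/3) \<le> s2" if "l \<in> S" for l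
        proof -
          have n: "\<epsilon> n / 2 \<le> norm l" "norm l \<le> 3 * \<epsilon> n"
            using that norm_in_corner_box[of "\<epsilon> n" l] \<epsilon> by (auto simp: S_def)
          then have "l \<noteq> 0" "norm l < \<rho>" using \<epsilon>(1)[of n] elim by auto
          then show "l \<in> U" "\<sigma>\<^sub>1 l powr (1/3) \<le> s1" "\<sigma>\<^sub>2 l powr (1/3) \<le> s2" using near by auto
          show "norm l powr \<alpha> \<le> c\<^sub>1 * \<epsilon> n powr \<alpha>" "norm l powr \<beta> \<le> c\<^sub>2 * \<epsilon> n powr \<beta>"
            unfolding c\<^sub>1_def c\<^sub>2_def using n \<epsilon>(1) by (intro powr_comparable; simp)+
        qed
        have "\<bar>flux (B t)\<bar> \<le> 18 * (C / \<epsilon> n) * (Y * X\<^sup>2)"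
        proof (rule F.flux_increment_bound[where S = S])
          fix l assume lS: "l \<in> S"
          have "C\<^sub>1 t powr (1 / r\<^sub>1) * norm l powr \<alpha> * \<sigma>\<^sub>1 l powr (1/3) \<le> X"
            unfolding X_def a\<^sub>1_def[symmetric] using l[OF lS] a c by (intro mult_mono) auto
          then have "Lp_norm (9/2) (\<lambda>x. b t (x + l) - b t x) \<le> X" "in_Lp (9/2) (\<lambda>x. b t (x + l) - b t x)"
            using g l(1)[OF lS] by (blast intro: order_trans)+
          moreover have "periodic (b t)" using g by (simp add: in_Lp_def)
          ultimately show "(\<integral>\<^sup>+x. ennreal (norm (B t (x + l) - B t x) powr (9/2)) \<partial>torus) \<le> ennreal (X powr (9/2))"
            by (intro in_Lp_transfer(3)[OF _ AE_eq_translate[OF B_per _ B_eq[OF True]]]) auto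
          have "C\<^sub>2 t powr (1 / r\<^sub>2) * norm l powr \<beta> * \<sigma>\<^sub>2 l powr (1/3) \<le> Y"
            unfolding Y_def a\<^sub>2_def[symmetric] using l[OF lS] a c by (intro mult_mono) auto
          then have "Lp_norm (9/5) (\<lambda>x. j t (x + l) - j t x) \<le> Y" "in_Lp (9/5) (\<lambda>x. j t (x + l) - j t x)"
            using g l(1)[OF lS] by (blast intro: order_trans)+
          moreover have "periodic (j t)" using g by (simp add: has_weak_curl_def in_Lp_def)
          moreover have [measurable]: "J t \<in> borel_measurable borel" by (rule J(1)[OF True])
          ultimately show "(\<integral>\<^sup>+x. ennreal (norm (J t (x + l) - J t x) powr (9/5)) \<partial>torus) \<le> ennreal (Y powr (9/5))"
            by (intro in_Lp_transfer(3)[OF _ AE_eq_translate[OF J(2)[OF True] _ J(3)[OF True]]]) auto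
        qed (use XY supp[of _ n] grad in \<open>auto simp: S_def\<close>)
        \<comment> \<open>The 1/\<epsilon> of the kernel gradient, two factors \<epsilon>^\<alpha>
          and one \<epsilon>^\<beta> combine to the power 2\<alpha> + \<beta> - 1.\<close>
        also have "\<dots> = K * (\<epsilon> n powr (2 * \<alpha> + \<beta> - 1)) * (a\<^sub>1\<^sup>2 * a\<^sub>2) * (s1\<^sup>2 * s2)"
        proof -
          have "\<epsilon> n powr (2 * \<alpha> + \<beta> - 1) = (\<epsilon> n powr \<alpha>)\<^sup>2 * \<epsilon> n powr \<beta> / \<epsilon> n"
          proof -
            have e: "2 * \<alpha> + \<beta> - 1 = \<alpha> + \<alpha> + \<beta> - 1" by simp
            have "\<epsilon> n powr 1 = \<epsilon> n" using \<epsilon>(1)[of n] by (simp add: powr_one)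
            then show ?thesis by (simp only: e powr_diff powr_add power2_eq_square)
          qed
          then show ?thesis
            by (simp only: K_def X_def Y_def power_mult_distrib divide_inverse ac_simps)
        qed
        \<comment> \<open>Three separate bounds: the power of \<epsilon> is at most 1 because
          \<epsilon> is below 1 and the exponent is nonnegative, the weights fall to Young's
          inequality, and the moduli to the choice of \<open>s1\<close> and
          \<open>s2\<close>.\<close>
        also have "\<dots> \<le> K * 1 * (C\<^sub>1 t + C\<^sub>2 t) * (\<delta> / K)"
        proof (intro mult_mono)
          show "\<epsilon> n powr (2 * \<alpha> + \<beta> - 1) \<le> 1"
            using \<epsilon>[of n] assms(7) by (intro powr_le1) auto
          have nn: "C\<^sub>1 t \<ge> 0" "C\<^sub>2 t \<ge> 0"
            using C\<^sub>1_nonneg C\<^sub>2_nonneg A_good(2)[OF True] by auto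
          show "a\<^sub>1\<^sup>2 * a\<^sub>2 \<le> C\<^sub>1 t + C\<^sub>2 t"
            unfolding a\<^sub>1_def a\<^sub>2_def by (rule young_time_weights[OF assms(4-6) nn])
          show "0 \<le> K * 1 * (C\<^sub>1 t + C\<^sub>2 t)" using nn \<open>K > 0\<close> by simp
        qed (use s a \<open>K > 0\<close> in auto)
        also have "\<dots> = \<delta> * W t" using \<open>K > 0\<close> g True by (simp add: W_def)
        finally show ?thesis .
      qed
      then show ?case by blast
    qed
  qed
  have "\<exists>c. AE t in time_measure T. (\<integral>x. (norm (B t x))\<^sup>2 \<partial>torus) = c"
  proof (rule energy_constant[OF ker _ _ W_int flux])
    show "norm l \<le> 3 * \<epsilon> n" if "l \<in> unit_cube" "\<eta> n l \<noteq> 0" for n l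
      using that supp[of l n] norm_in_corner_box(2)[of "\<epsilon> n" l] \<epsilon>(1) by blast
    have "(\<lambda>n. 3 * \<epsilon> n) \<longlonglongrightarrow> 3 * 0" by (intro tendsto_intros \<epsilon>_lim)
    then show "(\<lambda>n. 3 * \<epsilon> n) \<longlonglongrightarrow> 0" by simp
  qed
  then obtain e where "AE t in time_measure T. (\<integral>x. (norm (B t x))\<^sup>2 \<partial>torus) = e" by blast
  then have "AE t in time_measure T. energy (b t) = 1 / 2 * e"
    using A_AE
  proof eventually_elim
    case (elim t)
    have "AE x in torus. (norm (b t x))\<^sup>2 = (norm (B t x))\<^sup>2"
      using B_eq[OF elim(2)] by (rule eventually_mono) simp
    from torus_transfer(1)[OF _ this] elim(1) show ?case by (simp add: energy_def)
  qed
  then show ?thesis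
    unfolding energy_conserved_def AE_lebesgue_on_time by blast
qed

end
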